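(* Let $k,N\in\mathbb N$, let $\Omega\subset\mathbb R^k$ be open, let $\mathbb K\in\{\mathbb R,\mathbb C\}$, and let $f_1,\dots,f_N\colon\Omega\to\Omega$, $g_1,\dots,g_N\colon\Omega\to\mathbb K$, $h_0\colon\Omega\to\mathbb K$ be functions satisfying hypothesis (H) (with constants $K$ and $L$ as in (H)). Let $\psi$ be as in the context and assume $h_0\in L^{\psi,1}(\Omega,\mathbb K)$. Suppose there is a real constant $\alpha\in[0,\tfrac12)$ such that $$|g_n(x)|\le \alpha\min\Big\{\frac{|J_{f_n}(x)|}{KL},\frac1N\Big\}\quad\text{for all } n\in\{1,\dots,N\}\text{ and almost all }x\in\Omega.$$ Then the elementary solution of the equation $\varphi(x)=\sum_{n=1}^N g_n(x)\varphi(f_n(x))+h_0(x)$ in $L^{\psi,1}(\Omega,\mathbb K)$ exists, it is the unique solution of this equation in $L^{\psi,1}(\Omega,\mathbb K)$, and for every $j\in\mathbb N\cup\{0\}$ $$\Big\|\sum_{i=j}^\infty P^i h_0\Big\|_{L^{\psi,1}(\Omega,\mathbb K)}\le \frac{(2\alpha)^j}{1-2\alpha}\|h_0\|_{L^{\psi,1}(\Omega,\mathbb K)}.$$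
   Context: $\mu$ denotes $k$-dimensional Lebesgue measure. A Young function is a non-decreasing, left-continuous, convex $\Psi\colon[0,\infty)\to[0,\infty]$ with $\lim_{t\to0+}\Psi(t)=\Psi(0)=0$ and $\lim_{t\to\infty}\Psi(t)=\infty$. Fix a strictly increasing Young function $\psi\colon[0,\infty)\to[0,\infty)$ satisfying $\Delta_2$ globally (there is $d\in(1,\infty)$ with $\psi(2t)\le d\psi(t)$ for all $t>0$) and $\lim_{t\to0+}\psi(t)/t=\lim_{t\to\infty}t/\psi(t)=0$. Define $\tau(0)=0$ and $\tau(t)=1/\psi(1/t)$ for $t>0$; $\tau$ is a strictly increasing bijection of $[0,\infty)$, and $\tau^{-1}$ denotes its inverse (with $\tau^{-1}(\infty)=\infty$). For measurable $f\colon\Omega\to\mathbb K$ the distribution function is $\mu_f(s)=\mu(\{x\in\Omega:|f(x)|>s\})$. The Lorentz space $L^{\psi,1}(\Omega,\mathbb K)$ is the set of $f\in L^1_{\mathrm{loc}}(\Omega,\mathbb K)$ with $\|f\|_{L^{\psi,1}(\Omega,\mathbb K)}:=\int_0^\infty\tau^{-1}(\mu_f(s))\,ds<\infty$ (functions equal a.e. identified). Approximate differential: a linear map $A\colon\mathbb R^k\to\mathbb R^k$ is an approximate differential of a measurable $F\colon\Omega\to\mathbb R^k$ at $x_0$ if for every $\varepsilon>0$ the point $x_0$ is a density point of $\{x\in\Omega\setminus\{x_0\}:\|F(x)-F(x_0)-A(x-x_0)\|/\|x-x_0\|<\varepsilon\}$. $J_F(x)$ is the determinant of the approximate differential of $F$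 at $x$, set to $0$ where $F$ is not approximately differentiable. $F$ satisfies Luzin's condition N if it maps Lebesgue-null sets to Lebesgue-null sets. Hypothesis (H): $f_1,\dots,f_N$ are measurable, almost everywhere approximately differentiable and satisfy Luzin's condition N; for every $n$ and every null set $M\subset\mathbb R^k$, $f_n^{-1}(M)$ is null; there is $K\in\mathbb N$ such that for every $n$ the set $\{x\in\Omega:\operatorname{card} f_n^{-1}(x)>K\}$ is null; $g_1,\dots,g_N,h_0$ are measurable; and $L=\max\{l\in\{1,\dots,N\}: \mu(\bigcap_{i=1}^l f_{n_i}(\Omega))>0\text{ for some } n_1<\dots<n_l\}$. The operator $P$ is $P\psi=\sum_{n=1}^N g_n\cdot(\psi\circ f_n)$. The elementary solution of the equation in a normed function space $\mathcal F_0$ is the series $\sum_{i=0}^\infty P^i h_0$, when it converges in the norm of $\mathcal F_0$ to a function in $\mathcal F_0$ solving the equation. *)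

theory Defs
  imports "HOL-Analysis.Analysis"
begin

definition young_function :: "(real \<Rightarrow> real) \<Rightarrow> bool" where
  "young_function \<Psi> \<longleftrightarrow>
     mono_on {0..} \<Psi> \<and>
     (\<forall>t>0. continuous (at_left t) \<Psi>) \<and>
     convex_on {0..} \<Psi> \<and>
     (\<forall>t\<ge>0. \<Psi> t \<ge> 0) \<and>
     \<Psi> 0 = 0 \<and> (\<Psi> \<longlongrightarrow> 0) (at_right 0) \<and>
     filterlim \<Psi> at_top at_top"

definition admissible_psi :: "(real \<Rightarrow> real) \<Rightarrow> bool" where
  "admissible_psi \<psi> \<longleftrightarrow>
     young_function \<psi> \<and>
     strict_mono_on {0..} \<psi> \<and>
     (\<exists>d>1. \<forall>t>0. \<psi> (2 * t) \<le> d * \<psi> t) \<and>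
     ((\<lambda>t. \<psi> t / t) \<longlongrightarrow> 0) (at_right 0) \<and>
     ((\<lambda>t. t / \<psi> t) \<longlongrightarrow> 0) at_top"

definition tau :: "(real \<Rightarrow> real) \<Rightarrow> real \<Rightarrow> real" where
  "tau \<psi> t = (if t = 0 then 0 else 1 / \<psi> (1 / t))"

definition tau_inv :: "(real \<Rightarrow> real) \<Rightarrow> ennreal \<Rightarrow> ennreal" where
  "tau_inv \<psi> x = (if x = \<infinity> then \<infinity>
                   else ennreal (the_inv_into {0..} (tau \<psi>) (enn2real x)))"

definition distrib_fun :: "('a::euclidean_space) set \<Rightarrow> ('a \<Rightarrow> 'b::real_normed_vector) \<Rightarrow> real \<Rightarrow> ennreal" where
  "distrib_fun \<Omega> f s = emeasure lebesgue {x \<in> \<Omega>. norm (f x) > s}"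

definition lorentz_enorm :: "(real \<Rightarrow> real) \<Rightarrow> ('a::euclidean_space) set \<Rightarrow> ('a \<Rightarrow> 'b::real_normed_vector) \<Rightarrow> ennreal" where
  "lorentz_enorm \<psi> \<Omega> f = (\<integral>\<^sup>+ s. indicator {0..} s * tau_inv \<psi> (distrib_fun \<Omega> f s) \<partial>lborel)"

definition lorentz_norm :: "(real \<Rightarrow> real) \<Rightarrow> ('a::euclidean_space) set \<Rightarrow> ('a \<Rightarrow> 'b::real_normed_vector) \<Rightarrow> real" where
  "lorentz_norm \<psi> \<Omega> f = enn2real (lorentz_enorm \<psi> \<Omega> f)"

definition locally_integrable_on :: "('a::euclidean_space) set \<Rightarrow> ('a \<Rightarrow> 'b::{banach,second_countable_topology}) \<Rightarrow> bool" where
  "locally_integrable_on \<Omega> f \<longleftrightarrow>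
     f \<in> borel_measurable (restrict_space lebesgue \<Omega>) \<and>
     (\<forall>C. compact C \<and> C \<subseteq> \<Omega> \<longrightarrow> set_integrable lebesgue C f)"

text \<open>Membership in L^{\<psi>,1}(\<Omega>) (functions taken as representatives; a.e.-equal
  functions are identified in all statements by using AE-equalities).\<close>
definition lorentz_space :: "(real \<Rightarrow> real) \<Rightarrow> ('a::euclidean_space) set \<Rightarrow> ('a \<Rightarrow> 'b::{banach,second_countable_topology}) set" where
  "lorentz_space \<psi> \<Omega> = {f. locally_integrable_on \<Omega> f \<and> lorentz_enorm \<psi> \<Omega> f < \<infinity>}"

definition density_point :: "(real^'n) set \<Rightarrow> real^'n \<Rightarrow> bool" where
  "density_point E x0 \<longleftrightarrow>
     ((\<lambda>r. measure lebesgue (E \<inter> ball x0 r) / measure lebesgue (ball x0 r)) \<longlongrightarrow> 1) (at_right 0)"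

definition approx_differential ::
  "(real^'n) set \<Rightarrow> (real^'n \<Rightarrow> real^'n) \<Rightarrow> (real^'n \<Rightarrow> real^'n) \<Rightarrow> real^'n \<Rightarrow> bool" where
  "approx_differential \<Omega> F A x0 \<longleftrightarrow> linear A \<and>
     (\<forall>\<epsilon>>0. density_point
        {x \<in> \<Omega> - {x0}. norm (F x - F x0 - A (x - x0)) / norm (x - x0) < \<epsilon>} x0)"

definition approx_differentiable :: "(real^'n) set \<Rightarrow> (real^'n \<Rightarrow> real^'n) \<Rightarrow> real^'n \<Rightarrow> bool" where
  "approx_differentiable \<Omega> F x0 \<longleftrightarrow> (\<exists>A. approx_differential \<Omega> F A x0)"

definition approx_jacobian :: "(real^'n) set \<Rightarrow> (real^'n \<Rightarrow> real^'n) \<Rightarrow> real^'n \<Rightarrow> real" where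
  "approx_jacobian \<Omega> F x =
     (if approx_differentiable \<Omega> F x
      then det (matrix (SOME A. approx_differential \<Omega> F A x)) else 0)"

definition luzin_N :: "(real^'n) set \<Rightarrow> (real^'n \<Rightarrow> real^'n) \<Rightarrow> bool" where
  "luzin_N \<Omega> F \<longleftrightarrow> (\<forall>M. M \<subseteq> \<Omega> \<and> M \<in> null_sets lebesgue \<longrightarrow> F ` M \<in> null_sets lebesgue)"

definition hypothesis_H ::
  "(real^'n) set \<Rightarrow> nat \<Rightarrow> (nat \<Rightarrow> real^'n \<Rightarrow> real^'n) \<Rightarrow> (nat \<Rightarrow> real^'n \<Rightarrow> 'b::real_normed_vector)
   \<Rightarrow> (real^'n \<Rightarrow> 'b) \<Rightarrow> nat \<Rightarrow> bool" where
  "hypothesis_H \<Omega> N f g h0 K \<longleftrightarrow>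
     (\<forall>n\<in>{1..N}.
        f n \<in> borel_measurable (restrict_space lebesgue \<Omega>) \<and>
        (AE x in lebesgue. x \<in> \<Omega> \<longrightarrow> approx_differentiable \<Omega> (f n) x) \<and>
        luzin_N \<Omega> (f n) \<and>
        (\<forall>M. M \<in> null_sets lebesgue \<longrightarrow> f n -` M \<inter> \<Omega> \<in> null_sets lebesgue) \<and>
        {x \<in> \<Omega>. infinite (f n -` {x} \<inter> \<Omega>) \<or> card (f n -` {x} \<inter> \<Omega>) > K} \<in> null_sets lebesgue \<and>
        g n \<in> borel_measurable (restrict_space lebesgue \<Omega>)) \<and>
     h0 \<in> borel_measurable (restrict_space lebesgue \<Omega>)"

definition L_const :: "(real^'n) set \<Rightarrow> nat \<Rightarrow> (nat \<Rightarrow> real^'n \<Rightarrow> real^'n) \<Rightarrow> nat" where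
  "L_const \<Omega> N f = Max {l \<in> {1..N}. \<exists>S. S \<subseteq> {1..N} \<and> card S = l \<and>
                               emeasure lebesgue (\<Inter>n\<in>S. f n ` \<Omega>) > 0}"

definition P_op :: "nat \<Rightarrow> (nat \<Rightarrow> 'a \<Rightarrow> 'a) \<Rightarrow> (nat \<Rightarrow> 'a \<Rightarrow> 'b::real_normed_algebra) \<Rightarrow> ('a \<Rightarrow> 'b) \<Rightarrow> ('a \<Rightarrow> 'b)" where
  "P_op N f g \<phi> = (\<lambda>x. \<Sum>n\<in>{1..N}. g n x * \<phi> (f n x))"

end

theory Submission
  imports Defs
begin

text \<open>
  Write \<open>\<sigma>\<close> for the inverse of \<open>\<tau>\<close>. Convexity of \<open>\<psi>\<close> makes \<open>\<sigma> s / s\<close> non-increasing, but \<open>\<sigma>\<close> need not be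
  concave, so \<open>\<parallel>w\<parallel> = \<integral> \<sigma> (\<mu> {w > s}) ds\<close> is only a quasi-norm. It still satisfies
  \<open>\<parallel>v + R w\<parallel> \<le> \<parallel>v\<parallel> + 2 c \<parallel>w\<parallel>\<close> for every positive operator \<open>R\<close> bounded by \<open>c\<close> on \<open>L\<^sup>1\<close> and on \<open>L\<^sup>\<infinity>\<close>: adding
  \<open>c\<close> times the indicator of a set of measure \<open>m\<close> changes the quasi-norm by at most \<open>c \<sigma> t (1 + m / t)\<close> for every
  \<open>t > 0\<close>, which is affine in \<open>m\<close> and hence compatible with averaging over level sets. For \<open>t = m\<close> it
  is \<open>2 c \<sigma> m\<close>.

  The operator \<open>\<phi> \<mapsto> \<Sum>n. \<bar>g n\<bar> * \<phi> \<circ> f n\<close> is bounded by \<open>\<alpha>\<close> on both spaces. On \<open>L\<^sup>1\<close> this is an area inequality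
  for approximately differentiable maps, obtained by splitting \<open>\<Omega>\<close> up to a null set into countably many
  measurable pieces on which the map is differentiable, and injective where the Jacobian does not vanish.
  Hence the tail \<open>\<Sum>i\<ge>j\<close> of the Neumann series is bounded by \<open>\<alpha>\<^sup>j / (1 - \<alpha>)\<close> on both spaces. The estimate
  with \<open>v = 0\<close> settles \<open>j \<ge> 1\<close>, and with \<open>v = \<bar>h0\<bar>\<close>, \<open>j = 1\<close> it gives the bound for \<open>j = 0\<close>, because
  \<open>1 + 2 \<alpha> / (1 - \<alpha>) \<le> 1 / (1 - 2 \<alpha>)\<close>.
\<close>

section \<open>A quasi-norm given by level sets\<close>

text \<open>Two layer decompositions are nested: \<open>w\<close> is an average of indicators of its
  level sets A, and each R 1_A is an average of indicators of its own level sets B. About a single B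
  little is known; it is null above height c, and the measures of all B integrate to at most c *
  \<mu> A. A bound by \<sigma> (\<mu> B) could not be averaged, for lack of concavity, whereas
  \<sigma> t + \<mu> B * \<sigma> t / t with one t for all B can: the sup bound pays for the first
  summand, the L^1 bound for the second. Taking t = \<mu> A bounds both by c * \<sigma> (\<mu> A),
  and averaging over the sets A loses nothing, since the quasi-norm of \<open>w\<close> is itself
  the integral of \<sigma> (\<mu> A). The estimates run over functions with values in
  [0, \<infinity>], where sums and suprema need no convergence; signs and complex values enter only
  through the pointwise bound |P \<phi>| \<le> p |\<phi>|.\<close>

lemma antimono_ennreal_borel_measurable:
  fixes G :: "real \<Rightarrow> ennreal"
  assumes "antimono G"
  shows "G \<in> borel_measurable borel"
proof (rule borel_measurableI_greater)
  fix y
  have "is_interval {s. y < G s}"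
    unfolding is_interval_1 using assms by (auto simp: antimono_def intro: less_le_trans)
  then show "{x \<in> space borel. y < G x} \<in> sets borel"
    by (simp add: real_interval_borel_measurable)
qed

definition layer_integral :: "(ennreal \<Rightarrow> ennreal) \<Rightarrow> 'a measure \<Rightarrow> ('a \<Rightarrow> ennreal) \<Rightarrow> ennreal" where
  "layer_integral \<sigma> M w =
     (\<integral>\<^sup>+ s. indicator {0..} s * \<sigma> (emeasure M {x \<in> space M. ennreal s < w x}) \<partial>lborel)"

text \<open>\<open>slope\<close> encodes that \<sigma> s / s is non-increasing: \<sigma> (x + h)
  \<le> (x + h) * \<sigma> x / x and \<sigma> x / x \<le> \<sigma> t / t. The additive form leaves h
  free to be infinite. \<open>sigma_SUP\<close> is left continuity, which carries monotone
  convergence over from the measure to the quasi-norm.\<close>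

locale quasiconcave =
  fixes \<sigma> :: "ennreal \<Rightarrow> ennreal"
  assumes mono_sigma: "mono \<sigma>"
    and sigma_SUP: "incseq X \<Longrightarrow> \<sigma> (SUP n::nat. X n) = (SUP n. \<sigma> (X n))"
    and sigma_eq_0: "\<sigma> x = 0 \<longleftrightarrow> x = 0"
    and sigma_finite: "\<sigma> x < \<infinity> \<longleftrightarrow> x < \<infinity>"
    and slope: "0 < t \<Longrightarrow> t \<le> x \<Longrightarrow> x < \<infinity> \<Longrightarrow> \<sigma> (x + h) \<le> \<sigma> x + h * (\<sigma> t / t)"
begin

lemma antimono_level:
  assumes "w \<in> borel_measurable M"
  shows "antimono (\<lambda>s. \<sigma> (emeasure M {x \<in> space M. ennreal s < w x}))"
proof (rule antimonoI)
  fix r s :: real assume "r \<le> s"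
  then have "emeasure M {x \<in> space M. ennreal s < w x} \<le> emeasure M {x \<in> space M. ennreal r < w x}"
    using assms by (intro emeasure_mono) (auto intro: le_less_trans[OF ennreal_leI])
  then show "\<sigma> (emeasure M {x \<in> space M. ennreal s < w x}) \<le> \<sigma> (emeasure M {x \<in> space M. ennreal r < w x})"
    by (rule monoD[OF mono_sigma])
qed

lemma level_measurable [measurable]:
  assumes "w \<in> borel_measurable M"
  shows "(\<lambda>s. \<sigma> (emeasure M {x \<in> space M. ennreal s < w x})) \<in> borel_measurable borel"
  by (rule antimono_ennreal_borel_measurable[OF antimono_level[OF assms]])

lemma layer_integral_mono_AE:
  assumes "AE x in M. w x \<le> v x" "v \<in> borel_measurable M"
  shows "layer_integral \<sigma> M w \<le> layer_integral \<sigma> M v"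
  unfolding layer_integral_def
proof (intro nn_integral_mono mult_left_mono monoD[OF mono_sigma])
  fix s
  show "emeasure M {x \<in> space M. ennreal s < w x} \<le> emeasure M {x \<in> space M. ennreal s < v x}"
    using assms by (intro emeasure_mono_AE) auto
qed auto

lemma layer_integral_cong_AE:
  assumes "AE x in M. w x = v x" "w \<in> borel_measurable M" "v \<in> borel_measurable M"
  shows "layer_integral \<sigma> M w = layer_integral \<sigma> M v"
  using assms by (intro antisym layer_integral_mono_AE) auto

lemma layer_integral_SUP:
  assumes w: "\<And>n::nat. w n \<in> borel_measurable M" and inc: "\<And>x. incseq (\<lambda>n. w n x)"
  shows "layer_integral \<sigma> M (\<lambda>x. SUP n. w n x) = (SUP n. layer_integral \<sigma> M (w n))"
proof -
  have lev: "\<sigma> (emeasure M {x \<in> space M. ennreal s < (SUP n. w n x)})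
      = (SUP n. \<sigma> (emeasure M {x \<in> space M. ennreal s < w n x}))" for s
  proof -
    have inc': "incseq (\<lambda>n. {x \<in> space M. ennreal s < w n x})"
      using inc by (auto simp: incseq_def intro: less_le_trans)
    have "{x \<in> space M. ennreal s < (SUP n. w n x)} = (\<Union>n. {x \<in> space M. ennreal s < w n x})"
      by (auto simp: less_SUP_iff)
    then have "emeasure M {x \<in> space M. ennreal s < (SUP n. w n x)}
        = (SUP n. emeasure M {x \<in> space M. ennreal s < w n x})"
      using SUP_emeasure_incseq[OF _ inc'] w by (simp add: image_subset_iff)
    moreover have "incseq (\<lambda>n. emeasure M {x \<in> space M. ennreal s < w n x})"
      using inc' w by (auto simp: incseq_def intro!: emeasure_mono)
    ultimately show ?thesis by (simp add: sigma_SUP)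
  qed
  have "layer_integral \<sigma> M (\<lambda>x. SUP n. w n x)
    = (\<integral>\<^sup>+ s. (SUP n. indicator {0..} s * \<sigma> (emeasure M {x \<in> space M. ennreal s < w n x})) \<partial>lborel)"
    unfolding layer_integral_def lev by (simp add: SUP_mult_left_ennreal)
  also have "\<dots> = (SUP n. layer_integral \<sigma> M (w n))"
    unfolding layer_integral_def
  proof (rule nn_integral_monotone_convergence_SUP)
    show "incseq (\<lambda>n s. indicator {0..} s * \<sigma> (emeasure M {x \<in> space M. ennreal s < w n x}))"
      unfolding incseq_def le_fun_def
    proof (intro allI impI mult_left_mono monoD[OF mono_sigma])
      fix m n :: nat and s assume "m \<le> n"
      then show "emeasure M {x \<in> space M. ennreal s < w m x} \<le> emeasure M {x \<in> space M. ennreal s < w n x}"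
        using inc w by (intro emeasure_mono) (auto simp: incseq_def intro: less_le_trans)
    qed auto
    show "(\<lambda>s. indicator {0..} s * \<sigma> (emeasure M {x \<in> space M. ennreal s < w n x})) \<in> borel_measurable lborel" for n
      using level_measurable[OF w] by simp
  qed
  finally show ?thesis .
qed

text \<open>The increment of \<sigma> over [b + a', b + a] is split at t: below t it is kept as an
  increment of \<sigma> (min _ t), so that it can telescope, and above t \<open>slope\<close> bounds
  it by (a - a') * \<sigma> t / t. Differences are moved to the other side because subtraction on
  \<open>ennreal\<close> truncates.\<close>

lemma sigma_exchange:
  assumes "0 < t" "t < \<infinity>" "a' \<le> a" "a < \<infinity>"
  shows "\<sigma> (b + a) + \<sigma> (min (b + a') t) + a' * (\<sigma> t / t)
       \<le> \<sigma> (b + a') + \<sigma> (min (b + a) t) + a * (\<sigma> t / t)"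
proof -
  obtain d where d: "a = a' + d" using \<open>a' \<le> a\<close> by (auto simp: le_iff_add)
  let ?k = "\<sigma> t / t"
  consider "b = \<infinity>" | "b < \<infinity>" "t \<le> b + a'" | "b < \<infinity>" "b + a' < t" "t \<le> b + a" | "b + a < t"
    by (metis infinity_ennreal_def linorder_not_less not_less_iff_gr_or_eq top.not_eq_extremum)
  then show ?thesis
  proof cases
    case 1
    then have "\<sigma> b = \<infinity>" using sigma_finite[of b] by (simp add: less_top[symmetric])
    with 1 show ?thesis by simp
  next
    case 2
    then have "t \<le> b + a" using \<open>a' \<le> a\<close> by (metis add_left_mono order_trans)
    have "\<sigma> (b + a' + d) \<le> \<sigma> (b + a') + d * ?k"
      using 2 assms d by (intro slope) (auto simp: less_top[symmetric])
    then have "\<sigma> (b + a' + d) + (\<sigma> t + a' * ?k) \<le> (\<sigma> (b + a') + d * ?k) + (\<sigma> t + a' * ?k)"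
      by (rule add_right_mono)
    then show ?thesis
      using 2 \<open>t \<le> b + a\<close> by (simp add: d min_absorb2 algebra_simps)
  next
    case 3
    obtain e where e: "b + a = t + e" using 3 by (auto simp: le_iff_add)
    have "e \<le> d"
    proof -
      have "t + e \<le> t + d" using 3 e d
        by (metis add.assoc add_right_mono less_imp_le)
      then show ?thesis using assms(2) by (auto simp: ennreal_add_left_cancel_le)
    qed
    have "\<sigma> (t + e) \<le> \<sigma> t + e * ?k" using assms by (intro slope) auto
    also have "\<dots> \<le> \<sigma> t + d * ?k" using \<open>e \<le> d\<close> by (intro add_left_mono mult_right_mono) auto
    finally have "\<sigma> (t + e) + (\<sigma> (b + a') + a' * ?k) \<le> (\<sigma> t + d * ?k) + (\<sigma> (b + a') + a' * ?k)"
      by (rule add_right_mono)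
    moreover have "min (b + a) t = t" "min (b + a') t = b + a'" using 3 by auto
    ultimately show ?thesis unfolding e[symmetric] by (simp add: d algebra_simps)
  next
    case 4
    then have "b + a' < t" using \<open>a' \<le> a\<close> by (metis add_left_mono le_less_trans)
    have "a' * ?k \<le> a * ?k" using \<open>a' \<le> a\<close> by (intro mult_right_mono) auto
    with 4 \<open>b + a' < t\<close> show ?thesis
      by (simp add: add.commute add_left_mono min_absorb1)
  qed
qed

text \<open>The levels \<open>b i + a i\<close> and \<open>b i + a (i - 1)\<close>, where \<open>a (-1) = m\<close>, bound pairwise disjoint intervals of total length at
  most \<open>m\<close>. Those below \<open>t\<close> contribute at most \<open>\<sigma> t\<close>, those above \<open>t\<close> have slope at most \<open>\<sigma> t / t\<close>.\<close>

lemma sigma_telescope: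
  assumes t: "0 < t" "t < \<infinity>" and m: "m < \<infinity>"
    and a: "decseq a" "a 0 \<le> m" and b: "decseq b"
  shows "(\<Sum>i<n. \<sigma> (b i + (case i of 0 \<Rightarrow> m | Suc j \<Rightarrow> a j)))
       \<le> (\<Sum>i<n. \<sigma> (b i + a i)) + (\<sigma> t + m * (\<sigma> t / t))"
proof -
  let ?k = "\<sigma> t / t"
  let ?a = "\<lambda>i. case i of 0 \<Rightarrow> m | Suc j \<Rightarrow> a j"
  let ?x = "\<lambda>i. case i of 0 \<Rightarrow> t | Suc j \<Rightarrow> min (b j + a j) t"
  have am: "a i \<le> m" for i using a decseqD[OF a(1), of 0 i] by auto
  \<comment> \<open>The claim is strengthened by the budget not yet spent: the values of \<sigma>
    below \<open>?x n\<close>, and the slope on the remaining length \<open>?a n\<close>. The next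
    interval, cut off at t, ends below \<open>?x n\<close> because \<open>b\<close>
    decreases.\<close>
  have "(\<Sum>i<n. \<sigma> (b i + ?a i)) + (\<sigma> (?x n) + ?a n * ?k) \<le> (\<Sum>i<n. \<sigma> (b i + a i)) + (\<sigma> t + m * ?k)"
  proof (induction n)
    case 0 then show ?case by simp
  next
    case (Suc n)
    have a_le: "a n \<le> ?a n" using am decseqD[OF a(1)] by (cases n) auto
    have a_fin: "?a n < \<infinity>" using am m by (cases n) (auto intro: le_less_trans)
    have x: "min (b n + ?a n) t \<le> ?x n"
    proof (cases n)
      case (Suc j)
      have "b n + a j \<le> b j + a j" using decseqD[OF b, of j n] Suc by (intro add_right_mono) auto
      then show ?thesis using Suc by (auto simp: min_le_iff_disj)
    qed auto
    have "\<sigma> (b n + ?a n) + (\<sigma> (min (b n + a n) t) + a n * ?k)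
        \<le> \<sigma> (b n + a n) + \<sigma> (min (b n + ?a n) t) + ?a n * ?k"
      using sigma_exchange[OF t a_le a_fin, of "b n"] by (simp add: add.assoc)
    also have "\<dots> \<le> \<sigma> (b n + a n) + (\<sigma> (?x n) + ?a n * ?k)"
      using monoD[OF mono_sigma x] by (auto simp: add.assoc intro!: add_mono)
    finally have "(\<Sum>i<n. \<sigma> (b i + ?a i)) + (\<sigma> (b n + ?a n) + (\<sigma> (min (b n + a n) t) + a n * ?k))
        \<le> (\<Sum>i<n. \<sigma> (b i + ?a i)) + (\<sigma> (b n + a n) + (\<sigma> (?x n) + ?a n * ?k))"
      by (rule add_left_mono)
    also have "\<dots> = ((\<Sum>i<n. \<sigma> (b i + ?a i)) + (\<sigma> (?x n) + ?a n * ?k)) + \<sigma> (b n + a n)"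
      by (simp add: ac_simps)
    also have "\<dots> \<le> ((\<Sum>i<n. \<sigma> (b i + a i)) + (\<sigma> t + m * ?k)) + \<sigma> (b n + a n)"
      by (rule add_right_mono[OF Suc.IH])
    finally show ?case by (simp add: ac_simps)
  qed
  then show ?thesis by (rule order_trans[rotated]) simp
qed

end

text \<open>Adding c on a set moves its level s to level s + c, so the levels before and after are
  best compared along one residue class s + i * c at a time. The factor c of the estimate below is
  the length of the interval of residues.\<close>

lemma nn_integral_fold:
  fixes G :: "real \<Rightarrow> ennreal"
  assumes c: "0 < c" and G[measurable]: "G \<in> borel_measurable borel"
  shows "(\<integral>\<^sup>+ s. indicator {0..} s * G s \<partial>lborel)
       = (\<integral>\<^sup>+ s. indicator {0..<c} s * (\<Sum>i. G (s + real i * c)) \<partial>lborel)"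
proof -
  have ind: "indicator {0..} s = (\<Sum>i. indicator {0..<c} (s - real i * c) :: ennreal)" for s :: real
  proof (cases "0 \<le> s")
    case True
    define k where "k = nat \<lfloor>s / c\<rfloor>"
    have k: "real k \<le> s / c" "s / c < real k + 1"
      unfolding k_def using True c by (auto simp: of_nat_nat)
    have "indicator {0..<c} (s - real i * c) = (if i = k then 1 else 0 :: ennreal)" for i
    proof -
      have "0 \<le> s - real i * c \<and> s - real i * c < c \<longleftrightarrow> real i \<le> s / c \<and> s / c < real i + 1"
        using c by (auto simp: field_simps)
      also have "\<dots> \<longleftrightarrow> i = k" using k by (intro iffI conjI) (linarith | simp)+
      finally show ?thesis by (auto simp: indicator_def)
    qed
    then have "(\<Sum>i. indicator {0..<c} (s - real i * c) :: ennreal) = (\<Sum>i. if i = k then 1 else 0)"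
      by simp
    also have "\<dots> = 1" using sums_single[of k "\<lambda>_. 1::ennreal"] by (simp add: sums_iff)
    finally show ?thesis using True by simp
  next
    case False
    then have "indicator {0..<c} (s - real i * c) = (0::ennreal)" for i
    proof -
      have "s - real i * c < 0" using False c by (smt (verit) mult_nonneg_nonneg of_nat_0_le_iff)
      then show ?thesis by (simp add: indicator_def)
    qed
    then show ?thesis using False by simp
  qed
  have "(\<integral>\<^sup>+ s. indicator {0..} s * G s \<partial>lborel)
      = (\<integral>\<^sup>+ s. (\<Sum>i. indicator {0..<c} (s - real i * c) * G s) \<partial>lborel)"
    unfolding ind by simp
  also have "\<dots> = (\<Sum>i. \<integral>\<^sup>+ s. indicator {0..<c} (s - real i * c) * G s \<partial>lborel)"
    by (rule nn_integral_suminf) measurable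
  also have "\<dots> = (\<Sum>i. \<integral>\<^sup>+ s. indicator {0..<c} s * G (s + real i * c) \<partial>lborel)"
  proof (rule suminf_cong)
    fix i
    show "(\<integral>\<^sup>+ s. indicator {0..<c} (s - real i * c) * G s \<partial>lborel)
      = (\<integral>\<^sup>+ s. indicator {0..<c} s * G (s + real i * c) \<partial>lborel)"
      by (subst nn_integral_real_affine[where c=1 and t="real i * c"]) (auto simp: add.commute)
  qed
  also have "\<dots> = (\<integral>\<^sup>+ s. (\<Sum>i. indicator {0..<c} s * G (s + real i * c)) \<partial>lborel)"
    by (rule nn_integral_suminf[symmetric]) measurable
  finally show ?thesis by simp
qed

context quasiconcave begin

text \<open>On a residue class the level set of f + c * 1_A with index i is that of f with index i
  outside A, and that of f with index i - 1 inside A. The measures to compare are thus b i + a (i -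
  1) and b i + a i, as in \<open>sigma_telescope\<close>.\<close>

lemma layer_integral_add_indicator:
  assumes f[measurable]: "f \<in> borel_measurable M" and A[measurable]: "A \<in> sets M"
    and c: "0 < c" and t: "0 < t" "t < \<infinity>" and m: "emeasure M A < \<infinity>"
  shows "layer_integral \<sigma> M (\<lambda>x. f x + ennreal c * indicator A x)
       \<le> layer_integral \<sigma> M f + ennreal c * (\<sigma> t + emeasure M A * (\<sigma> t / t))"
proof -
  let ?m = "emeasure M A" and ?k = "\<sigma> t + emeasure M A * (\<sigma> t / t)"
  define G where "G = (\<lambda>s. \<sigma> (emeasure M {x \<in> space M. ennreal s < f x + ennreal c * indicator A x}))"
  define F where "F = (\<lambda>s. \<sigma> (emeasure M {x \<in> space M. ennreal s < f x}))"
  have [measurable]: "G \<in> borel_measurable borel" "F \<in> borel_measurable borel"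
    unfolding G_def F_def by (auto intro!: level_measurable)
  have sum_le: "(\<Sum>i. G (s + real i * c)) \<le> (\<Sum>i. F (s + real i * c)) + ?k" if s: "0 \<le> s" "s < c" for s
  proof -
    define a where "a = (\<lambda>i. emeasure M ({x \<in> space M. ennreal (s + real i * c) < f x} \<inter> A))"
    define b where "b = (\<lambda>i. emeasure M ({x \<in> space M. ennreal (s + real i * c) < f x} - A))"
    have mono_level: "ennreal (s + real i * c) \<le> ennreal (s + real j * c)" if "i \<le> j" for i j
      using that c by (intro ennreal_leI) (simp add: mult_right_mono)
    have a: "decseq a" "a 0 \<le> ?m" and b: "decseq b"
      unfolding a_def b_def decseq_def
      by (auto intro!: emeasure_mono intro: le_less_trans[OF mono_level])
    have F_eq: "F (s + real i * c) = \<sigma> (b i + a i)" for i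
    proof -
      have "emeasure M {x \<in> space M. ennreal (s + real i * c) < f x} = a i + b i"
        unfolding a_def b_def by (subst plus_emeasure) (auto intro!: arg_cong[where f="emeasure M"])
      then show ?thesis unfolding F_def by (simp add: add.commute)
    qed
    have G_le: "G (s + real i * c) \<le> \<sigma> (b i + (case i of 0 \<Rightarrow> ?m | Suc j \<Rightarrow> a j))" for i
    proof -
      let ?L = "{x \<in> space M. ennreal (s + real i * c) < f x + ennreal c * indicator A x}"
      \<comment> \<open>For i = 0 the inside part is all of A, since s < c; this is the term m in
        front of the sequence \<open>a\<close>.\<close>
      define B where "B = (case i of 0 \<Rightarrow> A | Suc j \<Rightarrow> {x \<in> space M. ennreal (s + real j * c) < f x} \<inter> A)"
      have B[measurable]: "B \<in> sets M" unfolding B_def by (cases i) auto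
      have "?L \<subseteq> ({x \<in> space M. ennreal (s + real i * c) < f x} - A) \<union> B"
      proof
        fix x assume x: "x \<in> ?L"
        show "x \<in> ({x \<in> space M. ennreal (s + real i * c) < f x} - A) \<union> B"
        proof (cases "x \<in> A \<and> i \<noteq> 0")
          case True
          then obtain j where j: "i = Suc j" by (cases i) auto
          have "ennreal (s + real j * c) + ennreal c < f x + ennreal c"
            using x True j s c by (simp add: ennreal_plus[symmetric] algebra_simps del: ennreal_plus)
          then have "ennreal (s + real j * c) < f x"
            by (meson add_right_mono not_le)
          then show ?thesis using x True j by (auto simp: B_def)
        qed (use x in \<open>auto simp: B_def split: nat.splits\<close>)
      qed
      then have "emeasure M ?L \<le> emeasure M (({x \<in> space M. ennreal (s + real i * c) < f x} - A) \<union> B)"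
        by (intro emeasure_mono) auto
      also have "\<dots> \<le> b i + emeasure M B"
        unfolding b_def by (intro emeasure_subadditive) auto
      also have "emeasure M B = (case i of 0 \<Rightarrow> ?m | Suc j \<Rightarrow> a j)"
        unfolding B_def a_def by (cases i) auto
      finally show ?thesis unfolding G_def by (rule monoD[OF mono_sigma])
    qed
    show ?thesis
    proof (rule suminf_le_const[OF summableI])
      fix n
      have "(\<Sum>i<n. G (s + real i * c)) \<le> (\<Sum>i<n. \<sigma> (b i + (case i of 0 \<Rightarrow> ?m | Suc j \<Rightarrow> a j)))"
        by (intro sum_mono G_le)
      also have "\<dots> \<le> (\<Sum>i<n. \<sigma> (b i + a i)) + ?k"
        by (rule sigma_telescope[OF t m a b])
      also have "\<dots> \<le> (\<Sum>i. F (s + real i * c)) + ?k"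
        unfolding F_eq by (intro add_right_mono sum_le_suminf) auto
      finally show "(\<Sum>i<n. G (s + real i * c)) \<le> (\<Sum>i. F (s + real i * c)) + ?k" .
    qed
  qed
  have "layer_integral \<sigma> M (\<lambda>x. f x + ennreal c * indicator A x)
      = (\<integral>\<^sup>+ s. indicator {0..<c} s * (\<Sum>i. G (s + real i * c)) \<partial>lborel)"
    unfolding layer_integral_def G_def[symmetric]
    using nn_integral_fold[OF c, of G] by (simp add: G_def)
  also have "\<dots> \<le> (\<integral>\<^sup>+ s. indicator {0..<c} s * (\<Sum>i. F (s + real i * c)) + ?k * indicator {0..<c} s \<partial>lborel)"
    using sum_le by (intro nn_integral_mono) (auto simp: indicator_def)
  also have "\<dots> = (\<integral>\<^sup>+ s. indicator {0..<c} s * (\<Sum>i. F (s + real i * c)) \<partial>lborel) + ?k * ennreal c"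
    using c by (subst nn_integral_add) (auto simp: nn_integral_cmult)
  also have "\<dots> = layer_integral \<sigma> M f + ?k * ennreal c"
    unfolding layer_integral_def using nn_integral_fold[OF c, of F] by (simp add: F_def)
  finally show ?thesis by (simp add: mult.commute)
qed

end

text \<open>A lower Riemann sum of the layer cake formula for w x, with step 2^-k up to height 2^k,
  hence 4^k terms. Every summand is the indicator of a level set of \<open>w\<close>, so the
  quasi-norm of \<open>w\<close> controls the summands directly.\<close>

definition dyadic_layers :: "nat \<Rightarrow> ('a \<Rightarrow> ennreal) \<Rightarrow> 'a \<Rightarrow> ennreal" where
  "dyadic_layers k w x =
     (\<Sum>j=1..4 ^ k. ennreal (1 / 2 ^ k) * indicator {y. ennreal (real j / 2 ^ k) < w y} x)"

text \<open>A layer of thickness 2^-k at height j / 2^k splits into two of half the thickness, with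
  indices 2 * j and 2 * j - 1 on the finer grid: the first at the same height, the second lower and
  hence at least as large.\<close>

lemma dyadic_layers_mono: "dyadic_layers k w x \<le> dyadic_layers (Suc k) w x"
proof -
  let ?T = "\<lambda>k j. ennreal (1 / 2 ^ k) * indicator {y. ennreal (real j / 2 ^ k) < w y} x"
  have T_le: "?T k j \<le> ?T (Suc k) (2 * j) + ?T (Suc k) (2 * j - 1)" if "1 \<le> j" for j
  proof -
    have half: "ennreal (1 / 2 ^ Suc k) + ennreal (1 / 2 ^ Suc k) = ennreal (1 / 2 ^ k)"
      by (subst ennreal_plus[symmetric]) auto
    have "ennreal (real (2 * j - 1) / 2 ^ Suc k) \<le> ennreal (real j / 2 ^ k)"
      using that by (intro ennreal_leI) (simp add: field_simps)
    then have "ennreal (real (2 * j - 1) / 2 ^ Suc k) < w x" if "ennreal (real j / 2 ^ k) < w x"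
      using that by (rule le_less_trans)
    moreover have "ennreal (real (2 * j) / 2 ^ Suc k) = ennreal (real j / 2 ^ k)" by simp
    ultimately show ?thesis
      using half by (cases "ennreal (real j / 2 ^ k) < w x") (simp_all add: indicator_def del: power_Suc)
  qed
  have "(\<Sum>j=1..4 ^ k. ?T k j) \<le> (\<Sum>j=1..4 ^ k. ?T (Suc k) (2 * j) + ?T (Suc k) (2 * j - 1))"
    by (intro sum_mono T_le) auto
  also have "\<dots> = (\<Sum>i\<in>(\<lambda>j. 2 * j) ` {1..4 ^ k}. ?T (Suc k) i) + (\<Sum>i\<in>(\<lambda>j. 2 * j - 1) ` {1..4 ^ k}. ?T (Suc k) i)"
    by (subst (1 2) sum.reindex) (auto simp: sum.distrib inj_on_def)
  also have "\<dots> = (\<Sum>i\<in>(\<lambda>j. 2 * j) ` {1..4 ^ k} \<union> (\<lambda>j. 2 * j - 1) ` {1..4 ^ k}. ?T (Suc k) i)"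
    by (rule sum.union_disjoint[symmetric]) (auto, presburger)
  also have "\<dots> \<le> (\<Sum>i=1..4 ^ Suc k. ?T (Suc k) i)"
    by (rule sum_mono2) auto
  finally show ?thesis unfolding dyadic_layers_def .
qed

lemma incseq_dyadic_layers: "incseq (\<lambda>k. dyadic_layers k w x)"
  by (intro incseq_SucI dyadic_layers_mono)

lemma dyadic_layers_le: "dyadic_layers k w x \<le> w x"
proof -
  have "(\<Sum>j=1..n. ennreal (1 / 2 ^ k) * indicator {y. ennreal (real j / 2 ^ k) < w y} x)
      \<le> min (w x) (ennreal (real n / 2 ^ k))" for n
  proof (induction n)
    case (Suc n)
    show ?case
    proof (cases "ennreal (real (Suc n) / 2 ^ k) < w x")
      case True
      have "(\<Sum>j=1..Suc n. ennreal (1 / 2 ^ k) * indicator {y. ennreal (real j / 2 ^ k) < w y} x)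
          \<le> ennreal (real n / 2 ^ k) + ennreal (1 / 2 ^ k)"
        using Suc True by (auto intro!: add_mono)
      also have "\<dots> = ennreal (real (Suc n) / 2 ^ k)"
        by (subst ennreal_plus[symmetric]) (auto simp: field_simps)
      finally show ?thesis using True by auto
    next
      case False
      have "ennreal (real n / 2 ^ k) \<le> ennreal (real (Suc n) / 2 ^ k)"
        by (intro ennreal_leI) (simp add: divide_right_mono)
      then show ?thesis using Suc False by (auto intro: order_trans)
    qed
  qed auto
  then show ?thesis unfolding dyadic_layers_def by (metis min.bounded_iff)
qed

lemma SUP_dyadic_layers: "(SUP k. dyadic_layers k w x) = w x"
proof (rule antisym)
  show "(SUP k. dyadic_layers k w x) \<le> w x" by (intro SUP_least dyadic_layers_le)
  show "w x \<le> (SUP k. dyadic_layers k w x)"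
  proof (rule dense_le)
    fix z assume z: "z < w x"
    then obtain r where r: "z = ennreal r" "0 \<le> r" by (cases z) auto
    obtain d where d: "0 < d" "ennreal (r + d) < w x"
    proof -
      obtain z' where "z < z'" "z' < w x" using dense[OF z] by auto
      then obtain r' where "z' = ennreal r'" "0 \<le> r'" by (cases z') auto
      with \<open>z < z'\<close> \<open>z' < w x\<close> r have "r < r'" "ennreal (r + (r' - r)) < w x" by (auto simp: ennreal_less_iff)
      then show ?thesis using that[of "r' - r"] by auto
    qed
    \<comment> \<open>The grid must reach beyond r and its mesh must fit into the gap d, so that the
      first n layers, of total thickness at least r, all lie below w x.\<close>
    obtain k where k: "r + 1 < 2 ^ k" "1 / 2 ^ k < d"
    proof -
      obtain k where k: "max (r + 1) (1 / d) < 2 ^ k" using real_arch_pow[of 2 "max (r+1) (1/d)"] by auto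
      then show ?thesis using that[of k] d by (auto simp: field_simps)
    qed
    define n where "n = nat \<lceil>r * 2 ^ k\<rceil>"
    have n: "r * 2 ^ k \<le> real n" "real n < r * 2 ^ k + 1"
      unfolding n_def using r ceiling_correct[of "r * 2 ^ k"] by (auto simp: of_nat_nat)
    have "real n < (2::real) ^ k * 2 ^ k"
    proof -
      have "r * 2 ^ k + 1 \<le> (r + 1) * 2 ^ k" by (simp add: algebra_simps)
      also have "\<dots> \<le> 2 ^ k * 2 ^ k" using k by (intro mult_right_mono) auto
      finally show ?thesis using n by linarith
    qed
    also have "(2::real) ^ k * 2 ^ k = real (4 ^ k)"
      by (simp add: power_mult_distrib[symmetric])
    finally have n4: "n \<le> 4 ^ k" by linarith
    have lt: "ennreal (real j / 2 ^ k) < w x" if "j \<le> n" for j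
    proof -
      have "real j / 2 ^ k \<le> real n / 2 ^ k" using that by (simp add: divide_right_mono)
      also have "\<dots> \<le> r + 1 / 2 ^ k" using n by (simp add: field_simps)
      also have "\<dots> \<le> r + d" using k by simp
      finally have "ennreal (real j / 2 ^ k) \<le> ennreal (r + d)" by (rule ennreal_leI)
      then show ?thesis using d(2) by (rule le_less_trans)
    qed
    have "z \<le> ennreal (real n * (1 / 2 ^ k))"
      unfolding r using n by (intro ennreal_leI) (simp add: field_simps)
    also have "\<dots> = (\<Sum>j=1..n. ennreal (1 / 2 ^ k) * indicator {y. ennreal (real j / 2 ^ k) < w y} x)"
      using lt by (subst ennreal_mult) (simp_all add: indicator_def ennreal_of_nat_eq_real_of_nat)
    also have "\<dots> \<le> dyadic_layers k w x"
      unfolding dyadic_layers_def using n4 by (intro sum_mono2) auto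
    finally show "z \<le> (SUP k. dyadic_layers k w x)" by (rule order_trans) (auto intro: SUP_upper)
  qed
qed

lemma SUP_add_dyadic: "(SUP k. c + dyadic_layers k w x) = c + w x"
  using ennreal_SUP_add_right[of UNIV c "\<lambda>k. dyadic_layers k w x"] by (simp add: SUP_dyadic_layers)

lemma dyadic_layers_measurable [measurable]:
  "w \<in> borel_measurable M \<Longrightarrow> dyadic_layers k w \<in> borel_measurable M"
  unfolding dyadic_layers_def by measurable

lemma antimono_sum_le_nn_integral:
  fixes G :: "real \<Rightarrow> ennreal"
  assumes "antimono G" "0 < d"
  shows "(\<Sum>j=1..n. ennreal d * G (real j * d)) \<le> (\<integral>\<^sup>+ s. indicator {0..} s * G s \<partial>lborel)"
proof -
  have [measurable]: "G \<in> borel_measurable borel"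
    by (rule antimono_ennreal_borel_measurable[OF assms(1)])
  have "ennreal d * G (real j * d) \<le> (\<integral>\<^sup>+ s. indicator {(real j - 1) * d..<real j * d} s * G s \<partial>lborel)" for j
  proof -
    have "(\<integral>\<^sup>+ s. G (real j * d) * indicator {(real j - 1) * d..<real j * d} s \<partial>lborel)
      = G (real j * d) * ennreal (real j * d - (real j - 1) * d)"
      using \<open>0 < d\<close> by (subst nn_integral_cmult) (auto simp: mult_right_mono)
    also have "real j * d - (real j - 1) * d = d" by (simp add: algebra_simps)
    finally have "ennreal d * G (real j * d) = (\<integral>\<^sup>+ s. G (real j * d) * indicator {(real j - 1) * d..<real j * d} s \<partial>lborel)"
      by (simp add: mult.commute)
    also have "\<dots> \<le> (\<integral>\<^sup>+ s. indicator {(real j - 1) * d..<real j * d} s * G s \<partial>lborel)"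
      using assms(1) by (intro nn_integral_mono) (auto simp: indicator_def antimono_def)
    finally show ?thesis .
  qed
  then have "(\<Sum>j=1..n. ennreal d * G (real j * d))
      \<le> (\<Sum>j=1..n. \<integral>\<^sup>+ s. indicator {(real j - 1) * d..<real j * d} s * G s \<partial>lborel)"
    by (intro sum_mono)
  also have "\<dots> = (\<integral>\<^sup>+ s. (\<Sum>j=1..n. indicator {(real j - 1) * d..<real j * d} s * G s) \<partial>lborel)"
    by (rule nn_integral_sum[symmetric]) measurable
  also have "\<dots> \<le> (\<integral>\<^sup>+ s. indicator {0..} s * G s \<partial>lborel)"
  proof (rule nn_integral_mono)
    fix s
    have "(\<Sum>j=1..n. indicator {(real j - 1) * d..<real j * d} s) \<le> (indicator {0..<real n * d} s :: ennreal)"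
    proof (induction n)
      case (Suc n)
      have "(\<Sum>j=1..Suc n. indicator {(real j - 1) * d..<real j * d} s)
         \<le> indicator {0..<real n * d} s + (indicator {real n * d..<real (Suc n) * d} s :: ennreal)"
        using Suc by (simp add: add_right_mono)
      also have "\<dots> \<le> indicator {0..<real (Suc n) * d} s"
      proof -
        have "real n * d \<le> real (Suc n) * d" "0 \<le> real n * d" using assms(2) by (auto simp: mult_right_mono)
        then show ?thesis by (auto simp: indicator_def)
      qed
      finally show ?case .
    qed simp
    also have "\<dots> \<le> indicator {0..} s" by (auto simp: indicator_def)
    finally show "(\<Sum>j=1..n. indicator {(real j - 1) * d..<real j * d} s * G s) \<le> indicator {0..} s * G s"
      unfolding sum_distrib_right[symmetric] by (rule mult_right_mono) auto
  qed
  finally show ?thesis .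
qed

text \<open>Such an operator is determined by its values on indicators: a measurable function is the
  supremum of its dyadic layers, and \<open>SUP\<close> passes this through R. The axioms hold
  pointwise on \<open>space M\<close>, so compositions and infinite sums stay in the class without
  any bookkeeping of null sets.\<close>

locale sup_linear_operator =
  fixes M :: "'a measure" and R :: "('a \<Rightarrow> ennreal) \<Rightarrow> 'a \<Rightarrow> ennreal"
  assumes measurable: "v \<in> borel_measurable M \<Longrightarrow> R v \<in> borel_measurable M"
    and zero: "x \<in> space M \<Longrightarrow> R (\<lambda>_. 0) x = 0"
    and linear: "v \<in> borel_measurable M \<Longrightarrow> w \<in> borel_measurable M \<Longrightarrow> x \<in> space M
      \<Longrightarrow> R (\<lambda>x. c * v x + w x) x = c * R v x + R w x"
    and mono: "(\<And>x. x \<in> space M \<Longrightarrow> v x \<le> w x) \<Longrightarrow> x \<in> space M \<Longrightarrow> R v x \<le> R w x"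
    and SUP: "(\<And>k::nat. u k \<in> borel_measurable M) \<Longrightarrow> (\<And>x. incseq (\<lambda>k. u k x)) \<Longrightarrow> x \<in> space M
      \<Longrightarrow> R (\<lambda>x. SUP k. u k x) x = (SUP k. R (u k) x)"
begin

lemma cong: "(\<And>x. x \<in> space M \<Longrightarrow> v x = w x) \<Longrightarrow> x \<in> space M \<Longrightarrow> R v x = R w x"
  by (intro antisym mono) auto

lemma sum:
  assumes "\<And>j. A j \<in> sets M" "x \<in> space M"
  shows "R (\<lambda>x. \<Sum>j=1..(n::nat). d * indicator (A j) x) x = (\<Sum>j=1..n. d * R (indicator (A j)) x)"
proof (induction n)
  case 0
  then show ?case using zero assms by simp
next
  case (Suc n)
  have "R (\<lambda>x. d * indicator (A (Suc n)) x + (\<Sum>j=1..n. d * indicator (A j) x)) x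
      = d * R (indicator (A (Suc n))) x + R (\<lambda>x. \<Sum>j=1..n. d * indicator (A j) x) x"
    using assms by (intro linear) auto
  then show ?case using Suc by (simp add: add.commute)
qed

end

section \<open>Interpolation between L^1 and L^\<infinity>\<close>

context quasiconcave begin

lemma sum_layers_le:
  assumes "w \<in> borel_measurable M"
  shows "(\<Sum>j=1..n. ennreal (1 / 2 ^ k) * \<sigma> (emeasure M {x \<in> space M. ennreal (real j / 2 ^ k) < w x}))
       \<le> layer_integral \<sigma> M w"
  unfolding layer_integral_def
  using antimono_sum_le_nn_integral[OF antimono_level[OF assms], of "1 / 2 ^ k" n] by simp

lemma level_le_layer_integral:
  assumes "w \<in> borel_measurable M" "0 < s"
  shows "ennreal s * \<sigma> (emeasure M {x \<in> space M. ennreal s < w x}) \<le> layer_integral \<sigma> M w"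
  using antimono_sum_le_nn_integral[OF antimono_level[OF assms(1)] assms(2), of 1]
  by (simp add: layer_integral_def)

lemma level_finite:
  assumes w: "w \<in> borel_measurable M" and fin: "layer_integral \<sigma> M w < \<infinity>" and s: "0 < s"
  shows "emeasure M {x \<in> space M. ennreal s < w x} < \<infinity>"
proof -
  have "ennreal s * \<sigma> (emeasure M {x \<in> space M. ennreal s < w x}) < \<infinity>"
    using level_le_layer_integral[OF w s] fin by (rule le_less_trans)
  then have "\<sigma> (emeasure M {x \<in> space M. ennreal s < w x}) < \<infinity>"
    using s by (auto simp: ennreal_mult_less_top)
  then show ?thesis using sigma_finite by blast
qed

text \<open>The indicator estimate is applied to one level set of \<open>u\<close> after the other,
  always with the same t. Its bound is affine in the measure, so the measures add up to at most the
  integral of \<open>u\<close>.\<close>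

lemma layer_integral_add_bounded:
  assumes f[measurable]: "f \<in> borel_measurable M" and u[measurable]: "u \<in> borel_measurable M"
    and c: "0 \<le> c" "AE x in M. u x \<le> ennreal c" and int: "(\<integral>\<^sup>+ x. u x \<partial>M) < \<infinity>"
    and t: "0 < t" "t < \<infinity>"
  shows "layer_integral \<sigma> M (\<lambda>x. f x + u x)
       \<le> layer_integral \<sigma> M f + (ennreal c * \<sigma> t + (\<integral>\<^sup>+ x. u x \<partial>M) * (\<sigma> t / t))"
proof -
  let ?k = "\<sigma> t / t"
  have approx: "layer_integral \<sigma> M (\<lambda>x. f x + dyadic_layers k u x)
      \<le> layer_integral \<sigma> M f + (ennreal c * \<sigma> t + (\<integral>\<^sup>+ x. u x \<partial>M) * ?k)" for k
  proof -
    define d :: real where "d = 1 / 2 ^ k"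
    have d: "0 < d" by (simp add: d_def)
    define A where "A j = {x \<in> space M. ennreal (real j * d) < u x}" for j
    have A[measurable]: "A j \<in> sets M" for j unfolding A_def by measurable
    have ind: "indicator {y. ennreal (real j / 2 ^ k) < u y} x = (indicator (A j) x :: ennreal)"
      if "x \<in> space M" for j x using that by (auto simp: A_def d_def indicator_def)
    have sum_A: "(\<Sum>j=1..4 ^ k. ennreal d * emeasure M (A j)) \<le> (\<integral>\<^sup>+ x. u x \<partial>M)"
    proof -
      have "(\<Sum>j=1..4 ^ k. ennreal d * emeasure M (A j)) = (\<integral>\<^sup>+ x. (\<Sum>j=1..4 ^ k. ennreal d * indicator (A j) x) \<partial>M)"
        by (subst nn_integral_sum) (auto simp: nn_integral_cmult)
      also have "\<dots> = (\<integral>\<^sup>+ x. dyadic_layers k u x \<partial>M)"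
        unfolding dyadic_layers_def by (intro nn_integral_cong sum.cong) (auto simp: ind d_def)
      also have "\<dots> \<le> (\<integral>\<^sup>+ x. u x \<partial>M)" by (intro nn_integral_mono dyadic_layers_le)
      finally show ?thesis .
    qed
    have A_fin: "emeasure M (A j) < \<infinity>" if "j \<in> {1..4 ^ k}" for j
    proof -
      have "ennreal d * emeasure M (A j) \<le> (\<Sum>j=1..4 ^ k. ennreal d * emeasure M (A j))"
        by (rule member_le_sum[OF that]) auto
      then have "ennreal d * emeasure M (A j) < \<infinity>"
        using sum_A int by (auto intro: le_less_trans)
      then show ?thesis using d by (auto simp: ennreal_mult_less_top)
    qed
    \<comment> \<open>Layers at heights j * d \<ge> c are null and cost nothing. Those below c pay d
      * \<sigma> t each and have total thickness at most c; this is where the sup bound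
      enters.\<close>
    define I where "I n = {j \<in> {1..n}. real j * d < c}" for n
    have step: "layer_integral \<sigma> M (\<lambda>x. f x + (\<Sum>j=1..n. ennreal d * indicator (A j) x))
        \<le> layer_integral \<sigma> M f + (\<Sum>j\<in>I n. ennreal d * (\<sigma> t + emeasure M (A j) * ?k))" if "n \<le> 4 ^ k" for n
      using that
    proof (induction n)
      case 0
      then show ?case by (simp add: I_def)
    next
      case (Suc n)
      let ?f = "\<lambda>x. f x + (\<Sum>j=1..n. ennreal d * indicator (A j) x)"
      have eq: "(\<lambda>x. f x + (\<Sum>j=1..Suc n. ennreal d * indicator (A j) x)) = (\<lambda>x. ?f x + ennreal d * indicator (A (Suc n)) x)"
        by (simp add: add.assoc)
      show ?case
      proof (cases "real (Suc n) * d < c")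
        case True
        have I: "I (Suc n) = insert (Suc n) (I n)" "Suc n \<notin> I n" "finite (I n)"
          using True by (auto simp: I_def le_Suc_eq)
        have "layer_integral \<sigma> M (\<lambda>x. ?f x + ennreal d * indicator (A (Suc n)) x)
          \<le> layer_integral \<sigma> M ?f + ennreal d * (\<sigma> t + emeasure M (A (Suc n)) * ?k)"
          using Suc.prems by (intro layer_integral_add_indicator d t A_fin) auto
        also have "\<dots> \<le> layer_integral \<sigma> M f + (\<Sum>j\<in>I n. ennreal d * (\<sigma> t + emeasure M (A j) * ?k))
            + ennreal d * (\<sigma> t + emeasure M (A (Suc n)) * ?k)"
          using Suc by (intro add_right_mono) auto
        finally show ?thesis unfolding eq I(1) using I(2,3) by (simp add: ac_simps)
      next
        case False
        then have I: "I (Suc n) = I n" by (auto simp: I_def le_Suc_eq)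
        have "AE x in M. x \<notin> A (Suc n)"
          using c(2) by eventually_elim
            (use False in \<open>auto simp: A_def not_less intro: order_trans[OF _ ennreal_leI]\<close>)
        then have "layer_integral \<sigma> M (\<lambda>x. ?f x + ennreal d * indicator (A (Suc n)) x) = layer_integral \<sigma> M ?f"
          by (intro layer_integral_cong_AE) (auto elim!: eventually_mono)
        then show ?thesis unfolding eq I using Suc by simp
      qed
    qed
    have "layer_integral \<sigma> M (\<lambda>x. f x + dyadic_layers k u x)
       = layer_integral \<sigma> M (\<lambda>x. f x + (\<Sum>j=1..4 ^ k. ennreal d * indicator (A j) x))"
      unfolding dyadic_layers_def by (intro layer_integral_cong_AE AE_I2) (auto simp: ind d_def)
    also have "\<dots> \<le> layer_integral \<sigma> M f + (\<Sum>j\<in>I (4 ^ k). ennreal d * (\<sigma> t + emeasure M (A j) * ?k))"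
      by (rule step) simp
    also have "(\<Sum>j\<in>I (4 ^ k). ennreal d * (\<sigma> t + emeasure M (A j) * ?k))
      = (\<Sum>j\<in>I (4 ^ k). ennreal d) * \<sigma> t + (\<Sum>j\<in>I (4 ^ k). ennreal d * emeasure M (A j)) * ?k"
      by (simp add: sum_distrib_right sum.distrib distrib_left mult.assoc)
    also have "\<dots> \<le> ennreal c * \<sigma> t + (\<integral>\<^sup>+ x. u x \<partial>M) * ?k"
    proof (intro add_mono mult_right_mono)
      have "real (card (I (4 ^ k))) * d \<le> c"
      proof (cases "I (4 ^ k) = {}")
        case True then show ?thesis using c by simp
      next
        case False
        have fin: "finite (I (4 ^ k))" by (simp add: I_def)
        define n where "n = Max (I (4 ^ k))"
        have "n \<in> I (4 ^ k)" unfolding n_def by (rule Max_in[OF fin False])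
        have "I (4 ^ k) \<subseteq> {1..n}" using Max_ge[OF fin] by (auto simp: n_def I_def)
        then have "card (I (4 ^ k)) \<le> n" using card_mono[of "{1..n}" "I (4 ^ k)"] by simp
        then have "real (card (I (4 ^ k))) * d \<le> real n * d" using d by simp
        then show ?thesis using \<open>n \<in> I (4 ^ k)\<close> by (simp add: I_def)
      qed
      then have "ennreal (real (card (I (4 ^ k))) * d) \<le> ennreal c" by (rule ennreal_leI)
      then show "(\<Sum>j\<in>I (4 ^ k). ennreal d) \<le> ennreal c"
        using d by (simp add: ennreal_mult ennreal_of_nat_eq_real_of_nat)
      have "(\<Sum>j\<in>I (4 ^ k). ennreal d * emeasure M (A j)) \<le> (\<Sum>j=1..4 ^ k. ennreal d * emeasure M (A j))"
        by (intro sum_mono2) (auto simp: I_def)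
      then show "(\<Sum>j\<in>I (4 ^ k). ennreal d * emeasure M (A j)) \<le> (\<integral>\<^sup>+ x. u x \<partial>M)"
        using sum_A by (rule order_trans)
    qed auto
    finally show ?thesis by (simp add: add_left_mono)
  qed
  have "(\<lambda>x. f x + u x) = (\<lambda>x. SUP k. f x + dyadic_layers k u x)"
    by (rule ext) (simp add: SUP_add_dyadic)
  moreover have "layer_integral \<sigma> M (\<lambda>x. SUP k. f x + dyadic_layers k u x)
      = (SUP k. layer_integral \<sigma> M (\<lambda>x. f x + dyadic_layers k u x))"
    using incseq_dyadic_layers[of u] by (intro layer_integral_SUP) (auto simp: incseq_def intro: add_left_mono)
  ultimately show ?thesis using approx by (auto intro: SUP_least)
qed

theorem layer_integral_add_operator:
  assumes f[measurable]: "f \<in> borel_measurable M" and w[measurable]: "w \<in> borel_measurable M"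
    and fin: "layer_integral \<sigma> M w < \<infinity>" and c: "0 \<le> c"
    and R: "sup_linear_operator M R"
    and R_bounded: "\<And>A. A \<in> sets M \<Longrightarrow> AE x in M. R (indicator A) x \<le> ennreal c"
    and R_int: "\<And>A. A \<in> sets M \<Longrightarrow> (\<integral>\<^sup>+ x. R (indicator A) x \<partial>M) \<le> ennreal c * emeasure M A"
  shows "layer_integral \<sigma> M (\<lambda>x. f x + R w x) \<le> layer_integral \<sigma> M f + 2 * ennreal c * layer_integral \<sigma> M w"
proof -
  interpret R: sup_linear_operator M R by (rule R)
  note R.measurable[measurable]
  have approx: "layer_integral \<sigma> M (\<lambda>x. f x + R (dyadic_layers k w) x)
      \<le> layer_integral \<sigma> M f + 2 * ennreal c * layer_integral \<sigma> M w" for k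
  proof -
    define d :: real where "d = 1 / 2 ^ k"
    have d: "0 < d" by (simp add: d_def)
    define A where "A j = {x \<in> space M. ennreal (real j / 2 ^ k) < w x}" for j :: nat
    have A[measurable]: "A j \<in> sets M" for j unfolding A_def by measurable
    have A_fin: "emeasure M (A j) < \<infinity>" if "1 \<le> j" for j
      unfolding A_def using that by (intro level_finite[OF w fin]) auto
    have eq: "R (dyadic_layers k w) x = (\<Sum>j=1..4 ^ k. ennreal d * R (indicator (A j)) x)" if "x \<in> space M" for x
    proof -
      have "R (dyadic_layers k w) x = R (\<lambda>x. \<Sum>j=1..4 ^ k. ennreal d * indicator (A j) x) x"
        using that by (intro R.cong) (auto simp: dyadic_layers_def A_def d_def indicator_def)
      also have "\<dots> = (\<Sum>j=1..4 ^ k. ennreal d * R (indicator (A j)) x)" by (rule R.sum[OF A that])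
      finally show ?thesis .
    qed
    have step: "layer_integral \<sigma> M (\<lambda>x. f x + (\<Sum>j=1..n. ennreal d * R (indicator (A j)) x))
        \<le> layer_integral \<sigma> M f + (\<Sum>j=1..n. 2 * ennreal c * (ennreal d * \<sigma> (emeasure M (A j))))" for n
    proof (induction n)
      case (Suc n)
      let ?f = "\<lambda>x. f x + (\<Sum>j=1..n. ennreal d * R (indicator (A j)) x)"
      let ?u = "\<lambda>x. ennreal d * R (indicator (A (Suc n))) x" and ?m = "emeasure M (A (Suc n))"
      have int: "(\<integral>\<^sup>+ x. ?u x \<partial>M) \<le> ennreal (d * c) * ?m"
        using mult_left_mono[OF R_int[OF A], of "ennreal d"] d c
        by (simp add: nn_integral_cmult ennreal_mult mult.assoc)
      have m: "?m < \<infinity>" using A_fin by simp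
      have "layer_integral \<sigma> M (\<lambda>x. ?f x + ?u x) \<le> layer_integral \<sigma> M ?f + 2 * ennreal c * (ennreal d * \<sigma> ?m)"
      \<comment> \<open>The parameter t will be the measure of the level set and must be positive.
        For a null level set \<open>R_int\<close> makes R 1_A vanish almost everywhere.\<close>
      proof (cases "?m = 0")
        case True
        then have "AE x in M. ?u x = 0"
          using int by (subst nn_integral_0_iff_AE[symmetric]) auto
        then have "layer_integral \<sigma> M (\<lambda>x. ?f x + ?u x) = layer_integral \<sigma> M ?f"
          by (intro layer_integral_cong_AE) (auto elim!: eventually_mono)
        then show ?thesis by simp
      next
        case False
        have "layer_integral \<sigma> M (\<lambda>x. ?f x + ?u x)
          \<le> layer_integral \<sigma> M ?f + (ennreal (d * c) * \<sigma> ?m + (\<integral>\<^sup>+ x. ?u x \<partial>M) * (\<sigma> ?m / ?m))"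
        proof (rule layer_integral_add_bounded)
          show "AE x in M. ?u x \<le> ennreal (d * c)"
            using R_bounded[OF A] by eventually_elim (use d c in \<open>auto simp: ennreal_mult intro: mult_left_mono\<close>)
          show "(\<integral>\<^sup>+ x. ?u x \<partial>M) < \<infinity>"
            using int m by (auto intro!: le_less_trans[OF int] simp: ennreal_mult_less_top)
        qed (use False m d c in \<open>auto simp: zero_less_iff_neq_zero\<close>)
        also have "(\<integral>\<^sup>+ x. ?u x \<partial>M) * (\<sigma> ?m / ?m) \<le> (ennreal (d * c) * ?m) * (\<sigma> ?m / ?m)"
          by (intro mult_right_mono int) auto
        also have "\<dots> = ennreal (d * c) * \<sigma> ?m"
        proof -
          have "?m * (\<sigma> ?m / ?m) = \<sigma> ?m"
            using False m by (simp add: ennreal_times_divide mult.commute[of ?m] ennreal_mult_divide_eq)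
          then show ?thesis by (simp add: mult.assoc)
        qed
        finally show ?thesis
          using d c by (simp add: ennreal_mult mult_2[symmetric] distrib_right[symmetric] ac_simps add_left_mono)
      qed
      also have "\<dots> \<le> (layer_integral \<sigma> M f + (\<Sum>j=1..n. 2 * ennreal c * (ennreal d * \<sigma> (emeasure M (A j)))))
           + 2 * ennreal c * (ennreal d * \<sigma> ?m)"
        by (intro add_right_mono Suc.IH)
      finally show ?case by (simp add: add.assoc)
    qed simp
    have "layer_integral \<sigma> M (\<lambda>x. f x + R (dyadic_layers k w) x)
       = layer_integral \<sigma> M (\<lambda>x. f x + (\<Sum>j=1..4 ^ k. ennreal d * R (indicator (A j)) x))"
      by (intro layer_integral_cong_AE AE_I2) (auto simp: eq)
    also have "\<dots> \<le> layer_integral \<sigma> M f + (\<Sum>j=1..4 ^ k. 2 * ennreal c * (ennreal d * \<sigma> (emeasure M (A j))))"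
      by (rule step)
    also have "\<dots> \<le> layer_integral \<sigma> M f + 2 * ennreal c * layer_integral \<sigma> M w"
    proof -
      have "(\<Sum>j=1..4 ^ k. ennreal d * \<sigma> (emeasure M (A j))) \<le> layer_integral \<sigma> M w"
        unfolding A_def d_def by (rule sum_layers_le[OF w])
      then show ?thesis
        unfolding sum_distrib_left[of "2 * ennreal c", symmetric] by (intro add_left_mono mult_left_mono) auto
    qed
    finally show ?thesis .
  qed
  have "layer_integral \<sigma> M (\<lambda>x. f x + R w x) = layer_integral \<sigma> M (\<lambda>x. SUP k. f x + R (dyadic_layers k w) x)"
  proof (intro layer_integral_cong_AE AE_I2)
    fix x assume "x \<in> space M"
    then have "R w x = (SUP k. R (dyadic_layers k w) x)"
      using R.SUP[of "\<lambda>k. dyadic_layers k w" x] by (simp add: SUP_dyadic_layers incseq_dyadic_layers)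
    then show "f x + R w x = (SUP k. f x + R (dyadic_layers k w) x)"
      by (simp add: ennreal_SUP_add_right)
  qed auto
  \<comment> \<open>Monotonicity of R is known on \<open>space M\<close> only, while
    \<open>layer_integral_SUP\<close> asks for increasing sequences at every point; cutting off
    outside the space reconciles the two.\<close>
  also have "\<dots> = layer_integral \<sigma> M (\<lambda>x. SUP k. f x + (if x \<in> space M then R (dyadic_layers k w) x else 0))"
    by (intro layer_integral_cong_AE AE_I2) (auto cong: measurable_cong)
  also have "\<dots> = (SUP k. layer_integral \<sigma> M (\<lambda>x. f x + (if x \<in> space M then R (dyadic_layers k w) x else 0)))"
    using incseq_dyadic_layers[of w]
    by (intro layer_integral_SUP)
      (auto simp: incseq_def le_fun_def cong: measurable_cong intro!: add_left_mono R.mono)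
  also have "\<dots> = (SUP k. layer_integral \<sigma> M (\<lambda>x. f x + R (dyadic_layers k w) x))"
    by (intro SUP_cong refl layer_integral_cong_AE AE_I2) (auto cong: measurable_cong)
  also have "\<dots> \<le> layer_integral \<sigma> M f + 2 * ennreal c * layer_integral \<sigma> M w"
    by (intro SUP_least approx)
  finally show ?thesis .
qed

end

section \<open>The Young function, \<tau> and its inverse\<close>

context
  fixes \<psi> :: "real \<Rightarrow> real"
  assumes psi: "admissible_psi \<psi>"
begin

lemma psi_less: "0 \<le> s \<Longrightarrow> s < t \<Longrightarrow> \<psi> s < \<psi> t"
proof -
  assume "0 \<le> s" "s < t"
  moreover have "strict_mono_on {0..} \<psi>" using psi unfolding admissible_psi_def by (elim conjE)
  ultimately show "\<psi> s < \<psi> t" by (auto intro: strict_mono_onD)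
qed

lemma psi_0: "\<psi> 0 = 0"
  using psi unfolding admissible_psi_def young_function_def by (elim conjE)

lemma psi_pos: "0 < t \<Longrightarrow> 0 < \<psi> t"
  using psi_less[of 0 t] psi_0 by simp

lemma psi_surj:
  assumes "0 < y"
  obtains u where "0 < u" "\<psi> u = y"
proof -
  have conv: "convex_on {0..} \<psi>"
    using psi unfolding admissible_psi_def young_function_def by (elim conjE)
  have lim0: "(\<psi> \<longlongrightarrow> 0) (at_right 0)" and top: "filterlim \<psi> at_top at_top"
    using psi unfolding admissible_psi_def young_function_def by blast+
  have "continuous_on {0<..} \<psi>" 
    by (rule convex_on_continuous[OF _ convex_on_subset[OF conv]]) auto
  have "\<forall>\<^sub>F t in at_right 0. \<psi> t < y" using lim0 assms by (rule order_tendstoD)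
  then obtain a where a: "0 < a" "\<And>t. 0 < t \<Longrightarrow> t < a \<Longrightarrow> \<psi> t < y"
    unfolding eventually_at_right_field by blast
  have "\<forall>\<^sub>F t in at_top. y \<le> \<psi> t" using top by (simp add: filterlim_at_top)
  then obtain b where b: "\<And>t. b \<le> t \<Longrightarrow> y \<le> \<psi> t" unfolding eventually_at_top_linorder by blast
  let ?a = "a / 2" and ?b = "max a b"
  have "\<exists>u\<ge>?a. u \<le> ?b \<and> \<psi> u = y"
  proof (rule IVT')
    show "\<psi> ?a \<le> y" using a by (simp add: less_imp_le)
    show "y \<le> \<psi> ?b" using b by simp
    show "continuous_on {?a..?b} \<psi>"
      using \<open>continuous_on {0<..} \<psi>\<close> by (rule continuous_on_subset) (use a in auto)
  qed (use a in auto)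
  then obtain u where "a / 2 \<le> u" "\<psi> u = y" by blast
  then show ?thesis using a(1) by (intro that[of u]) auto
qed

lemma tau_less: "0 \<le> s \<Longrightarrow> s < t \<Longrightarrow> tau \<psi> s < tau \<psi> t"
  using psi_pos[of "1 / t"] psi_less[of "1 / t" "1 / s"] psi_pos[of "1 / s"] frac_less2[of 1 1 s t]
  by (cases "s = 0") (simp_all add: tau_def divide_strict_left_mono)

lemma tau_le_iff: "0 \<le> s \<Longrightarrow> 0 \<le> t \<Longrightarrow> tau \<psi> s \<le> tau \<psi> t \<longleftrightarrow> s \<le> t"
  using tau_less[of s t] tau_less[of t s] by (cases s t rule: linorder_cases) auto

lemma tau_nonneg: "0 \<le> t \<Longrightarrow> 0 \<le> tau \<psi> t"
  using tau_le_iff[of 0 t] by (simp add: tau_def)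

lemma bij_betw_tau: "bij_betw (tau \<psi>) {0..} {0..}"
  unfolding bij_betw_def
proof
  show "inj_on (tau \<psi>) {0..}"
    by (rule inj_onI) (metis atLeast_iff linorder_neqE_linordered_idom less_irrefl tau_less)
  have "y \<in> tau \<psi> ` {0..}" if y: "0 \<le> y" for y
  proof (cases "y = 0")
    case True then show ?thesis by (auto simp: tau_def image_iff intro!: bexI[of _ 0])
  next
    case False
    then obtain u where "0 < u" "\<psi> u = 1 / y" using psi_surj[of "1 / y"] y by auto
    then show ?thesis by (auto simp: tau_def image_iff intro!: bexI[of _ "1 / u"])
  qed
  then show "tau \<psi> ` {0..} = {0..}" using tau_nonneg by auto
qed

lemma tau_inv_ennreal:
  assumes "0 \<le> r"
  obtains s where "0 \<le> s" "tau \<psi> s = r" "tau_inv \<psi> (ennreal r) = ennreal s"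
proof -
  let ?s = "the_inv_into {0..} (tau \<psi>) r"
  have "?s \<in> {0..}" using bij_betw_tau assms by (intro the_inv_into_into) (auto simp: bij_betw_def)
  moreover have "tau \<psi> ?s = r" using bij_betw_tau assms by (intro f_the_inv_into_f) (auto simp: bij_betw_def)
  ultimately show ?thesis using that[of ?s] assms by (simp add: tau_inv_def)
qed

text \<open>A Galois connection. Monotonicity, left continuity and the zero of the inverse all
  follow from it, without a separate continuity argument for the inverse.\<close>

lemma tau_inv_le_iff:
  assumes "0 \<le> z"
  shows "tau_inv \<psi> x \<le> ennreal z \<longleftrightarrow> x \<le> ennreal (tau \<psi> z)"
proof (cases x)
  case (real r)
  obtain s where s: "0 \<le> s" "tau \<psi> s = r" "tau_inv \<psi> (ennreal r) = ennreal s"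
    using tau_inv_ennreal[OF real(1)] .
  then show ?thesis
    using assms real tau_le_iff[OF s(1) assms] by (simp add: tau_nonneg)
next
  case top then show ?thesis by (simp add: tau_inv_def top_unique)
qed

text \<open>Convexity along the segment from 0 gives \<psi> (s / l) \<le> \<psi> s / l because
  \<psi> 0 = 0. For the inverse of \<tau> this says that \<sigma> s / s does not increase.\<close>

lemma tau_scale:
  assumes "1 \<le> l" "0 \<le> t"
  shows "l * tau \<psi> t \<le> tau \<psi> (l * t)"
proof (cases "t = 0")
  case False
  have conv: "convex_on {0..} \<psi>"
    using psi unfolding admissible_psi_def young_function_def by (elim conjE)
  have "\<psi> ((1 - 1 / l) *\<^sub>R 0 + (1 / l) *\<^sub>R (1 / t)) \<le> (1 - 1 / l) * \<psi> 0 + (1 / l) * \<psi> (1 / t)"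
    by (rule convex_onD[OF conv]) (use assms in auto)
  then have "\<psi> (1 / (l * t)) \<le> \<psi> (1 / t) / l" by (simp add: psi_0)
  moreover have "0 < \<psi> (1 / (l * t))" "0 < \<psi> (1 / t)" using assms False by (auto intro!: psi_pos)
  ultimately have "l / \<psi> (1 / t) \<le> 1 / \<psi> (1 / (l * t))" using assms by (simp add: field_simps)
  then show ?thesis using False assms by (simp add: tau_def)
qed (simp add: tau_def)

lemma quasiconcave_tau_inv: "quasiconcave (tau_inv \<psi>)"
proof
  show mono: "mono (tau_inv \<psi>)"
  proof (rule monoI)
    fix x y :: ennreal assume "x \<le> y"
    show "tau_inv \<psi> x \<le> tau_inv \<psi> y"
    proof (cases "tau_inv \<psi> y")
      case (real z)
      then have "y \<le> ennreal (tau \<psi> z)" using tau_inv_le_iff[of z y] by simp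
      then show ?thesis using real tau_inv_le_iff[of z x] \<open>x \<le> y\<close> by (simp add: order_trans)
    qed simp
  qed
  show "tau_inv \<psi> (SUP n. X n) = (SUP n. tau_inv \<psi> (X n))" if "incseq X" for X :: "nat \<Rightarrow> ennreal"
  proof (rule antisym)
    show "(SUP n. tau_inv \<psi> (X n)) \<le> tau_inv \<psi> (SUP n. X n)"
      by (intro SUP_least monoD[OF mono] SUP_upper) simp
    show "tau_inv \<psi> (SUP n. X n) \<le> (SUP n. tau_inv \<psi> (X n))"
    proof (cases "SUP n. tau_inv \<psi> (X n)")
      case (real z)
      then have "tau_inv \<psi> (X n) \<le> ennreal z" for n by (metis SUP_upper UNIV_I)
      then have "X n \<le> ennreal (tau \<psi> z)" for n using tau_inv_le_iff[OF real(1)] by blast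
      then have "(SUP n. X n) \<le> ennreal (tau \<psi> z)" by (intro SUP_least)
      then show ?thesis using real tau_inv_le_iff by metis
    next
      case top
      then show ?thesis by (metis top_greatest)
    qed
  qed
  show "tau_inv \<psi> x = 0 \<longleftrightarrow> x = 0" for x
    using tau_inv_le_iff[of 0 x] by (simp add: tau_def)
  show "tau_inv \<psi> x < \<infinity> \<longleftrightarrow> x < \<infinity>" for x
    by (auto simp: tau_inv_def less_top)
  show "tau_inv \<psi> (x + h) \<le> tau_inv \<psi> x + h * (tau_inv \<psi> t / t)" if t: "0 < t" "t \<le> x" "x < \<infinity>" for t x h
  proof -
    obtain xr where xr: "x = ennreal xr" "0 \<le> xr" using t by (cases x) auto
    obtain tr where tr: "t = ennreal tr" "0 < tr" "tr \<le> xr" using t xr by (cases t) (auto simp: top_unique)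
    obtain T where T: "0 \<le> T" "tau \<psi> T = tr" "tau_inv \<psi> t = ennreal T"
      using tau_inv_ennreal[of tr] tr by auto
    have T0: "0 < T" using T tr by (cases "T = 0") (auto simp: tau_def)
    have slope: "tau_inv \<psi> t / t = ennreal (T / tr)" using T tr by (simp add: divide_ennreal)
    show ?thesis
    proof (cases h)
      case (real hr)
      obtain S where S: "0 \<le> S" "tau \<psi> S = xr" "tau_inv \<psi> x = ennreal S"
        using tau_inv_ennreal[of xr] xr by auto
      have x0: "0 < xr" using tr by simp
      \<comment> \<open>Scaling from t to x by the factor x / t gives \<sigma> x / x \<le> \<sigma>
        t / t; scaling from x to x + h afterwards gives the additive form.\<close>
      have "xr \<le> tau \<psi> (xr / tr * T)"
        using tau_scale[of "xr / tr" T] T tr by simp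
      then have "S \<le> xr / tr * T" using tau_le_iff[of S "xr / tr * T"] S T tr xr by simp
      then have ST: "S / xr \<le> T / tr" using x0 tr by (simp add: field_simps)
      have "xr + hr \<le> tau \<psi> ((xr + hr) / xr * S)"
        using tau_scale[of "(xr + hr) / xr" S] S x0 real by simp
      then have "tau_inv \<psi> (x + h) \<le> ennreal ((xr + hr) / xr * S)"
        using tau_inv_le_iff[of "(xr + hr) / xr * S" "x + h"] real xr S x0 by (simp add: ennreal_leI flip: ennreal_plus)
      also have "(xr + hr) / xr * S = S + hr * (S / xr)" using x0 by (simp add: field_simps)
      also have "ennreal (S + hr * (S / xr)) \<le> ennreal (S + hr * (T / tr))"
        using ST real by (intro ennreal_leI add_left_mono mult_left_mono) auto
      also have "\<dots> = tau_inv \<psi> x + h * (tau_inv \<psi> t / t)"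
        unfolding slope S(3) real using S T tr real by (simp add: ennreal_mult del: times_divide_eq_right)
      finally show ?thesis .
    next
      case top
      then show ?thesis using slope T0 tr by (simp add: ennreal_top_mult)
    qed
  qed
qed

end

section \<open>Integrability and finiteness from a finite quasi-norm\<close>

context quasiconcave begin

text \<open>The monotonicity of \<sigma> s / s is read backwards here, as an estimate of n by
  \<sigma> n whose constant depends on the upper bound m alone. It is \<open>slope\<close> at t = x
  = n with h = m - n.\<close>

lemma sigma_ratio:
  assumes "n \<le> m" "0 < m" "m < \<infinity>"
  shows "n \<le> m / \<sigma> m * \<sigma> n"
proof (cases "n = 0")
  case False
  obtain h where h: "m = n + h" using assms by (auto simp: le_iff_add)
  have n: "0 < n" "n < \<infinity>" using False assms by (auto simp: zero_less_iff_neq_zero)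
  have sm: "\<sigma> m \<noteq> 0" "\<sigma> m < top" using sigma_eq_0[of m] sigma_finite[of m] assms by auto
  have "n * \<sigma> m \<le> n * (\<sigma> n + h * (\<sigma> n / n))"
    unfolding h using n by (intro mult_left_mono slope) auto
  also have "\<dots> = n * \<sigma> n + h * (n * (\<sigma> n / n))" by (simp add: distrib_left ac_simps)
  also have "n * (\<sigma> n / n) = \<sigma> n"
    using n by (simp add: ennreal_times_divide mult.commute[of n] ennreal_mult_divide_eq)
  also have "n * \<sigma> n + h * \<sigma> n = m * \<sigma> n" by (simp add: h distrib_right)
  finally have "n * \<sigma> m / \<sigma> m \<le> m * \<sigma> n / \<sigma> m" by (rule divide_right_mono_ennreal)
  then show ?thesis using sm by (simp add: ennreal_mult_divide_eq ennreal_times_divide mult.commute)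
qed simp

text \<open>Inside \<open>C\<close> no level set has measure above m = \<mu> C, so
  \<open>sigma_ratio\<close> trades the measure of each level for its \<sigma> at the fixed rate m /
  \<sigma> m.\<close>

lemma nn_integral_le_layer_integral:
  assumes w[measurable]: "w \<in> borel_measurable M" and C[measurable]: "C \<in> sets M"
    and m: "0 < emeasure M C" "emeasure M C < \<infinity>"
  shows "(\<integral>\<^sup>+ x. w x * indicator C x \<partial>M) \<le> emeasure M C / \<sigma> (emeasure M C) * layer_integral \<sigma> M w"
proof -
  let ?m = "emeasure M C"
  define v where "v x = w x * indicator C x" for x
  have v[measurable]: "v \<in> borel_measurable M" unfolding v_def by measurable
  have "(\<integral>\<^sup>+ x. dyadic_layers k v x \<partial>M) \<le> ?m / \<sigma> ?m * layer_integral \<sigma> M w" for k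
  proof -
    let ?L = "\<lambda>u j. emeasure M {x \<in> space M. ennreal (real j / 2 ^ k) < u x}"
    have "(\<integral>\<^sup>+ x. dyadic_layers k v x \<partial>M)
      = (\<integral>\<^sup>+ x. (\<Sum>j=1..4 ^ k. ennreal (1 / 2 ^ k) * indicator {x \<in> space M. ennreal (real j / 2 ^ k) < v x} x) \<partial>M)"
      unfolding dyadic_layers_def by (intro nn_integral_cong) (auto simp: indicator_def)
    also have "\<dots> = (\<Sum>j=1..4 ^ k. ennreal (1 / 2 ^ k) * ?L v j)"
      by (subst nn_integral_sum) (auto simp: nn_integral_cmult)
    also have "\<dots> \<le> (\<Sum>j=1..4 ^ k. ennreal (1 / 2 ^ k) * (?m / \<sigma> ?m * \<sigma> (?L w j)))"
    proof (intro sum_mono mult_left_mono)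
      fix j :: nat assume "j \<in> {1..4 ^ k}"
      have sub: "{x \<in> space M. ennreal (real j / 2 ^ k) < v x} \<subseteq> C" "?L v j \<le> ?L w j"
        by (auto simp: v_def indicator_def intro!: emeasure_mono split: if_splits)
      then have "?L v j \<le> ?m" by (intro emeasure_mono) auto
      then have "?L v j \<le> ?m / \<sigma> ?m * \<sigma> (?L v j)" using m by (rule sigma_ratio)
      also have "\<dots> \<le> ?m / \<sigma> ?m * \<sigma> (?L w j)"
        using sub(2) by (intro mult_left_mono monoD[OF mono_sigma]) auto
      finally show "?L v j \<le> ?m / \<sigma> ?m * \<sigma> (?L w j)" .
    qed simp
    also have "\<dots> = ?m / \<sigma> ?m * (\<Sum>j=1..4 ^ k. ennreal (1 / 2 ^ k) * \<sigma> (?L w j))"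
      unfolding sum_distrib_left by (intro sum.cong refl) (simp only: ac_simps)
    also have "\<dots> \<le> ?m / \<sigma> ?m * layer_integral \<sigma> M w"
      by (intro mult_left_mono sum_layers_le w) auto
    finally show ?thesis .
  qed
  then have "(SUP k. \<integral>\<^sup>+ x. dyadic_layers k v x \<partial>M) \<le> ?m / \<sigma> ?m * layer_integral \<sigma> M w"
    by (intro SUP_least)
  moreover have "(\<integral>\<^sup>+ x. v x \<partial>M) = (SUP k. \<integral>\<^sup>+ x. dyadic_layers k v x \<partial>M)"
    using nn_integral_monotone_convergence_SUP[of "\<lambda>k. dyadic_layers k v" M] incseq_dyadic_layers[of v]
    by (simp add: SUP_dyadic_layers incseq_def le_fun_def)
  ultimately show ?thesis by (simp add: v_def)
qed

lemma AE_finite_layer_integral: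
  assumes w[measurable]: "w \<in> borel_measurable M" and fin: "layer_integral \<sigma> M w < \<infinity>"
  shows "AE x in M. w x < \<infinity>"
proof -
  let ?I = "{x \<in> space M. w x = \<infinity>}"
  have le: "ennreal s * \<sigma> (emeasure M ?I) \<le> layer_integral \<sigma> M w" if "0 < s" for s
  proof -
    have "ennreal s * \<sigma> (emeasure M ?I) \<le> ennreal s * \<sigma> (emeasure M {x \<in> space M. ennreal s < w x})"
      by (intro mult_left_mono monoD[OF mono_sigma] emeasure_mono) auto
    also have "\<dots> \<le> layer_integral \<sigma> M w" by (rule level_le_layer_integral[OF w that])
    finally show ?thesis .
  qed
  obtain e where e: "layer_integral \<sigma> M w = ennreal e" "0 \<le> e"
    using fin by (cases "layer_integral \<sigma> M w") auto
  have "\<sigma> (emeasure M ?I) \<le> ennreal e" using le[of 1] e by simp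
  then obtain k where k: "\<sigma> (emeasure M ?I) = ennreal k" "0 \<le> k"
    by (cases "\<sigma> (emeasure M ?I)") (auto simp: top_unique)
  have "k = 0"
  proof (rule ccontr)
    assume "k \<noteq> 0"
    then have "0 < k" using k by simp
    \<comment> \<open>Chebyshev's bound at height (e + 1) / k would give e + 1 \<le> e.\<close>
    then have "ennreal ((e + 1) / k * k) \<le> ennreal e"
      using le[of "(e + 1) / k"] e k by (simp add: ennreal_mult del: times_divide_eq_left)
    then show False using \<open>0 < k\<close> e by simp
  qed
  then have "emeasure M ?I = 0" using k sigma_eq_0 by simp
  then show ?thesis
    by (subst AE_iff_measurable[OF _ refl]) (auto simp: less_top[symmetric])
qed

lemma AE_0_layer_integral:
  assumes w[measurable]: "w \<in> borel_measurable M" and 0: "layer_integral \<sigma> M w = 0"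
  shows "AE x in M. w x = 0"
proof -
  have "AE x in M. w x \<le> ennreal (1 / real (Suc n))" for n
  proof -
    have "ennreal (1 / real (Suc n)) * \<sigma> (emeasure M {x \<in> space M. ennreal (1 / real (Suc n)) < w x}) \<le> 0"
      using level_le_layer_integral[OF w, of "1 / real (Suc n)"] 0 by simp
    then have "emeasure M {x \<in> space M. ennreal (1 / real (Suc n)) < w x} = 0"
      using sigma_eq_0 by simp
    then show ?thesis by (subst AE_iff_measurable[OF _ refl]) (auto simp: not_le)
  qed
  then have "AE x in M. \<forall>n. w x \<le> ennreal (1 / real (Suc n))" by (simp add: AE_all_countable)
  then show ?thesis
  proof eventually_elim
    case (elim x)
    have "(\<lambda>n. ennreal (1 / real (Suc n))) \<longlonglongrightarrow> ennreal 0"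
      by (intro tendsto_ennrealI LIMSEQ_Suc[OF lim_1_over_n])
    then have "w x \<le> ennreal 0" using elim by (intro Lim_bounded2) auto
    then show ?case by simp
  qed
qed

lemma layer_integral_0: "layer_integral \<sigma> M (\<lambda>_. 0) = 0"
  using sigma_eq_0[of 0] by (simp add: layer_integral_def)

end

lemma lorentz_enorm_eq_layer_integral:
  assumes "\<Omega> \<in> sets lebesgue"
  shows "lorentz_enorm \<psi> \<Omega> f = layer_integral (tau_inv \<psi>) (lebesgue_on \<Omega>) (\<lambda>x. ennreal (norm (f x)))"
  unfolding lorentz_enorm_def layer_integral_def distrib_fun_def
proof (intro nn_integral_cong)
  fix s :: real
  have "emeasure (lebesgue_on \<Omega>) {x \<in> \<Omega>. s < norm (f x)} = emeasure lebesgue {x \<in> \<Omega>. s < norm (f x)}"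
    using assms by (intro emeasure_restrict_space) auto
  then show "indicator {0..} s * tau_inv \<psi> (emeasure lebesgue {x \<in> \<Omega>. s < norm (f x)})
     = indicator {0..} s * tau_inv \<psi> (emeasure (lebesgue_on \<Omega>) {x \<in> space (lebesgue_on \<Omega>). ennreal s < ennreal (norm (f x))})"
    by (auto simp: indicator_def ennreal_less_iff space_restrict_space simp del: emeasure_completion)
qed

text \<open>Compact sets have finite measure, so finiteness of the quasi-norm already implies local
  integrability. Membership is checked through this criterion from here on.\<close>

lemma lorentz_space_iff:
  fixes f :: "'a::euclidean_space \<Rightarrow> 'b::{banach,second_countable_topology}"
  assumes psi: "admissible_psi \<psi>" and \<Omega>: "\<Omega> \<in> sets lebesgue"
  shows "f \<in> lorentz_space \<psi> \<Omega> \<longleftrightarrow> f \<in> borel_measurable (lebesgue_on \<Omega>) \<and>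
     layer_integral (tau_inv \<psi>) (lebesgue_on \<Omega>) (\<lambda>x. ennreal (norm (f x))) < \<infinity>"
proof -
  interpret quasiconcave "tau_inv \<psi>" by (rule quasiconcave_tau_inv[OF psi])
  have "set_integrable lebesgue C f" if f: "f \<in> borel_measurable (lebesgue_on \<Omega>)"
      and fin: "layer_integral (tau_inv \<psi>) (lebesgue_on \<Omega>) (\<lambda>x. ennreal (norm (f x))) < \<infinity>"
      and C: "compact C" "C \<subseteq> \<Omega>" for C
    unfolding set_integrable_def
  proof (rule integrableI_bounded)
    have Cl: "C \<in> sets lebesgue" using C by (simp add: lmeasurable_compact fmeasurableD)
    have "f \<in> borel_measurable (lebesgue_on C)" using f C(2) by (rule measurable_restrict_mono)
    then show "(\<lambda>x. indicator C x *\<^sub>R f x) \<in> borel_measurable lebesgue"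
      using Cl by (subst (asm) borel_measurable_restrict_space_iff) auto
    have C': "C \<in> sets (lebesgue_on \<Omega>)" using Cl C \<Omega> by (simp add: sets_restrict_space_iff)
    have eC: "emeasure (lebesgue_on \<Omega>) C = emeasure lebesgue C"
      using C \<Omega> by (intro emeasure_restrict_space) auto
    have "(\<integral>\<^sup>+ x. ennreal (norm (indicator C x *\<^sub>R f x)) \<partial>lebesgue)
       = (\<integral>\<^sup>+ x. (ennreal (norm (f x)) * indicator C x) * indicator \<Omega> x \<partial>lebesgue)"
      using C by (intro nn_integral_cong) (auto simp: indicator_def)
    also have "\<dots> = (\<integral>\<^sup>+ x. ennreal (norm (f x)) * indicator C x \<partial>lebesgue_on \<Omega>)"
      using \<Omega> by (intro nn_integral_restrict_space[symmetric]) auto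
    also have "\<dots> < \<infinity>"
    proof (cases "emeasure (lebesgue_on \<Omega>) C = 0")
      case True
      then have "AE x in lebesgue_on \<Omega>. x \<notin> C" using C' by (intro AE_not_in) auto
      then have "(\<integral>\<^sup>+ x. ennreal (norm (f x)) * indicator C x \<partial>lebesgue_on \<Omega>) = (\<integral>\<^sup>+ x. 0 \<partial>lebesgue_on \<Omega>)"
        by (intro nn_integral_cong_AE) (auto elim!: eventually_mono)
      then show ?thesis by simp
    next
      case False
      let ?m = "emeasure (lebesgue_on \<Omega>) C"
      have m: "0 < ?m" "?m < \<infinity>"
        using False lmeasurable_compact[OF C(1)] unfolding eC by (auto simp: zero_less_iff_neq_zero fmeasurable_def simp del: emeasure_completion)
      have "(\<integral>\<^sup>+ x. ennreal (norm (f x)) * indicator C x \<partial>lebesgue_on \<Omega>)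
        \<le> ?m / tau_inv \<psi> ?m * layer_integral (tau_inv \<psi>) (lebesgue_on \<Omega>) (\<lambda>x. ennreal (norm (f x)))"
        using f C' m by (intro nn_integral_le_layer_integral) auto
      also have "\<dots> < \<infinity>"
      proof -
        have "tau_inv \<psi> ?m \<noteq> 0" using m sigma_eq_0[of ?m] by auto
        then have "?m / tau_inv \<psi> ?m < top"
          using m(2) by (simp add: less_top[symmetric] ennreal_divide_eq_top_iff)
        then show ?thesis using fin by (simp add: ennreal_mult_less_top)
      qed
      finally show ?thesis .
    qed
    finally show "(\<integral>\<^sup>+ x. ennreal (norm (indicator C x *\<^sub>R f x)) \<partial>lebesgue) < \<infinity>" .
  qed
  then show ?thesis
    unfolding lorentz_space_def locally_integrable_on_def lorentz_enorm_eq_layer_integral[OF \<Omega>] by auto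
qed

section \<open>Weighted composition operators\<close>

lemma sup_linear_operator_id: "sup_linear_operator M (\<lambda>v. v)"
  by standard auto

lemma sup_linear_operator_compose:
  assumes "sup_linear_operator M R" "sup_linear_operator M R'"
  shows "sup_linear_operator M (\<lambda>v. R (R' v))"
proof -
  interpret R: sup_linear_operator M R by fact
  interpret R': sup_linear_operator M R' by fact
  show ?thesis
  proof
    fix x assume x: "x \<in> space M"
    have "R (R' (\<lambda>_. 0)) x = R (\<lambda>_. 0) x" using R'.zero x by (intro R.cong) auto
    then show "R (R' (\<lambda>_. 0)) x = 0" using R.zero x by simp
    show "R (R' (\<lambda>x. c * v x + w x)) x = c * R (R' v) x + R (R' w) x"
      if "v \<in> borel_measurable M" "w \<in> borel_measurable M" for v w c
    proof -
      have "R (R' (\<lambda>x. c * v x + w x)) x = R (\<lambda>x. c * R' v x + R' w x) x"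
        using that x by (intro R.cong R'.linear) auto
      then show ?thesis using that x R'.measurable R.linear by simp
    qed
    show "R (R' v) x \<le> R (R' w) x" if "\<And>x. x \<in> space M \<Longrightarrow> v x \<le> w x" for v w
      using that x by (intro R.mono R'.mono) auto
    show "R (R' (\<lambda>x. SUP k. u k x)) x = (SUP k. R (R' (u k)) x)"
      if u: "\<And>k::nat. u k \<in> borel_measurable M" "\<And>x. incseq (\<lambda>k. u k x)" for u
    proof -
      let ?u = "\<lambda>k x. if x \<in> space M then R' (u k) x else 0"
      have [measurable]: "R' (u k) \<in> borel_measurable M" for k using u R'.measurable by blast
      have "R (R' (\<lambda>x. SUP k. u k x)) x = R (\<lambda>x. SUP k. ?u k x) x"
        using u x R'.SUP by (intro R.cong) auto
      also have "\<dots> = (SUP k. R (?u k) x)"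
        using u x by (intro R.SUP) (auto simp: incseq_def cong: measurable_cong intro!: R'.mono)
      also have "\<dots> = (SUP k. R (R' (u k)) x)" using x by (intro SUP_cong refl R.cong) auto
      finally show ?thesis .
    qed
  qed (use R.measurable R'.measurable in blast)
qed

lemma sup_linear_operator_suminf:
  assumes "\<And>i::nat. sup_linear_operator M (R i)"
  shows "sup_linear_operator M (\<lambda>v x. \<Sum>i. R i v x)"
proof
  fix v :: "'a \<Rightarrow> ennreal" assume v: "v \<in> borel_measurable M"
  show "(\<lambda>x. \<Sum>i. R i v x) \<in> borel_measurable M"
    using sup_linear_operator.measurable[OF assms v] by measurable
next
  fix x assume x: "x \<in> space M"
  show "(\<Sum>i. R i (\<lambda>_. 0) x) = 0" using sup_linear_operator.zero[OF assms x] by simp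
  show "(\<Sum>i. R i (\<lambda>x. c * v x + w x) x) = c * (\<Sum>i. R i v x) + (\<Sum>i. R i w x)"
    if "v \<in> borel_measurable M" "w \<in> borel_measurable M" for v w c
    using sup_linear_operator.linear[OF assms that x] by (simp add: suminf_add[symmetric])
  show "(\<Sum>i. R i v x) \<le> (\<Sum>i. R i w x)" if "\<And>x. x \<in> space M \<Longrightarrow> v x \<le> w x" for v w
    using sup_linear_operator.mono[OF assms that x] by (intro suminf_le) auto
  show "(\<Sum>i. R i (\<lambda>x. SUP k. u k x) x) = (SUP k. \<Sum>i. R i (u k) x)"
    if u: "\<And>k::nat. u k \<in> borel_measurable M" "\<And>x. incseq (\<lambda>k. u k x)" for u
  proof -
    have "incseq (\<lambda>k. R i (u k) x)" for i
      unfolding incseq_def using u(2) x sup_linear_operator.mono[OF assms, of "u _" "u _"]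
      by (auto simp: incseq_def)
    then show ?thesis
      using sup_linear_operator.SUP[OF assms u x] by (simp add: ennreal_suminf_SUP_eq)
  qed
qed

text \<open>The positive majorant of P, reduced to its bounds on L^\<infinity>
  (\<open>bounded\<close>) and on L^1 (\<open>integral\<close>). Nonsingularity lets almost
  everywhere statements be pulled back along f n. The L^1 bound is demanded on sets of finite
  measure, which is the form that the area inequality delivers.\<close>

locale transfer_operator =
  fixes M :: "'a measure" and N :: nat and f :: "nat \<Rightarrow> 'a \<Rightarrow> 'a" and G :: "nat \<Rightarrow> 'a \<Rightarrow> ennreal" and \<alpha> :: real
  assumes f: "n \<in> {1..N} \<Longrightarrow> f n \<in> M \<rightarrow>\<^sub>M M"
    and G: "n \<in> {1..N} \<Longrightarrow> G n \<in> borel_measurable M"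
    and nonsingular: "n \<in> {1..N} \<Longrightarrow> A \<in> null_sets M \<Longrightarrow> f n -` A \<inter> space M \<in> null_sets M"
    and \<alpha>: "0 \<le> \<alpha>" "\<alpha> < 1"
    and bounded: "AE x in M. (\<Sum>n=1..N. G n x) \<le> ennreal \<alpha>"
    and integral: "A \<in> sets M \<Longrightarrow> emeasure M A < \<infinity> \<Longrightarrow>
      (\<Sum>n=1..N. \<integral>\<^sup>+ x. G n x * indicator A (f n x) \<partial>M) \<le> ennreal \<alpha> * emeasure M A"
begin

definition p :: "('a \<Rightarrow> ennreal) \<Rightarrow> 'a \<Rightarrow> ennreal" where
  "p v x = (\<Sum>n=1..N. G n x * v (f n x))"

lemma AE_compose:
  assumes "AE x in M. P x" "n \<in> {1..N}"
  shows "AE x in M. P (f n x)"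
proof -
  obtain Z where Z: "Z \<in> null_sets M" "{x \<in> space M. \<not> P x} \<subseteq> Z"
    using assms(1) by (auto simp: eventually_ae_filter)
  show ?thesis
  proof (rule AE_I')
    show "f n -` Z \<inter> space M \<in> null_sets M" by (rule nonsingular[OF assms(2) Z(1)])
    show "{x \<in> space M. \<not> P (f n x)} \<subseteq> f n -` Z \<inter> space M"
      using Z(2) measurable_space[OF f[OF assms(2)]] by auto
  qed
qed

lemma p_measurable: "v \<in> borel_measurable M \<Longrightarrow> p v \<in> borel_measurable M"
  unfolding p_def using f G
  by (intro borel_measurable_sum borel_measurable_times_ennreal measurable_compose[of "f _" M M v]) auto

lemma sup_linear_operator_p: "sup_linear_operator M p"
proof
  fix x assume x: "x \<in> space M"
  show "p (\<lambda>_. 0) x = 0" by (simp add: p_def)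
  show "p (\<lambda>x. c * v x + w x) x = c * p v x + p w x" for v w c
    by (simp add: p_def distrib_left sum.distrib sum_distrib_left ac_simps)
  show "p v x \<le> p w x" if "\<And>x. x \<in> space M \<Longrightarrow> v x \<le> w x" for v w
    unfolding p_def using that x measurable_space[OF f] by (intro sum_mono mult_left_mono) auto
  show "p (\<lambda>x. SUP k. u k x) x = (SUP k. p (u k) x)"
    if u: "\<And>k::nat. u k \<in> borel_measurable M" "\<And>x. incseq (\<lambda>k. u k x)" for u
  proof -
    have "(\<Sum>n=1..N. SUP k. G n x * u k (f n x)) = (SUP k. \<Sum>n=1..N. G n x * u k (f n x))"
      using u(2) by (intro ennreal_SUP_sum[symmetric]) (auto simp: incseq_def intro!: mult_left_mono)
    then show ?thesis by (simp add: p_def SUP_mult_left_ennreal)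
  qed
qed (rule p_measurable)

lemma sup_linear_operator_power: "sup_linear_operator M (p ^^ i)"
proof (induction i)
  case 0 show ?case using sup_linear_operator_id by (simp add: id_def)
next
  case (Suc i)
  then show ?case using sup_linear_operator_compose[OF sup_linear_operator_p Suc] by (simp add: o_def)
qed

lemma p_bounded_AE:
  assumes "AE x in M. v x \<le> c"
  shows "AE x in M. p v x \<le> ennreal \<alpha> * c"
proof -
  have "AE x in M. \<forall>n\<in>{1..N}. v (f n x) \<le> c"
    using AE_compose[OF assms] by (intro AE_finite_allI) auto
  with bounded show ?thesis
  proof eventually_elim
    case (elim x)
    have "p v x \<le> (\<Sum>n=1..N. G n x * c)"
      unfolding p_def using elim(2) by (intro sum_mono mult_left_mono) auto
    also have "\<dots> = (\<Sum>n=1..N. G n x) * c" by (simp add: sum_distrib_right)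
    also have "\<dots> \<le> ennreal \<alpha> * c" using elim(1) by (intro mult_right_mono) auto
    finally show ?case .
  qed
qed

lemma p_mono_AE:
  assumes "AE x in M. v x \<le> w x"
  shows "AE x in M. p v x \<le> p w x"
proof -
  have "AE x in M. \<forall>n\<in>{1..N}. v (f n x) \<le> w (f n x)"
    using AE_compose[OF assms] by (intro AE_finite_allI) auto
  then show ?thesis
    by eventually_elim (auto simp: p_def intro!: sum_mono mult_left_mono)
qed

lemma nn_integral_p_indicator:
  assumes A: "A \<in> sets M"
  shows "(\<integral>\<^sup>+ x. p (indicator A) x \<partial>M) \<le> ennreal \<alpha> * emeasure M A"
proof -
  have eq: "(\<integral>\<^sup>+ x. p (indicator A) x \<partial>M) = (\<Sum>n=1..N. \<integral>\<^sup>+ x. G n x * indicator A (f n x) \<partial>M)"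
    unfolding p_def using f G A
    by (intro nn_integral_sum borel_measurable_times_ennreal measurable_compose[of "f _" M M "indicator A"]) auto
  consider "emeasure M A < \<infinity>" | "emeasure M A = \<infinity>" "\<alpha> = 0" | "emeasure M A = \<infinity>" "0 < \<alpha>"
    using \<alpha> by (cases "emeasure M A = \<infinity>"; cases "\<alpha> = 0") (auto simp: less_top)
  then show ?thesis
  proof cases
    case 1 then show ?thesis unfolding eq by (rule integral[OF A])
  next
    \<comment> \<open>On a set of infinite measure the right-hand side is infinite unless \<alpha> =
      0, when it is 0 * \<infinity> = 0; the sup bound then makes the integrand vanish almost
      everywhere.\<close>
    case 2
    have "AE x in M. p (indicator A) x \<le> ennreal \<alpha> * 1"
      by (rule p_bounded_AE) (simp add: indicator_def)
    then have "AE x in M. p (indicator A) x = 0" using 2 by (auto elim!: eventually_mono)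
    then have "(\<integral>\<^sup>+ x. p (indicator A) x \<partial>M) = (\<integral>\<^sup>+ x. 0 \<partial>M)" by (rule nn_integral_cong_AE)
    then show ?thesis by simp
  next
    case 3 then show ?thesis by (simp add: ennreal_mult_top)
  qed
qed

lemma nn_integral_p:
  assumes v[measurable]: "v \<in> borel_measurable M"
  shows "(\<integral>\<^sup>+ x. p v x \<partial>M) \<le> ennreal \<alpha> * (\<integral>\<^sup>+ x. v x \<partial>M)"
proof -
  interpret p: sup_linear_operator M p by (rule sup_linear_operator_p)
  note p_measurable[measurable]
  have approx: "(\<integral>\<^sup>+ x. p (dyadic_layers k v) x \<partial>M) \<le> ennreal \<alpha> * (\<integral>\<^sup>+ x. v x \<partial>M)" for k
  proof -
    define d :: ennreal where "d = ennreal (1 / 2 ^ k)"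
    define A where "A j = {x \<in> space M. ennreal (real j / 2 ^ k) < v x}" for j :: nat
    have A[measurable]: "A j \<in> sets M" for j unfolding A_def by measurable
    have eq: "dyadic_layers k v x = (\<Sum>j=1..4 ^ k. d * indicator (A j) x)" if "x \<in> space M" for x
      using that by (auto simp: dyadic_layers_def A_def d_def indicator_def)
    have "(\<integral>\<^sup>+ x. p (dyadic_layers k v) x \<partial>M) = (\<integral>\<^sup>+ x. (\<Sum>j=1..4 ^ k. d * p (indicator (A j)) x) \<partial>M)"
    proof (rule nn_integral_cong)
      fix x assume x: "x \<in> space M"
      have "p (dyadic_layers k v) x = p (\<lambda>x. \<Sum>j=1..4 ^ k. d * indicator (A j) x) x"
        using x by (intro p.cong eq)
      also have "\<dots> = (\<Sum>j=1..4 ^ k. d * p (indicator (A j)) x)" by (rule p.sum[OF A x])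
      finally show "p (dyadic_layers k v) x = (\<Sum>j=1..4 ^ k. d * p (indicator (A j)) x)" .
    qed
    also have "\<dots> = (\<Sum>j=1..4 ^ k. d * (\<integral>\<^sup>+ x. p (indicator (A j)) x \<partial>M))"
      by (subst nn_integral_sum) (auto simp: nn_integral_cmult)
    also have "\<dots> \<le> (\<Sum>j=1..4 ^ k. d * (ennreal \<alpha> * emeasure M (A j)))"
      by (intro sum_mono mult_left_mono nn_integral_p_indicator) auto
    also have "\<dots> = ennreal \<alpha> * (\<Sum>j=1..4 ^ k. d * emeasure M (A j))"
      unfolding sum_distrib_left by (intro sum.cong refl) (simp only: ac_simps)
    also have "(\<Sum>j=1..4 ^ k. d * emeasure M (A j)) = (\<integral>\<^sup>+ x. (\<Sum>j=1..4 ^ k. d * indicator (A j) x) \<partial>M)"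
      by (subst nn_integral_sum) (auto simp: nn_integral_cmult)
    also have "\<dots> = (\<integral>\<^sup>+ x. dyadic_layers k v x \<partial>M)" by (intro nn_integral_cong) (simp only: eq)
    also have "ennreal \<alpha> * \<dots> \<le> ennreal \<alpha> * (\<integral>\<^sup>+ x. v x \<partial>M)"
      by (intro mult_left_mono nn_integral_mono dyadic_layers_le) auto
    finally show ?thesis .
  qed
  have "(\<integral>\<^sup>+ x. p v x \<partial>M) = (\<integral>\<^sup>+ x. (SUP k. p (dyadic_layers k v) x) \<partial>M)"
  proof (rule nn_integral_cong)
    fix x assume "x \<in> space M"
    then show "p v x = (SUP k. p (dyadic_layers k v) x)"
      using p.SUP[of "\<lambda>k. dyadic_layers k v" x] by (simp add: SUP_dyadic_layers incseq_dyadic_layers)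
  qed
  also have "\<dots> = (SUP k. \<integral>\<^sup>+ x. p (dyadic_layers k v) x \<partial>M)"
  proof (rule nn_integral_monotone_convergence_SUP)
    show "incseq (\<lambda>k. p (dyadic_layers k v))"
      using incseq_dyadic_layers[of v]
      by (auto simp: incseq_def le_fun_def p_def intro!: sum_mono mult_left_mono)
  qed simp
  also have "\<dots> \<le> ennreal \<alpha> * (\<integral>\<^sup>+ x. v x \<partial>M)" by (intro SUP_least approx)
  finally show ?thesis .
qed

lemma power_measurable: "v \<in> borel_measurable M \<Longrightarrow> (p ^^ i) v \<in> borel_measurable M"
  by (rule sup_linear_operator.measurable[OF sup_linear_operator_power])

lemma power_bounded_AE: "AE x in M. (p ^^ i) (indicator A) x \<le> ennreal (\<alpha> ^ i)"
proof (induction i)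
  case (Suc i)
  then show ?case using p_bounded_AE[OF Suc] \<alpha> by (simp add: ennreal_mult)
qed (simp add: indicator_def)

lemma nn_integral_power:
  assumes "A \<in> sets M"
  shows "(\<integral>\<^sup>+ x. (p ^^ i) (indicator A) x \<partial>M) \<le> ennreal (\<alpha> ^ i) * emeasure M A"
proof (induction i)
  case (Suc i)
  have "(\<integral>\<^sup>+ x. (p ^^ Suc i) (indicator A) x \<partial>M) \<le> ennreal \<alpha> * (\<integral>\<^sup>+ x. (p ^^ i) (indicator A) x \<partial>M)"
    using nn_integral_p[OF power_measurable, of "indicator A" i] assms by simp
  also have "\<dots> \<le> ennreal \<alpha> * (ennreal (\<alpha> ^ i) * emeasure M A)" using Suc by (intro mult_left_mono) auto
  finally show ?case using \<alpha> by (simp add: ennreal_mult mult.assoc)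
qed (use assms in simp)

text \<open>A majorant of the Neumann series from index j on. It is itself a positive operator with
  a geometric bound on L^1 and L^\<infinity>, so a single application of the interpolation estimate
  covers the whole tail.\<close>

definition tail :: "nat \<Rightarrow> ('a \<Rightarrow> ennreal) \<Rightarrow> 'a \<Rightarrow> ennreal" where
  "tail j v x = (\<Sum>i. (p ^^ (i + j)) v x)"

lemma sup_linear_operator_tail: "sup_linear_operator M (tail j)"
  using sup_linear_operator_suminf[of M "\<lambda>i. p ^^ (i + j)"] sup_linear_operator_power
  by (simp add: tail_def[abs_def])

lemma suminf_geometric_tail: "(\<Sum>i. ennreal (\<alpha> ^ (i + j))) = ennreal (\<alpha> ^ j / (1 - \<alpha>))"
proof -
  have "(\<lambda>i. \<alpha> ^ j * \<alpha> ^ i) sums (\<alpha> ^ j * (1 / (1 - \<alpha>)))"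
    using \<alpha> by (intro sums_mult geometric_sums) auto
  then have "(\<lambda>i. \<alpha> ^ (i + j)) sums (\<alpha> ^ j / (1 - \<alpha>))" by (simp add: power_add mult.commute)
  then show ?thesis using \<alpha> by (intro suminf_ennreal_eq) auto
qed

lemma tail_bounded_AE: "AE x in M. tail j (indicator A) x \<le> ennreal (\<alpha> ^ j / (1 - \<alpha>))"
proof -
  have "AE x in M. \<forall>i. (p ^^ (i + j)) (indicator A) x \<le> ennreal (\<alpha> ^ (i + j))"
    using power_bounded_AE by (simp add: AE_all_countable)
  then show ?thesis
    unfolding tail_def suminf_geometric_tail[symmetric]
    by eventually_elim (auto intro!: suminf_le)
qed

lemma nn_integral_tail:
  assumes A: "A \<in> sets M"
  shows "(\<integral>\<^sup>+ x. tail j (indicator A) x \<partial>M) \<le> ennreal (\<alpha> ^ j / (1 - \<alpha>)) * emeasure M A"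
proof -
  have "(\<integral>\<^sup>+ x. tail j (indicator A) x \<partial>M) = (\<Sum>i. \<integral>\<^sup>+ x. (p ^^ (i + j)) (indicator A) x \<partial>M)"
    unfolding tail_def using A by (intro nn_integral_suminf power_measurable) simp
  also have "\<dots> \<le> (\<Sum>i. ennreal (\<alpha> ^ (i + j)) * emeasure M A)"
    using nn_integral_power[OF A] by (intro suminf_le) auto
  also have "\<dots> = ennreal (\<alpha> ^ j / (1 - \<alpha>)) * emeasure M A"
    by (simp add: suminf_geometric_tail)
  finally show ?thesis .
qed

end

section \<open>Quasi-norm bounds for powers and tails\<close>

context quasiconcave begin

lemma layer_integral_add_le:
  assumes "f \<in> borel_measurable M" "w \<in> borel_measurable M" "layer_integral \<sigma> M w < \<infinity>"
  shows "layer_integral \<sigma> M (\<lambda>x. f x + w x) \<le> layer_integral \<sigma> M f + 2 * layer_integral \<sigma> M w"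
proof -
  have "layer_integral \<sigma> M (\<lambda>x. f x + w x) \<le> layer_integral \<sigma> M f + 2 * ennreal 1 * layer_integral \<sigma> M w"
    by (rule layer_integral_add_operator[OF assms _ sup_linear_operator_id])
      (auto split: split_indicator)
  then show ?thesis by simp
qed

lemma layer_integral_add_tail:
  assumes T: "transfer_operator M N F G \<alpha>"
    and "f \<in> borel_measurable M" "w \<in> borel_measurable M" "layer_integral \<sigma> M w < \<infinity>"
  shows "layer_integral \<sigma> M (\<lambda>x. f x + transfer_operator.tail N F G j w x)
       \<le> layer_integral \<sigma> M f + 2 * ennreal (\<alpha> ^ j / (1 - \<alpha>)) * layer_integral \<sigma> M w"
proof -
  interpret transfer_operator M N F G \<alpha> by (rule T)
  show ?thesis
    using assms \<alpha> tail_bounded_AE nn_integral_tail sup_linear_operator_tail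
    by (intro layer_integral_add_operator) auto
qed

lemma layer_integral_power:
  assumes T: "transfer_operator M N F G \<alpha>"
    and w: "w \<in> borel_measurable M" "layer_integral \<sigma> M w < \<infinity>"
  shows "layer_integral \<sigma> M ((transfer_operator.p N F G ^^ i) w) \<le> 2 * ennreal (\<alpha> ^ i) * layer_integral \<sigma> M w"
proof -
  interpret transfer_operator M N F G \<alpha> by (rule T)
  have "layer_integral \<sigma> M (\<lambda>x. 0 + (p ^^ i) w x) \<le> layer_integral \<sigma> M (\<lambda>_. 0) + 2 * ennreal (\<alpha> ^ i) * layer_integral \<sigma> M w"
    using w \<alpha> power_bounded_AE nn_integral_power sup_linear_operator_power
    by (intro layer_integral_add_operator) auto
  then show ?thesis by (simp add: layer_integral_0)
qed

end

section \<open>Change of variables without an ordered index type\<close>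

text \<open>The change of variables theorem of the library requires a well-ordered index type, so
  coordinates are renamed along a bijection with the phantom type of an initial segment of \<open>\<nat>\<close>.\<close>

typedef ('a::finite) ordinal_index = "{..<CARD('a)}"
  by (rule exI[of _ 0]) simp

instantiation ordinal_index :: (finite) wellorder
begin

definition less_eq_ordinal_index :: "'a ordinal_index \<Rightarrow> 'a ordinal_index \<Rightarrow> bool" where
  "less_eq_ordinal_index x y \<longleftrightarrow> Rep_ordinal_index x \<le> Rep_ordinal_index y"

definition less_ordinal_index :: "'a ordinal_index \<Rightarrow> 'a ordinal_index \<Rightarrow> bool" where
  "less_ordinal_index x y \<longleftrightarrow> Rep_ordinal_index x < Rep_ordinal_index y"

instance
proof
  fix P and a :: "'a ordinal_index"
  assume step: "\<And>x :: 'a ordinal_index. (\<And>y. y < x \<Longrightarrow> P y) \<Longrightarrow> P x"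
  show "P a"
  proof (induction "Rep_ordinal_index a" arbitrary: a rule: less_induct)
    case less
    show ?case by (rule step) (use less in \<open>simp add: less_ordinal_index_def\<close>)
  qed
qed (auto simp: less_eq_ordinal_index_def less_ordinal_index_def Rep_ordinal_index_inject)

end

instance ordinal_index :: (finite) finite
  by standard (simp add: type_definition.univ[OF type_definition_ordinal_index])

lemma ex_ordinal_index_bij: "\<exists>b :: 'n::finite ordinal_index \<Rightarrow> 'n. bij b"
proof -
  have "CARD('n ordinal_index) = CARD('n)"
    by (simp add: type_definition.card[OF type_definition_ordinal_index])
  then show ?thesis
    using finite_same_card_bij[of "UNIV :: 'n ordinal_index set" "UNIV :: 'n set"] by auto
qed

section \<open>Renaming of coordinates\<close>

definition reindex :: "('m \<Rightarrow> 'n) \<Rightarrow> real^'n \<Rightarrow> real^'m" where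
  "reindex b x = (\<chi> i. x $ b i)"

lemma reindex_nth [simp]: "reindex b x $ i = x $ b i"
  by (simp add: reindex_def)

lemma linear_reindex: "linear (reindex b)"
  by (rule linearI) (auto simp: vec_eq_iff)

lemma bounded_linear_reindex: "bounded_linear (reindex b)"
  by (rule linear_conv_bounded_linear[THEN iffD1, OF linear_reindex])

lemma reindex_reindex_inv:
  assumes "bij b"
  shows "reindex b (reindex (inv b) y) = y" "reindex (inv b) (reindex b x) = x"
  using assms by (simp_all add: vec_eq_iff bij_is_inj bij_is_surj surj_f_inv_f inv_f_f)

lemma bij_reindex: "bij b \<Longrightarrow> bij (reindex b)"
  by (rule o_bij[of "reindex (inv b)"]) (auto simp: fun_eq_iff reindex_reindex_inv)

lemma emeasure_lborel_box_cart:
  fixes l u :: "real^'n"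
  assumes "\<And>i. l $ i \<le> u $ i"
  shows "emeasure lborel (box l u) = ennreal (\<Prod>i\<in>UNIV. u $ i - l $ i)"
proof -
  have "emeasure lborel (box l u) = ennreal (\<Prod>b\<in>Basis. (u - l) \<bullet> b)"
    using assms by (intro emeasure_lborel_box) (auto simp: Basis_vec_def inner_axis)
  also have "(\<Prod>b\<in>Basis. (u - l) \<bullet> b) = (\<Prod>i\<in>UNIV. u $ i - l $ i)"
    by (simp add: Basis_vec_def cart_eq_inner_axis axis_eq_axis prod.UNION_disjoint inner_diff_left)
  finally show ?thesis .
qed

lemma reindex_measurable [measurable]: "reindex b \<in> borel_measurable borel"
  by (intro borel_measurable_continuous_onI linear_continuous_on bounded_linear_reindex)

lemma distr_lborel_reindex:
  fixes b :: "'m::finite \<Rightarrow> 'n::finite"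
  assumes b: "bij b"
  shows "distr lborel borel (reindex b) = lborel"
proof (rule lborel_eqI[symmetric])
  fix l u :: "real^'m" assume le: "\<And>b. b \<in> Basis \<Longrightarrow> l \<bullet> b \<le> u \<bullet> b"
  then have lu: "l $ i \<le> u $ i" for i by (auto simp: Basis_vec_def cart_eq_inner_axis)
  have "reindex b -` box l u = box (reindex (inv b) l) (reindex (inv b) u)"
  proof -
    have "b (inv b j) = j" for j using b by (simp add: bij_is_surj surj_f_inv_f)
    then show ?thesis
      by (auto simp: mem_box_cart) (metis b bij_inv_eq_iff)+
  qed
  then have "emeasure (distr lborel borel (reindex b)) (box l u)
     = emeasure lborel (box (reindex (inv b) l) (reindex (inv b) u))"
    by (simp add: emeasure_distr)
  also have "\<dots> = ennreal (\<Prod>j\<in>UNIV. u $ inv b j - l $ inv b j)"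
    using lu by (simp add: emeasure_lborel_box_cart)
  also have "(\<Prod>j\<in>UNIV. u $ inv b j - l $ inv b j) = (\<Prod>i\<in>UNIV. u $ i - l $ i)"
    using prod.reindex_bij_betw[OF bij_imp_bij_inv[OF b], of "\<lambda>i. u $ i - l $ i"] by simp
  also have "ennreal \<dots> = emeasure lborel (box l u)"
    by (rule emeasure_lborel_box_cart[symmetric, OF lu])
  finally show "emeasure (distr lborel borel (reindex b)) (box l u) = (\<Prod>b\<in>Basis. (u - l) \<bullet> b)"
    using le by simp
qed simp

lemma
  fixes b :: "'m::finite \<Rightarrow> 'n::finite"
  assumes b: "bij b"
  shows reindex_measurable_lebesgue: "reindex b \<in> lebesgue \<rightarrow>\<^sub>M lebesgue" (is ?A)
    and distr_lebesgue_reindex: "distr lebesgue lebesgue (reindex b) = lebesgue" (is ?B)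
proof -
  have d: "distr lebesgue lborel (reindex b) = lborel"
  proof -
    have "distr lebesgue lborel (reindex b) = distr lborel lborel (reindex b)"
      by (rule distr_completion) simp
    also have "\<dots> = distr lborel borel (reindex b)" by (rule distr_cong) auto
    finally show ?thesis using distr_lborel_reindex[OF b] by simp
  qed
  have m: "reindex b \<in> lebesgue \<rightarrow>\<^sub>M lborel"
    by (rule measurable_completion) simp
  show ?A by (rule completion.measurable_completion2[OF m]) (simp add: d)
  show ?B using completion.completion_distr_eq[OF m] by (simp add: d)
qed

lemma reindex_image_lebesgue:
  fixes b :: "'m::finite \<Rightarrow> 'n::finite"
  assumes b: "bij b"
  shows "reindex b ` S = reindex (inv b) -` S"
    and "S \<in> sets lebesgue \<Longrightarrow> reindex b ` S \<in> sets lebesgue"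
    and "S \<in> sets lebesgue \<Longrightarrow> emeasure lebesgue (reindex b ` S) = emeasure lebesgue S"
proof -
  show eq: "reindex b ` S = reindex (inv b) -` S" for S
    using reindex_reindex_inv[OF b] by (auto simp: image_iff) metis
  have bi: "bij (inv b)" using b by (rule bij_imp_bij_inv)
  show "reindex b ` S \<in> sets lebesgue" if "S \<in> sets lebesgue"
    using measurable_sets[OF reindex_measurable_lebesgue[OF bi] that] by (simp add: eq)
  show "emeasure lebesgue (reindex b ` S) = emeasure lebesgue S" if "S \<in> sets lebesgue"
    using emeasure_distr[OF reindex_measurable_lebesgue[OF bi] that]
    by (simp add: eq distr_lebesgue_reindex[OF bi])
qed

text \<open>Leibniz's formula is reindexed by the conjugation p \<mapsto> b^-1 \<circ> p \<circ> b,
  which preserves signs. The two index types differ, so similarity of matrices over a single type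
  does not apply.\<close>

lemma det_reindex:
  fixes A :: "real^'n::finite^'n" and b :: "'m::finite \<Rightarrow> 'n"
  assumes b: "bij b"
  shows "det (\<chi> i j. A $ b i $ b j) = det A"
proof -
  define c where "c p = inv b \<circ> p \<circ> b" for p :: "'n \<Rightarrow> 'n"
  have bb: "b (inv b j) = j" "inv b (b i) = i" for i j
    using b by (simp_all add: bij_is_surj surj_f_inv_f bij_is_inj)
  have bij_c: "bij_betw c {p. p permutes UNIV} {p. p permutes UNIV}"
  proof (rule bij_betw_byWitness[where f'="\<lambda>q. b \<circ> q \<circ> inv b"])
    show "c ` {p. p permutes UNIV} \<subseteq> {p. p permutes UNIV}"
      using b by (auto simp: c_def dest!: permutes_bij intro!: bij_imp_permutes bij_comp bij_imp_bij_inv)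
    show "(\<lambda>q. b \<circ> q \<circ> inv b) ` {p. p permutes UNIV} \<subseteq> {p. p permutes UNIV}"
      using b by (auto dest!: permutes_bij intro!: bij_imp_permutes bij_comp bij_imp_bij_inv)
  qed (auto simp: c_def fun_eq_iff bb)
  have sign_c: "sign (c p) = sign p" if "p permutes UNIV" for p
  proof -
    have "c p = map_permutation UNIV (inv b) p"
      using b by (auto simp: c_def map_permutation_def restrict_id_def fun_eq_iff inv_inv_eq bij_is_surj bij_imp_bij_inv)
    then show ?thesis
      using sign_map_permutation[of "inv b" UNIV p] that b by (simp add: bij_is_inj bij_imp_bij_inv)
  qed
  have "det (\<chi> i j. A $ b i $ b j)
     = (\<Sum>q | q permutes UNIV. of_int (sign q) * (\<Prod>i\<in>UNIV. A $ b i $ b (q i)))"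
    by (simp add: det_def)
  also have "\<dots> = (\<Sum>p | p permutes UNIV. of_int (sign (c p)) * (\<Prod>i\<in>UNIV. A $ b i $ b (c p i)))"
    by (rule sum.reindex_bij_betw[OF bij_c, symmetric])
  also have "\<dots> = det A"
    unfolding det_def
  proof (intro sum.cong refl arg_cong2[where f="(*)"])
    fix p :: "'n \<Rightarrow> 'n" assume p: "p \<in> {p. p permutes UNIV}"
    then show "of_int (sign (c p)) = (of_int (sign p) :: real)" by (simp add: sign_c)
    have "(\<Prod>i\<in>UNIV. A $ b i $ b (c p i)) = (\<Prod>i\<in>UNIV. A $ b i $ p (b i))"
      by (simp add: c_def bb)
    also have "\<dots> = (\<Prod>i\<in>UNIV. A $ i $ p i)"
      by (rule prod.reindex_bij_betw[OF b])
    finally show "(\<Prod>i\<in>UNIV. A $ b i $ b (c p i)) = (\<Prod>i\<in>UNIV. A $ i $ p i)" .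
  qed
  finally show ?thesis .
qed

lemma matrix_reindex:
  fixes A :: "real^'n::finite \<Rightarrow> real^'n" and b :: "'m::finite \<Rightarrow> 'n"
  assumes b: "bij b"
  shows "matrix (\<lambda>y. reindex b (A (reindex (inv b) y))) = (\<chi> i j. matrix A $ b i $ b j)"
proof -
  have "reindex (inv b) (axis j 1) = axis (b j) 1" for j
    using bij_inv_eq_iff[OF b] by (simp add: vec_eq_iff axis_def) metis
  then have "A (reindex (inv b) (axis j 1)) $ b i = A (axis (b j) 1) $ b i" for i j by simp
  then show ?thesis by (simp add: matrix_def vec_eq_iff)
qed

lemma nn_integral_det_wellorder:
  fixes f :: "real^'m::{finite,wellorder} \<Rightarrow> real^'m::_"
  assumes S: "S \<in> sets lebesgue"
    and der: "\<And>x. x \<in> S \<Longrightarrow> (f has_derivative f' x) (at x within S)"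
    and inj: "inj_on f S" and im: "f ` S \<in> lmeasurable"
  shows "(\<lambda>x. indicator S x * ennreal \<bar>det (matrix (f' x))\<bar>) \<in> borel_measurable lebesgue"
    and "(\<integral>\<^sup>+ x. indicator S x * ennreal \<bar>det (matrix (f' x))\<bar> \<partial>lebesgue) = emeasure lebesgue (f ` S)"
proof -
  have "(\<lambda>x. det (matrix (f' x))) \<in> borel_measurable (lebesgue_on S)"
    by (rule borel_measurable_det_Jacobian[OF S der])
  then have "(\<lambda>x. ennreal \<bar>det (matrix (f' x))\<bar>) \<in> borel_measurable (restrict_space lebesgue S)"
    by measurable
  then show "(\<lambda>x. indicator S x * ennreal \<bar>det (matrix (f' x))\<bar>) \<in> borel_measurable lebesgue"
    using S by (subst (asm) borel_measurable_restrict_space_iff_ennreal) (auto simp: mult.commute)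
  have "((\<lambda>x. \<bar>det (matrix (f' x))\<bar>) has_integral measure lebesgue (f ` S)) S"
    using has_measure_differentiable_image[OF S der inj] im by blast
  from nn_integral_has_integral_lebesgue'[OF _ this]
  have "(\<integral>\<^sup>+ x. ennreal \<bar>det (matrix (f' x))\<bar> * indicator S x \<partial>lborel) = ennreal (measure lebesgue (f ` S))"
    by simp
  then show "(\<integral>\<^sup>+ x. indicator S x * ennreal \<bar>det (matrix (f' x))\<bar> \<partial>lebesgue) = emeasure lebesgue (f ` S)"
    unfolding nn_integral_completion emeasure_eq_measure2[OF im] by (simp only: mult.commute)
qed

text \<open>Conjugation by a renaming of coordinates changes neither the measures of sets nor
  injectivity nor the Jacobian determinant, so the well-ordered case carries over.\<close>

proposition
  fixes f :: "real^'n \<Rightarrow> real^'n"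
  assumes S: "S \<in> sets lebesgue"
    and der: "\<And>x. x \<in> S \<Longrightarrow> (f has_derivative f' x) (at x within S)"
    and inj: "inj_on f S" and im: "f ` S \<in> lmeasurable"
  shows det_measurable_inj: "(\<lambda>x. indicator S x * ennreal \<bar>det (matrix (f' x))\<bar>) \<in> borel_measurable lebesgue" (is ?A)
    and nn_integral_det_inj:
      "(\<integral>\<^sup>+ x. indicator S x * ennreal \<bar>det (matrix (f' x))\<bar> \<partial>lebesgue) = emeasure lebesgue (f ` S)" (is ?B)
proof -
  obtain b :: "'n ordinal_index \<Rightarrow> 'n" where b: "bij b" using ex_ordinal_index_bij by auto
  let ?r = "reindex b" and ?s = "reindex (inv b)"
  have bi: "bij (inv b)" using b by (rule bij_imp_bij_inv)
  note [simp] = reindex_reindex_inv[OF b]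
  define F where "F = ?r \<circ> f \<circ> ?s"
  define F' where "F' y = (\<lambda>z. ?r (f' (?s y) (?s z)))" for y
  have FS: "F ` ?r ` S = ?r ` f ` S" by (auto simp: F_def image_image)
  have S': "?r ` S \<in> sets lebesgue" by (rule reindex_image_lebesgue(2)[OF b S])
  have fS: "f ` S \<in> sets lebesgue" using im by blast
  have der': "(F has_derivative F' y) (at y within ?r ` S)" if "y \<in> ?r ` S" for y
  proof -
    have sr: "?s ` ?r ` S = S" by (simp add: image_image)
    have "?s y \<in> S" using that by auto
    have "(?s has_derivative ?s) (at y within ?r ` S)"
      by (rule bounded_linear.has_derivative[OF bounded_linear_reindex has_derivative_ident, simplified])
    then have "((f \<circ> ?s) has_derivative (f' (?s y) \<circ> ?s)) (at y within ?r ` S)"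
      using der[OF \<open>?s y \<in> S\<close>] by (intro diff_chain_within) (auto simp: sr)
    then have "((\<lambda>z. ?r ((f \<circ> ?s) z)) has_derivative (\<lambda>z. ?r ((f' (?s y) \<circ> ?s) z))) (at y within ?r ` S)"
      by (rule bounded_linear.has_derivative[OF bounded_linear_reindex])
    then show ?thesis by (simp add: F_def F'_def o_def)
  qed
  have inj': "inj_on F (?r ` S)"
    using inj bij_is_inj[OF bij_reindex[OF b]] by (auto simp: inj_on_def F_def)
  have im': "F ` ?r ` S \<in> lmeasurable"
    unfolding FS 
    using reindex_image_lebesgue(2,3)[OF b fS] fmeasurableD2[OF im] by (intro fmeasurableI) (auto simp only: top.not_eq_extremum infinity_ennreal_def)
  note W = nn_integral_det_wellorder[OF S' der' inj' im']
  have eq: "indicator (?r ` S) (?r x) * ennreal \<bar>det (matrix (F' (?r x)))\<bar>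
      = indicator S x * ennreal \<bar>det (matrix (f' x))\<bar>" for x
  proof -
    have "?r x \<in> ?r ` S \<longleftrightarrow> x \<in> S" using bij_is_inj[OF bij_reindex[OF b]] by (auto simp: inj_on_def)
    moreover have "det (matrix (F' (?r x))) = det (matrix (f' x))"
      by (simp add: F'_def matrix_reindex[OF b] det_reindex[OF b])
    ultimately show ?thesis by (simp add: indicator_def)
  qed
  show ?A using measurable_compose[OF reindex_measurable_lebesgue[OF b] W(1)] by (simp only: eq)
  have "(\<integral>\<^sup>+ y. indicator (?r ` S) y * ennreal \<bar>det (matrix (F' y))\<bar> \<partial>lebesgue)
      = (\<integral>\<^sup>+ y. indicator (?r ` S) y * ennreal \<bar>det (matrix (F' y))\<bar> \<partial>distr lebesgue lebesgue ?r)"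
    by (simp only: distr_lebesgue_reindex[OF b])
  also have "\<dots> = (\<integral>\<^sup>+ x. indicator S x * ennreal \<bar>det (matrix (f' x))\<bar> \<partial>lebesgue)"
    using W(1) by (subst nn_integral_distr[OF reindex_measurable_lebesgue[OF b]]) (simp_all only: eq measurable_distr_eq1)
  finally show ?B
    using W(2) reindex_image_lebesgue(3)[OF b fS] by (simp add: FS)
qed

section \<open>The area inequality for approximately differentiable maps\<close>

lemma lebesgue_AE_null_sets:
  assumes "AE x in lebesgue. P x"
  shows "{x. \<not> P x} \<in> null_sets lebesgue"
proof -
  obtain N where "N \<in> null_sets lebesgue" "{x. \<not> P x} \<subseteq> N"
    using assms by (auto simp: eventually_ae_filter)
  then show ?thesis by (rule completion.complete2[rotated])
qed

text \<open>A Lebesgue set is a Borel set together with a null set. Borel measurability of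
  \<open>f\<close> handles the first part, the hypothesis on preimages of null sets the
  second.\<close>

lemma nonsingular_measurable_lebesgue:
  assumes \<Omega>: "\<Omega> \<in> sets lebesgue" and f: "f \<in> borel_measurable (lebesgue_on \<Omega>)"
    and null: "\<And>M. M \<in> null_sets lebesgue \<Longrightarrow> f -` M \<inter> \<Omega> \<in> null_sets lebesgue"
  shows "f \<in> lebesgue_on \<Omega> \<rightarrow>\<^sub>M lebesgue"
proof (rule measurableI)
  fix A :: "'b set" assume "A \<in> sets lebesgue"
  then obtain B N where BN: "B \<in> sets borel" "N \<in> null_sets lebesgue" "B \<union> N = A"
    using sets_lebesgue_almost_borel negligible_iff_null_sets by metis
  have "f -` B \<inter> space (lebesgue_on \<Omega>) \<in> sets (lebesgue_on \<Omega>)"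
    by (rule measurable_sets[OF f BN(1)])
  moreover have "f -` N \<inter> \<Omega> \<in> sets (lebesgue_on \<Omega>)"
    using null[OF BN(2)] \<Omega> by (subst sets_restrict_space_iff) auto
  ultimately have "(f -` B \<inter> \<Omega>) \<union> (f -` N \<inter> \<Omega>) \<in> sets (lebesgue_on \<Omega>)"
    by (auto simp: space_restrict_space)
  also have "(f -` B \<inter> \<Omega>) \<union> (f -` N \<inter> \<Omega>) = f -` A \<inter> space (lebesgue_on \<Omega>)"
    using BN by (auto simp: space_restrict_space)
  finally show "f -` A \<inter> space (lebesgue_on \<Omega>) \<in> sets (lebesgue_on \<Omega>)" .
qed simp

section \<open>From approximate differentials to differentials on large sets\<close>

lemma measure_lebesgue_ball:
  fixes c :: "'a::euclidean_space"
  assumes "0 \<le> r"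
  shows "measure lebesgue (ball c r) = r ^ DIM('a) * measure lebesgue (ball (0::'a) 1)"
  using content_ball_conv_unit_ball[OF assms, of c] by (simp add: measure_completion)

lemma measure_lebesgue_unit_ball_pos: "0 < measure lebesgue (ball (0::'a::euclidean_space) 1)"
  using content_ball_pos[of 1 "0::'a"] by (simp add: measure_completion)

text \<open>V misses less than \<delta> times the volume of the large ball, which is at most half
  the volume of the small one, while W fills more than half of the small one.\<close>

lemma subsets_of_ball_meet:
  fixes x y :: "'a::euclidean_space"
  assumes V: "V \<in> sets lebesgue" "V \<subseteq> ball x R" and W: "W \<in> sets lebesgue" "W \<subseteq> ball y \<rho>"
    and sub: "ball y \<rho> \<subseteq> ball x R" and "0 \<le> R" "0 \<le> \<rho>"
    and large: "measure lebesgue V > (1 - \<delta>) * measure lebesgue (ball x R)"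
      "measure lebesgue W > measure lebesgue (ball y \<rho>) / 2"
      "\<delta> * R ^ DIM('a) \<le> \<rho> ^ DIM('a) / 2"
  shows "V \<inter> W \<noteq> {}"
proof
  assume disj: "V \<inter> W = {}"
  have Vf: "V \<in> lmeasurable" "W \<in> lmeasurable"
    using fmeasurableI2[OF lmeasurable_ball V(2,1)] fmeasurableI2[OF lmeasurable_ball W(2,1)] by auto
  let ?v = "measure lebesgue (ball (0::'a) 1)"
  have "measure lebesgue V + measure lebesgue W = measure lebesgue (V \<union> W)"
    using Vf disj by (simp add: measure_Un3)
  also have "\<dots> \<le> measure lebesgue (ball x R)"
    using Vf V W sub by (intro measure_mono_fmeasurable) auto
  finally have "(1 - \<delta>) * (R ^ DIM('a) * ?v) + \<rho> ^ DIM('a) * ?v / 2 < R ^ DIM('a) * ?v"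
    using large(1,2) unfolding measure_lebesgue_ball[OF assms(6)] measure_lebesgue_ball[OF assms(7)] by linarith
  then have "\<rho> ^ DIM('a) / 2 * ?v < \<delta> * R ^ DIM('a) * ?v" by (simp add: algebra_simps)
  then show False
    using large(3) measure_lebesgue_unit_ball_pos[where 'a='a] by (simp add: mult_less_cancel_right)
qed

lemma density_pointD:
  assumes "density_point E x" "0 < \<delta>" "\<delta> \<le> 1"
  obtains d where "0 < d" "\<And>r. 0 < r \<Longrightarrow> r < d \<Longrightarrow>
     E \<inter> ball x r \<in> sets lebesgue \<and> measure lebesgue (E \<inter> ball x r) > (1 - \<delta>) * measure lebesgue (ball x r)"
proof -
  have "\<forall>\<^sub>F r in at_right 0. 1 - \<delta> < measure lebesgue (E \<inter> ball x r) / measure lebesgue (ball x r)"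
    using assms unfolding density_point_def by (intro order_tendstoD) auto
  then obtain d where d: "0 < d"
    "\<And>r. 0 < r \<Longrightarrow> r < d \<Longrightarrow> 1 - \<delta> < measure lebesgue (E \<inter> ball x r) / measure lebesgue (ball x r)"
    unfolding eventually_at_right_field by auto
  show ?thesis
  proof (rule that[OF d(1)])
    fix r :: real assume r: "0 < r" "r < d"
    have pos: "0 < measure lebesgue (ball x r)"
      using r content_ball_pos[of r x] by (simp add: measure_completion)
    then have gt: "(1 - \<delta>) * measure lebesgue (ball x r) < measure lebesgue (E \<inter> ball x r)"
      using d(2)[OF r] by (simp add: field_simps)
    \<comment> \<open>A set outside \<open>sets lebesgue\<close> has \<open>measure\<close> 0 by
      convention, so a measure above a nonnegative number certifies measurability.\<close>
    have "0 \<le> (1 - \<delta>) * measure lebesgue (ball x r)" using assms pos by simp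
    then have "E \<inter> ball x r \<in> sets lebesgue" using gt by (metis measure_notin_sets not_less)
    with gt show "E \<inter> ball x r \<in> sets lebesgue \<and> measure lebesgue (E \<inter> ball x r) > (1 - \<delta>) * measure lebesgue (ball x r)"
      by simp
  qed
qed

text \<open>The defect \<open>2 ^ - (k + 1)\<close> is small enough that the witnesses for \<open>ball x (2 * r)\<close> and
  \<open>ball y r\<close> with \<open>r = norm (x - y)\<close> must meet, which makes \<open>f\<close> locally Lipschitz on these sets.\<close>

definition approx_lipschitz_set :: "(real^'n \<Rightarrow> real^'n) \<Rightarrow> nat \<Rightarrow> (real^'n) set" where
  "approx_lipschitz_set f j = {y. \<forall>r. 0 < r \<and> r * real j < 1 \<longrightarrow>
     (\<exists>W\<in>sets lebesgue. W \<subseteq> ball y r \<and>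
        measure lebesgue W > (1 - (1/2) ^ Suc CARD('n)) * measure lebesgue (ball y r) \<and>
        (\<forall>z\<in>W. norm (f z - f y) \<le> real j * norm (z - y)))}"

lemma approx_lipschitz_setE:
  fixes y :: "real^'n"
  assumes "y \<in> approx_lipschitz_set f j" "0 < r" "r * real j < 1"
  obtains W where "W \<in> sets lebesgue" "W \<subseteq> ball y r"
    "measure lebesgue W > (1 - (1/2) ^ Suc CARD('n)) * measure lebesgue (ball y r)"
    "\<And>z. z \<in> W \<Longrightarrow> norm (f z - f y) \<le> real j * norm (z - y)"
  using bexE[OF assms(1)[unfolded approx_lipschitz_set_def mem_Collect_eq, THEN spec, THEN mp, OF conjI[OF assms(2,3)]]]
    that by metis

lemma half_power_le: "(1/2::real) ^ Suc n \<le> 1/2"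
  by (simp add: power_le_one)

lemma approx_differentiable_imp_lipschitz_set:
  fixes f :: "real^'n \<Rightarrow> real^'n"
  assumes "approx_differentiable \<Omega> f y"
  shows "\<exists>j. y \<in> approx_lipschitz_set f j"
proof -
  obtain A where A: "approx_differential \<Omega> f A y" using assms by (auto simp: approx_differentiable_def)
  then have "linear A" by (simp add: approx_differential_def)
  then obtain B where B: "0 < B" "\<And>z. norm (A z) \<le> B * norm z"
    by (rule linear_bounded_pos) blast
  let ?E = "{x \<in> \<Omega> - {y}. norm (f x - f y - A (x - y)) / norm (x - y) < 1}"
  let ?e = "(1/2::real) ^ Suc CARD('n)"
  have e: "0 < ?e" "?e \<le> 1" using half_power_le[of "CARD('n)"] by (simp, linarith)
  have "density_point ?E y" using A unfolding approx_differential_def using zero_less_one by blast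
  then obtain d where d: "0 < d" "\<And>r. 0 < r \<Longrightarrow> r < d \<Longrightarrow>
     ?E \<inter> ball y r \<in> sets lebesgue \<and> measure lebesgue (?E \<inter> ball y r) > (1 - ?e) * measure lebesgue (ball y r)"
    by (rule density_pointD[OF _ e]) blast
  \<comment> \<open>The bound 1 / d < j turns r * j < 1 into r < d, and B + 1 is the Lipschitz
    constant at y on its density set with tolerance 1.\<close>
  obtain j :: nat where j: "max (1 / d) (B + 1) < real j" using reals_Archimedean2 by blast
  have "y \<in> approx_lipschitz_set f j"
    unfolding approx_lipschitz_set_def
  proof (intro CollectI allI impI)
    fix r assume r: "0 < r \<and> r * real j < 1"
    have "r < d"
    proof (rule ccontr)
      assume "\<not> r < d"
      then have "d * real j \<le> r * real j" by (intro mult_right_mono) auto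
      moreover have "1 < d * real j" using j d(1) by (simp add: field_simps)
      ultimately show False using r by linarith
    qed
    show "\<exists>W\<in>sets lebesgue. W \<subseteq> ball y r \<and> measure lebesgue W > (1 - ?e) * measure lebesgue (ball y r) \<and>
        (\<forall>z\<in>W. norm (f z - f y) \<le> real j * norm (z - y))"
    proof (intro bexI[of _ "?E \<inter> ball y r"] conjI ballI)
      fix z assume z: "z \<in> ?E \<inter> ball y r"
      then have "norm (f z - f y - A (z - y)) < norm (z - y)" by (auto simp: divide_less_eq)
      moreover have "norm (f z - f y) \<le> norm (f z - f y - A (z - y)) + norm (A (z - y))"
        using norm_triangle_ineq[of "f z - f y - A (z - y)" "A (z - y)"] by simp
      ultimately have "norm (f z - f y) \<le> (B + 1) * norm (z - y)" using B(2)[of "z - y"] by (simp add: algebra_simps)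
      also have "\<dots> \<le> real j * norm (z - y)" using j by (intro mult_right_mono) auto
      finally show "norm (f z - f y) \<le> real j * norm (z - y)" .
    qed (use d(2)[of r] r \<open>r < d\<close> in \<open>blast+\<close>)
  qed
  then show ?thesis ..
qed

text \<open>A point common to both witness sets lies within 2 * r of x and within r of y, where r =
  norm (x - y); this gives the constant 2 * j + j.\<close>

lemma lipschitz_set_local_bound:
  fixes f :: "real^'n \<Rightarrow> real^'n"
  assumes x: "x \<in> approx_lipschitz_set f j" and y: "y \<in> approx_lipschitz_set f j"
    and close: "2 * norm (x - y) * real j < 1"
  shows "norm (f x - f y) \<le> 3 * real j * norm (x - y)"
proof (cases "x = y")
  case False
  define r where "r = norm (x - y)"
  have r: "0 < r" "0 < 2 * r" using False by (auto simp: r_def)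
  have close': "r * real j < 1" "2 * r * real j < 1"
  proof -
    have "0 \<le> r * real j" using r by simp
    then show "r * real j < 1" "2 * r * real j < 1" using close by (simp_all add: r_def)
  qed
  obtain V where V: "V \<in> sets lebesgue" "V \<subseteq> ball x (2 * r)"
    "measure lebesgue V > (1 - (1/2) ^ Suc CARD('n)) * measure lebesgue (ball x (2 * r))"
    "\<And>z. z \<in> V \<Longrightarrow> norm (f z - f x) \<le> real j * norm (z - x)"
    by (rule approx_lipschitz_setE[OF x r(2) close'(2)]) blast
  obtain W where W: "W \<in> sets lebesgue" "W \<subseteq> ball y r"
    "measure lebesgue W > (1 - (1/2) ^ Suc CARD('n)) * measure lebesgue (ball y r)"
    "\<And>z. z \<in> W \<Longrightarrow> norm (f z - f y) \<le> real j * norm (z - y)"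
    by (rule approx_lipschitz_setE[OF y r(1) close'(1)]) blast
  have "V \<inter> W \<noteq> {}"
  proof (rule subsets_of_ball_meet[OF V(1,2) W(1,2) _ _ _ V(3)])
    show "ball y r \<subseteq> ball x (2 * r)"
      using r by (intro ball_subset_ball_iff[THEN iffD2] disjI1) (auto simp: r_def dist_norm norm_minus_commute)
    have "1 / 2 * measure lebesgue (ball y r) \<le> (1 - (1/2) ^ Suc CARD('n)) * measure lebesgue (ball y r)"
      using half_power_le[of "CARD('n)"] by (intro mult_right_mono) auto
    then show "measure lebesgue (ball y r) / 2 < measure lebesgue W" using W(3) by simp
    show "(1/2) ^ Suc CARD('n) * (2 * r) ^ DIM(real^'n) \<le> r ^ DIM(real^'n) / 2"
      by (simp add: power_mult_distrib power_one_over)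
  qed (use r in auto)
  then obtain z where z: "z \<in> V" "z \<in> W" by auto
  have "norm (f x - f y) \<le> norm (f z - f x) + norm (f z - f y)"
    using norm_triangle_ineq4[of "f z - f y" "f z - f x"] by simp
  also have "\<dots> \<le> real j * norm (z - x) + real j * norm (z - y)"
    using V(4)[OF z(1)] W(4)[OF z(2)] by (rule add_mono)
  also have "\<dots> \<le> real j * (2 * r) + real j * r"
    using z V(2) W(2) by (intro add_mono mult_left_mono) (auto simp: dist_norm norm_minus_commute subset_iff less_imp_le)
  finally show ?thesis by (simp add: r_def)
qed simp

lemma uniformly_continuous_on_lipschitz_set:
  fixes f :: "real^'n \<Rightarrow> real^'n"
  shows "uniformly_continuous_on (approx_lipschitz_set f j) f"
  unfolding uniformly_continuous_on_def
proof (intro allI impI)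
  fix e :: real assume e: "0 < e"
  define d where "d = min 1 e / (3 * (real j + 1))"
  show "\<exists>d>0. \<forall>x\<in>approx_lipschitz_set f j. \<forall>x'\<in>approx_lipschitz_set f j. dist x' x < d \<longrightarrow> dist (f x') (f x) < e"
  proof (intro exI[of _ d] conjI ballI impI)
    show "0 < d" using e by (simp add: d_def)
    fix x y assume xy: "x \<in> approx_lipschitz_set f j" "y \<in> approx_lipschitz_set f j" "dist y x < d"
    have "dist y x * (3 * (real j + 1)) < min 1 e"
      using xy(3) by (simp add: d_def pos_less_divide_eq)
    then have lt: "3 * real j * norm (y - x) + 3 * norm (y - x) < min 1 e"
      by (simp add: dist_norm algebra_simps)
    have "0 \<le> real j * norm (y - x)" by simp
    then have "2 * (real j * norm (y - x)) < 1" using lt norm_ge_zero[of "y - x"] by linarith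
    then have "2 * norm (y - x) * real j < 1" by (simp add: ac_simps)
    then have "norm (f y - f x) \<le> 3 * real j * norm (y - x)"
      by (rule lipschitz_set_local_bound[OF xy(2,1)])
    also have "\<dots> < e" using lt norm_ge_zero[of "y - x"] by linarith
    finally show "dist (f y) (f x) < e" by (simp add: dist_norm)
  qed
qed

text \<open>With r = norm (y - x), the point y itself may miss the density set of x, but some z in
  that set lies within \<eta> * r of y and in the witness set of y. Passing from z to y costs at
  most (j + B) * \<eta> * r. The point x ranges over all points with an approximate differential,
  because limit points of the Lipschitz set occur later.\<close>

lemma approx_differential_lipschitz_set:
  fixes f :: "real^'n \<Rightarrow> real^'n"
  assumes A: "approx_differential \<Omega> f A x" and e: "0 < e"
  obtains d where "0 < d" "\<And>y. y \<in> approx_lipschitz_set f j \<Longrightarrow> norm (y - x) < d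
     \<Longrightarrow> norm (f y - f x - A (y - x)) \<le> e * norm (y - x)"
proof -
  have lin: "linear A" using A by (simp add: approx_differential_def)
  then obtain B where B: "0 < B" "\<And>z. norm (A z) \<le> B * norm z"
    by (rule linear_bounded_pos) blast
  \<comment> \<open>The error will be \<eta> * (2 + j + B) * norm (y - x): 2 from the density set in
    the ball of radius 2 * r, j from the Lipschitz bound, B from the norm of A.\<close>
  define \<eta> where "\<eta> = min 1 (e / (real j + 2 + B))"
  have \<eta>: "0 < \<eta>" "\<eta> \<le> 1" using e B by (auto simp: \<eta>_def)
  have \<eta>e: "\<eta> * (real j + 2 + B) \<le> e"
  proof -
    have "\<eta> * (real j + 2 + B) \<le> e / (real j + 2 + B) * (real j + 2 + B)"
      using B by (intro mult_right_mono) (auto simp: \<eta>_def)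
    also have "\<dots> = e" using B by (simp add: add_nonneg_pos)
    finally show ?thesis .
  qed
  let ?E = "{z \<in> \<Omega> - {x}. norm (f z - f x - A (z - x)) / norm (z - x) < \<eta>}"
  \<comment> \<open>With this defect, what the density set misses in \<open>ball x (2 * r)\<close>
    has at most half the volume of \<open>ball y (\<eta> * r)\<close>.\<close>
  define \<delta> where "\<delta> = (\<eta> / 2) ^ CARD('n) / 2"
  have \<delta>: "0 < \<delta>" "\<delta> \<le> 1"
  proof -
    have "(\<eta> / 2) ^ CARD('n) \<le> 1" using \<eta> by (intro power_le_one) auto
    then show "0 < \<delta>" "\<delta> \<le> 1" using \<eta> by (auto simp: \<delta>_def)
  qed
  have "density_point ?E x" using A \<eta>(1) unfolding approx_differential_def by blast
  then obtain d where d: "0 < d" "\<And>r. 0 < r \<Longrightarrow> r < d \<Longrightarrow>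
     ?E \<inter> ball x r \<in> sets lebesgue \<and> measure lebesgue (?E \<inter> ball x r) > (1 - \<delta>) * measure lebesgue (ball x r)"
    by (rule density_pointD[OF _ \<delta>]) blast
  show ?thesis
  proof (rule that[of "min (d / 2) (1 / (real j + 1))"])
    show "0 < min (d / 2) (1 / (real j + 1))" using d(1) by simp
    fix y assume y: "y \<in> approx_lipschitz_set f j" and near: "norm (y - x) < min (d / 2) (1 / (real j + 1))"
    show "norm (f y - f x - A (y - x)) \<le> e * norm (y - x)"
    proof (cases "y = x")
      case True then show ?thesis using linear_0[OF lin] by simp
    next
      case False
      define r where "r = norm (y - x)"
      have r: "0 < r" "2 * r < d" "r * (real j + 1) < 1"
        using False near by (auto simp: r_def field_simps)
      let ?V = "?E \<inter> ball x (2 * r)"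
      have V: "?V \<in> sets lebesgue" "measure lebesgue ?V > (1 - \<delta>) * measure lebesgue (ball x (2 * r))"
        using d(2)[of "2 * r"] r by auto
      have \<eta>r: "0 < \<eta> * r" "\<eta> * r * real j < 1" "\<eta> * r \<le> r"
      proof -
        show "0 < \<eta> * r" using \<eta> r by simp
        show le: "\<eta> * r \<le> r" using \<eta> r by (simp add: mult_left_le_one_le)
        have "\<eta> * r * real j \<le> r * (real j + 1)" using le r by (intro mult_mono) auto
        then show "\<eta> * r * real j < 1" using r(3) by linarith
      qed
      obtain W where W: "W \<in> sets lebesgue" "W \<subseteq> ball y (\<eta> * r)"
        "measure lebesgue W > (1 - (1/2) ^ Suc CARD('n)) * measure lebesgue (ball y (\<eta> * r))"
        "\<And>z. z \<in> W \<Longrightarrow> norm (f z - f y) \<le> real j * norm (z - y)"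
        by (rule approx_lipschitz_setE[OF y \<eta>r(1,2)]) blast
      have "?V \<inter> W \<noteq> {}"
      proof (rule subsets_of_ball_meet[OF V(1) _ W(1,2) _ _ _ V(2)])
        show "ball y (\<eta> * r) \<subseteq> ball x (2 * r)"
          using r \<eta>r by (intro ball_subset_ball_iff[THEN iffD2] disjI1) (auto simp: r_def dist_norm)
        have "1 / 2 * measure lebesgue (ball y (\<eta> * r)) \<le> (1 - (1/2) ^ Suc CARD('n)) * measure lebesgue (ball y (\<eta> * r))"
          using half_power_le[of "CARD('n)"] by (intro mult_right_mono) auto
        then show "measure lebesgue (ball y (\<eta> * r)) / 2 < measure lebesgue W" using W(3) by simp
        show "\<delta> * (2 * r) ^ DIM(real^'n) \<le> (\<eta> * r) ^ DIM(real^'n) / 2"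
          by (simp add: \<delta>_def power_mult_distrib power_divide)
      qed (use r \<eta>r in auto)
      then obtain z where z: "z \<in> ?V" "z \<in> W" by blast
      have zx: "norm (z - x) < 2 * r" and zy: "norm (z - y) < \<eta> * r"
        using z W(2) by (auto simp: dist_norm norm_minus_commute)
      have "f y - f x - A (y - x) = (f z - f x - A (z - x)) - (f z - f y) + A (z - y)"
        using linear_add[OF lin, of "y - x" "z - y"] by simp
      also have "norm \<dots> \<le> norm (f z - f x - A (z - x)) + norm (f z - f y) + norm (A (z - y))"
        by (meson norm_triangle_ineq norm_triangle_ineq4 add_right_mono order_trans)
      also have "\<dots> \<le> \<eta> * norm (z - x) + real j * norm (z - y) + B * norm (z - y)"
        using z W(4)[OF z(2)] B(2)[of "z - y"] by (intro add_mono) (auto simp: divide_less_eq less_imp_le)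
      also have "\<dots> \<le> \<eta> * (2 * r) + real j * (\<eta> * r) + B * (\<eta> * r)"
        using zx zy \<eta> B by (intro add_mono mult_left_mono) auto
      also have "\<dots> = \<eta> * (real j + 2 + B) * r" by (simp add: algebra_simps)
      also have "\<dots> \<le> e * r" using \<eta>e r by (intro mult_right_mono) auto
      finally show ?thesis by (simp add: r_def)
    qed
  qed
qed

text \<open>Neither Rademacher's theorem nor Lebesgue's density theorem is needed. The sets
  \<open>approx_lipschitz_set f j\<close> need not be shown measurable: \<open>f\<close> extends continuously to their closures,
  and the set where \<open>f\<close> agrees with the extension is measurable.\<close>

proposition approx_differentiable_decomposition:
  fixes f :: "real^'n \<Rightarrow> real^'n"
  assumes \<Omega>: "\<Omega> \<in> sets lebesgue" and f: "f \<in> borel_measurable (lebesgue_on \<Omega>)"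
    and AE: "AE x in lebesgue. x \<in> \<Omega> \<longrightarrow> approx_differentiable \<Omega> f x"
  obtains S :: "nat \<Rightarrow> (real^'n) set" where "\<And>j. S j \<in> sets lebesgue" "\<And>j. S j \<subseteq> \<Omega>"
    "\<Omega> - (\<Union>j. S j) \<in> null_sets lebesgue" "\<And>j x. x \<in> S j \<Longrightarrow> approx_differentiable \<Omega> f x"
    "\<And>j x A. x \<in> S j \<Longrightarrow> approx_differential \<Omega> f A x \<Longrightarrow> (f has_derivative A) (at x within S j)"
proof -
  define D where "D j = approx_lipschitz_set f j" for j
  have "\<exists>F. continuous_on (closure (D j)) F \<and> (\<forall>x\<in>D j. f x = F x)" for j
    using uniformly_continuous_on_extension_on_closure[OF uniformly_continuous_on_lipschitz_set[of f j]]
    unfolding D_def by (metis uniformly_continuous_imp_continuous)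
  then obtain F where F: "\<And>j. continuous_on (closure (D j)) (F j)" "\<And>j x. x \<in> D j \<Longrightarrow> f x = F j x"
    by metis
  define G where "G = {x \<in> \<Omega>. approx_differentiable \<Omega> f x}"
  have null: "\<Omega> - G \<in> null_sets lebesgue"
  proof -
    have "\<Omega> - G = {x. \<not> (x \<in> \<Omega> \<longrightarrow> approx_differentiable \<Omega> f x)}" by (auto simp: G_def)
    then show ?thesis using lebesgue_AE_null_sets[OF AE] by simp
  qed
  have G: "G \<in> sets lebesgue"
  proof -
    have "G = \<Omega> - (\<Omega> - G)" by (auto simp: G_def)
    then show ?thesis using \<Omega> null by (metis null_setsD2 sets.Diff)
  qed
  define S where "S j = {x \<in> closure (D j) \<inter> G. f x = F j x}" for j
  show ?thesis
  proof (rule that[of S])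
    fix j
    show "S j \<in> sets lebesgue"
    proof -
      let ?T = "closure (D j) \<inter> G"
      have T: "?T \<in> sets lebesgue" using G by (intro sets.Int) auto
      have fT: "f \<in> borel_measurable (lebesgue_on ?T)"
        by (rule measurable_restrict_mono[OF f]) (auto simp: G_def)
      have FT: "F j \<in> borel_measurable (lebesgue_on ?T)"
        by (rule continuous_imp_measurable_on_sets_lebesgue[OF continuous_on_subset[OF F(1)] T]) auto
      have "{x \<in> space (lebesgue_on ?T). norm (f x - F j x) = 0} \<in> sets (lebesgue_on ?T)"
        using fT FT by measurable
      then have "{x \<in> ?T. norm (f x - F j x) = 0} \<in> sets lebesgue"
        using T by (simp add: sets_restrict_space_iff space_restrict_space)
      then show ?thesis by (simp add: S_def)
    qed
    show "S j \<subseteq> \<Omega>" by (auto simp: S_def G_def)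
    show "approx_differentiable \<Omega> f x" if "x \<in> S j" for x using that by (auto simp: S_def G_def)
    fix x A assume x: "x \<in> S j" and A: "approx_differential \<Omega> f A x"
    have lin: "bounded_linear A"
      using A by (simp add: approx_differential_def linear_conv_bounded_linear)
    show "(f has_derivative A) (at x within S j)"
      unfolding has_derivative_within_alt
    proof (intro conjI lin allI impI)
      fix e :: real assume "0 < e"
      then obtain d where d: "0 < d" "\<And>y. y \<in> approx_lipschitz_set f j \<Longrightarrow> norm (y - x) < d
         \<Longrightarrow> norm (f y - f x - A (y - x)) \<le> e * norm (y - x)"
        by (rule approx_differential_lipschitz_set[OF A]) blast
      show "\<exists>d>0. \<forall>y\<in>S j. norm (y - x) < d \<longrightarrow> norm (f y - f x - A (y - x)) \<le> e * norm (y - x)"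
      proof (intro exI[of _ d] conjI d(1) ballI impI)
        fix y assume y: "y \<in> S j" "norm (y - x) < d"
        then have "y \<in> closure (D j)" and fy: "f y = F j y" by (auto simp: S_def)
        \<comment> \<open>The estimate is available on \<open>D j\<close>. It survives the limit
          along \<open>q\<close>, being non-strict, and \<open>f\<close> converges along
          \<open>q\<close> because it agrees with the continuous extension at y.\<close>
        then obtain q where q: "\<And>n. q n \<in> D j" "q \<longlonglongrightarrow> y" by (auto simp: closure_sequential)
        have Fq: "(\<lambda>n. f (q n)) \<longlonglongrightarrow> f y"
        proof -
          have "(\<lambda>n. F j (q n)) \<longlonglongrightarrow> F j y"
            using F(1)[of j] \<open>y \<in> closure (D j)\<close> q closure_subset[of "D j"]
            unfolding continuous_on_sequentially by (auto simp: o_def)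
          then show ?thesis using F(2)[OF q(1)] fy by simp
        qed
        have lim1: "(\<lambda>n. norm (f (q n) - f x - A (q n - x))) \<longlonglongrightarrow> norm (f y - f x - A (y - x))"
          by (intro tendsto_intros Fq q bounded_linear.tendsto[OF lin])
        have lim2: "(\<lambda>n. e * norm (q n - x)) \<longlonglongrightarrow> e * norm (y - x)"
          by (intro tendsto_intros q)
        have "(\<lambda>n. norm (q n - x)) \<longlonglongrightarrow> norm (y - x)" by (intro tendsto_intros q)
        then have "\<forall>\<^sub>F n in sequentially. norm (q n - x) < d" using y(2) by (rule order_tendstoD)
        then have "\<forall>\<^sub>F n in sequentially. norm (f (q n) - f x - A (q n - x)) \<le> e * norm (q n - x)"
          by eventually_elim (use d(2) q(1) in \<open>auto simp: D_def\<close>)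
        then show "norm (f y - f x - A (y - x)) \<le> e * norm (y - x)"
          by (rule tendsto_le[OF _ lim2 lim1, rotated]) simp
      qed
    qed
  next
    have "G \<subseteq> (\<Union>j. S j)"
    proof
      fix x assume x: "x \<in> G"
      then obtain j where "x \<in> D j"
        using approx_differentiable_imp_lipschitz_set[of \<Omega> f x] by (auto simp: G_def D_def)
      then show "x \<in> (\<Union>j. S j)" using x F(2) closure_subset[of "D j"] by (auto simp: S_def)
    qed
    then have "\<Omega> - (\<Union>j. S j) = \<Omega> - G" by (auto simp: S_def)
    then show "\<Omega> - (\<Union>j. S j) \<in> null_sets lebesgue" using null by simp
  qed
qed

text \<open>\<open>I j\<close> collects the points from which f expands distances by at least 1 / (j
  + 1) within radius 1 / (j + 1). It is relatively closed in S by continuity, hence measurable, and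
  f is injective on its subsets of diameter below that radius. An invertible differential puts a
  point into some \<open>I j\<close>.\<close>

proposition injective_decomposition:
  fixes f :: "real^'n \<Rightarrow> real^'n"
  assumes S: "S \<in> sets lebesgue"
    and der: "\<And>x. x \<in> S \<Longrightarrow> (f has_derivative f' x) (at x within S)"
  obtains T :: "nat \<Rightarrow> (real^'n) set" where "\<And>i. T i \<in> sets lebesgue" "\<And>i. T i \<subseteq> S" "\<And>i. inj_on f (T i)"
    "{x \<in> S. det (matrix (f' x)) \<noteq> 0} \<subseteq> (\<Union>i. T i)"
proof -
  have cont: "continuous_on S f"
    using der by (rule has_derivative_continuous_on)
  define I where "I j = {x \<in> S. \<forall>y\<in>S. norm (y - x) * real (Suc j) < 1 \<longrightarrow> norm (y - x) \<le> real (Suc j) * norm (f y - f x)}" for j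
  have I_closed: "x \<in> I j" if x: "x \<in> closure (I j)" "x \<in> S" for x j
  proof -
    obtain q where q: "\<And>n. q n \<in> I j" "q \<longlonglongrightarrow> x" using x(1) by (auto simp: closure_sequential)
    have fq: "(\<lambda>n. f (q n)) \<longlonglongrightarrow> f x"
      using cont x(2) q unfolding continuous_on_sequentially by (auto simp: o_def I_def)
    have "norm (y - x) \<le> real (Suc j) * norm (f y - f x)" if y: "y \<in> S" "norm (y - x) * real (Suc j) < 1" for y
    proof -
      have "(\<lambda>n. norm (y - q n) * real (Suc j)) \<longlonglongrightarrow> norm (y - x) * real (Suc j)"
        by (intro tendsto_intros q)
      then have "\<forall>\<^sub>F n in sequentially. norm (y - q n) * real (Suc j) < 1"
        using y(2) by (rule order_tendstoD)
      then have "\<forall>\<^sub>F n in sequentially. norm (y - q n) \<le> real (Suc j) * norm (f y - f (q n))"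
        by eventually_elim (use q(1) y(1) in \<open>auto simp: I_def\<close>)
      moreover have "(\<lambda>n. norm (y - q n)) \<longlonglongrightarrow> norm (y - x)" by (intro tendsto_intros q)
      moreover have "(\<lambda>n. real (Suc j) * norm (f y - f (q n))) \<longlonglongrightarrow> real (Suc j) * norm (f y - f x)"
        by (intro tendsto_intros fq)
      ultimately show ?thesis by (intro tendsto_le[of sequentially]) auto
    qed
    with x(2) show ?thesis by (auto simp: I_def)
  qed
  have I: "I j \<in> sets lebesgue" for j
  proof -
    have "I j \<subseteq> S" by (auto simp: I_def)
    then have "I j = closure (I j) \<inter> S"
      using I_closed closure_subset[of "I j"] by blast
    moreover have "closure (I j) \<inter> S \<in> sets lebesgue" using S by (intro sets.Int) auto
    ultimately show ?thesis by simp
  qed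
  obtain Q :: "(real^'n) set" where Q: "countable Q" "\<And>X. open X \<Longrightarrow> X \<noteq> {} \<Longrightarrow> \<exists>d\<in>Q. d \<in> X"
    by (rule countable_dense_setE) blast
  have "Q \<noteq> {}" using Q(2)[of UNIV] by auto
  \<comment> \<open>Balls of half the radius around a countable dense set: two points of one piece
    are closer than 1 / (j + 1).\<close>
  define T where "T i = (case prod_decode i of (j, k) \<Rightarrow> I j \<inter> ball (from_nat_into Q k) (1 / (2 * real (Suc j))))" for i
  show ?thesis
  proof (rule that[of T])
    fix i
    obtain j k where jk: "prod_decode i = (j, k)" by fastforce
    show "T i \<in> sets lebesgue" using I[of j] by (auto simp: T_def jk intro: sets.Int)
    show "T i \<subseteq> S" by (auto simp: T_def jk I_def)
    show "inj_on f (T i)"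
    proof (rule inj_onI)
      fix x y assume xy: "x \<in> T i" "y \<in> T i" "f x = f y"
      let ?c = "from_nat_into Q k"
      have "norm (y - x) \<le> dist ?c y + dist ?c x"
        by (metis dist_commute dist_norm dist_triangle)
      also have "\<dots> < 1 / (2 * real (Suc j)) + 1 / (2 * real (Suc j))"
        using xy by (intro add_strict_mono) (auto simp: T_def jk)
      also have "\<dots> = 1 / real (Suc j)" by (simp add: field_simps)
      finally have "norm (y - x) * real (Suc j) < 1" by (simp add: pos_less_divide_eq)
      then have "norm (y - x) \<le> real (Suc j) * norm (f y - f x)"
        using xy by (auto simp: T_def jk I_def)
      then show "x = y" using xy(3) by simp
    qed
  next
    show "{x \<in> S. det (matrix (f' x)) \<noteq> 0} \<subseteq> (\<Union>i. T i)"
    proof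
      fix x assume x: "x \<in> {x \<in> S. det (matrix (f' x)) \<noteq> 0}"
      then have xS: "x \<in> S" and "det (matrix (f' x)) \<noteq> 0" by auto
      have lin: "linear (f' x)" using der[OF xS] by (rule has_derivative_linear)
      then have "inj (f' x)" using \<open>det (matrix (f' x)) \<noteq> 0\<close> by (simp add: det_nz_iff_inj)
      then obtain B where B: "0 < B" "\<And>z. B * norm z \<le> norm (f' x z)"
        by (rule linear_inj_bounded_below_pos[OF lin]) blast
      \<comment> \<open>The differential expands by at least B; a remainder of at most half of that
        leaves expansion by B / 2 for f.\<close>
      have "0 < B / 2" using B(1) by simp
      then obtain d where d: "0 < d"
        "\<And>y. y \<in> S \<Longrightarrow> norm (y - x) < d \<Longrightarrow> norm (f y - f x - f' x (y - x)) \<le> B / 2 * norm (y - x)"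
        using der[OF xS] unfolding has_derivative_within_alt by blast
      obtain j :: nat where j: "max (1 / d) (2 / B) < real j" using reals_Archimedean2 by blast
      have "x \<in> I j"
        unfolding I_def
      proof (intro CollectI conjI xS ballI impI)
        fix y assume y: "y \<in> S" "norm (y - x) * real (Suc j) < 1"
        have "norm (y - x) < d"
        proof (rule ccontr)
          assume "\<not> norm (y - x) < d"
          then have "d * real (Suc j) \<le> norm (y - x) * real (Suc j)" by (intro mult_right_mono) auto
          moreover have "1 < d * real j" using j d(1) by (simp add: field_simps)
          moreover have "d * real j \<le> d * real (Suc j)" using d(1) by (intro mult_left_mono) auto
          ultimately show False using y by linarith
        qed
        then have "norm (f y - f x - f' x (y - x)) \<le> B / 2 * norm (y - x)" using d(2) y(1) by blast
        moreover have "norm (f' x (y - x)) \<le> norm (f y - f x) + norm (f y - f x - f' x (y - x))"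
          using norm_triangle_ineq4[of "f y - f x" "f y - f x - f' x (y - x)"] by simp
        ultimately have *: "B / 2 * norm (y - x) \<le> norm (f y - f x)" using B(2)[of "y - x"] by linarith
        have "2 / B \<le> real (Suc j)" using j by simp
        then have "2 / B * (B / 2 * norm (y - x)) \<le> real (Suc j) * norm (f y - f x)"
          using * B(1) by (intro mult_mono) auto
        then show "norm (y - x) \<le> real (Suc j) * norm (f y - f x)" using B(1) by simp
      qed
      obtain q where q: "q \<in> Q" "q \<in> ball x (1 / (2 * real (Suc j)))"
        using Q(2)[of "ball x (1 / (2 * real (Suc j)))"] by auto
      obtain k where k: "from_nat_into Q k = q" using from_nat_into_surj[OF Q(1) q(1)] by blast
      have "x \<in> T (prod_encode (j, k))" using \<open>x \<in> I j\<close> q k by (simp add: T_def dist_commute)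
      then show "x \<in> (\<Union>i. T i)" by blast
    qed
  qed
qed

text \<open>Differentiable images of Lebesgue sets are Lebesgue sets, which covers the pieces; the
  rest of the domain is null, and condition N keeps its image null.\<close>

lemma image_measurable_lebesgue_if_luzin:
  fixes f :: "real^'n \<Rightarrow> real^'n"
  assumes \<Omega>: "\<Omega> \<in> sets lebesgue" and f: "f \<in> borel_measurable (lebesgue_on \<Omega>)"
    and AE: "AE x in lebesgue. x \<in> \<Omega> \<longrightarrow> approx_differentiable \<Omega> f x" and luzin: "luzin_N \<Omega> f"
  shows "f ` \<Omega> \<in> sets lebesgue"
proof -
  obtain S :: "nat \<Rightarrow> (real^'n) set" where S: "\<And>j. S j \<in> sets lebesgue" "\<And>j. S j \<subseteq> \<Omega>"
    "\<Omega> - (\<Union>j. S j) \<in> null_sets lebesgue" "\<And>j x. x \<in> S j \<Longrightarrow> approx_differentiable \<Omega> f x"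
    "\<And>j x A. x \<in> S j \<Longrightarrow> approx_differential \<Omega> f A x \<Longrightarrow> (f has_derivative A) (at x within S j)"
    by (rule approx_differentiable_decomposition[OF \<Omega> f AE]) blast
  have "f differentiable_on S j" for j
    unfolding differentiable_on_def differentiable_def
    using S(4,5) unfolding approx_differentiable_def by blast
  then have "f ` S j \<in> sets lebesgue" for j
    by (intro differentiable_image_in_sets_lebesgue[OF S(1)]) auto
  moreover have "f ` (\<Omega> - (\<Union>j. S j)) \<in> sets lebesgue"
    using luzin S(3) unfolding luzin_N_def by (metis Diff_subset null_setsD2)
  moreover have "f ` \<Omega> = (\<Union>j. f ` S j) \<union> f ` (\<Omega> - (\<Union>j. S j))"
  proof -
    have "(\<Union>j. S j) \<subseteq> \<Omega>" using S(2) by (rule UN_least)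
    then have "\<Omega> = (\<Union>j. S j) \<union> (\<Omega> - (\<Union>j. S j))" by blast
    then show ?thesis by (metis image_UN image_Un)
  qed
  ultimately show ?thesis by (metis sets.Un sets.countable_nat_UN image_subset_iff)
qed

text \<open>The pieces need not exhaust \<Omega>, since critical points may be left over. Almost
  everywhere on the remainder the Jacobian is zero, so an integrand dominated by it vanishes there
  and the image of the remainder requires no control. Disjointness prepares the counting of
  preimages.\<close>

proposition approx_jacobian_decomposition:
  fixes f :: "real^'n \<Rightarrow> real^'n"
  assumes \<Omega>: "\<Omega> \<in> sets lebesgue" and f: "f \<in> borel_measurable (lebesgue_on \<Omega>)"
    and AE: "AE x in lebesgue. x \<in> \<Omega> \<longrightarrow> approx_differentiable \<Omega> f x"
  obtains T :: "nat \<Rightarrow> (real^'n) set" where "\<And>i. T i \<in> sets lebesgue" "\<And>i. T i \<subseteq> \<Omega>" "\<And>i. inj_on f (T i)"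
    "disjoint_family T"
    "AE x in lebesgue. x \<in> \<Omega> - (\<Union>i. T i) \<longrightarrow> approx_jacobian \<Omega> f x = 0"
    "\<And>i x. x \<in> T i \<Longrightarrow> approx_differentiable \<Omega> f x"
    "\<And>i x. x \<in> T i \<Longrightarrow> (f has_derivative (SOME A. approx_differential \<Omega> f A x)) (at x within T i)"
proof -
  let ?A = "\<lambda>x. SOME A. approx_differential \<Omega> f A x"
  obtain S :: "nat \<Rightarrow> (real^'n) set" where S: "\<And>j. S j \<in> sets lebesgue" "\<And>j. S j \<subseteq> \<Omega>"
    "\<Omega> - (\<Union>j. S j) \<in> null_sets lebesgue" "\<And>j x. x \<in> S j \<Longrightarrow> approx_differentiable \<Omega> f x"
    "\<And>j x A. x \<in> S j \<Longrightarrow> approx_differential \<Omega> f A x \<Longrightarrow> (f has_derivative A) (at x within S j)"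
    by (rule approx_differentiable_decomposition[OF \<Omega> f AE]) blast
  have der: "(f has_derivative ?A x) (at x within S j)" if "x \<in> S j" for j x
    using S(4)[OF that] unfolding approx_differentiable_def by (intro S(5)[OF that] someI_ex[where P="\<lambda>A. approx_differential \<Omega> f A x"])
  define Q where "Q j T \<longleftrightarrow> (\<forall>i::nat. T i \<in> sets lebesgue \<and> T i \<subseteq> S j \<and> inj_on f (T i)) \<and>
      {x \<in> S j. det (matrix (?A x)) \<noteq> 0} \<subseteq> (\<Union>i. T i)" for j T
  have "\<exists>T. Q j T" for j
  proof (rule injective_decomposition[OF S(1)[of j] der])
    fix T :: "nat \<Rightarrow> (real^'n) set" assume "\<And>i. T i \<in> sets lebesgue" "\<And>i. T i \<subseteq> S j" "\<And>i. inj_on f (T i)"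
      "{x \<in> S j. det (matrix (?A x)) \<noteq> 0} \<subseteq> (\<Union>i. T i)"
    then have "Q j T" unfolding Q_def by (intro conjI allI)
    then show "\<exists>T. Q j T" by (rule exI[of "Q j"])
  qed
  then have "\<exists>T. \<forall>j. Q j (T j)" by (intro choice allI)
  then obtain T where "\<And>j. Q j (T j)" by blast
  then have T: "\<And>j i. T j i \<in> sets lebesgue" "\<And>j i. T j i \<subseteq> S j" "\<And>j i. inj_on f (T j i)"
     "\<And>j. {x \<in> S j. det (matrix (?A x)) \<noteq> 0} \<subseteq> (\<Union>i. T j i)"
    unfolding Q_def by simp_all
  define U where "U n = (case prod_decode n of (j, i) \<Rightarrow> T j i)" for n
  have U: "U n \<in> sets lebesgue" "inj_on f (U n)" "\<exists>j. U n \<subseteq> S j" for n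
  proof -
    obtain j i where "prod_decode n = (j, i)" by fastforce
    then have Un: "U n = T j i" by (simp add: U_def)
    show "U n \<in> sets lebesgue" "inj_on f (U n)" unfolding Un by (rule T)+
    show "\<exists>j. U n \<subseteq> S j" unfolding Un by (rule exI, rule T)
  qed
  have DU: "disjointed U n \<subseteq> U n" for n by (rule disjointed_subset)
  show ?thesis
  proof (rule that[of "disjointed U"])
    fix n
    show "disjointed U n \<in> sets lebesgue"
      using sets.range_disjointed_sets[of U lebesgue] U(1) by auto
    show "disjointed U n \<subseteq> \<Omega>" using DU[of n] U(3)[of n] S(2) by blast
    show "inj_on f (disjointed U n)" using U(2) DU by (rule inj_on_subset)
    fix x assume x: "x \<in> disjointed U n"
    obtain j where j: "U n \<subseteq> S j" using U(3) by blast
    then show "approx_differentiable \<Omega> f x" using S(4)[of x j] x DU[of n] by blast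
    have "disjointed U n \<subseteq> S j" using j DU[of n] by blast
    then show "(f has_derivative ?A x) (at x within disjointed U n)"
      using der[of x j] x by (meson has_derivative_subset subsetD)
  next
    show "disjoint_family (disjointed U)" by (rule disjoint_family_disjointed)
    have zero: "approx_jacobian \<Omega> f x = 0" if x: "x \<in> \<Omega> - (\<Union>i. disjointed U i)" "x \<notin> \<Omega> - (\<Union>j. S j)" for x
    proof -
      obtain j where j: "x \<in> S j" using x by blast
      have "x \<notin> (\<Union>i. T j i)"
      proof
        assume "x \<in> (\<Union>i. T j i)"
        then obtain i where "x \<in> T j i" by blast
        then have "x \<in> U (prod_encode (j, i))" by (simp add: U_def)
        then have "x \<in> (\<Union>i. disjointed U i)" unfolding UN_disjointed_eq by blast
        then show False using x by blast
      qed
      then have "det (matrix (?A x)) = 0" using T(4)[of j] j by blast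
      then show ?thesis by (simp add: approx_jacobian_def)
    qed
    have "AE x in lebesgue. x \<notin> \<Omega> - (\<Union>j. S j)" by (rule AE_not_in[OF S(3)])
    then show "AE x in lebesgue. x \<in> \<Omega> - (\<Union>i. disjointed U i) \<longrightarrow> approx_jacobian \<Omega> f x = 0"
      by eventually_elim (use zero in blast)
  qed
qed

text \<open>Each piece whose image contains y contributes a preimage of y, and disjointness makes
  these preimages distinct.\<close>

lemma sum_indicator_disjoint_images_le_card:
  assumes "disjoint_family U" "\<And>i. U i \<subseteq> \<Omega>" "finite (f -` {y} \<inter> \<Omega>)" "card (f -` {y} \<inter> \<Omega>) \<le> K"
  shows "(\<Sum>i::nat. indicator (f ` U i) y :: ennreal) \<le> of_nat K"
proof (rule suminf_le_const[OF summableI])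
  fix n
  define J where "J = {i \<in> {..<n}. y \<in> f ` U i}"
  have "\<forall>i\<in>J. \<exists>x. x \<in> U i \<and> f x = y" by (auto simp: J_def)
  then obtain p where p: "\<And>i. i \<in> J \<Longrightarrow> p i \<in> U i \<and> f (p i) = y" by metis
  have "inj_on p J"
  proof (rule inj_onI)
    fix i j assume ij: "i \<in> J" "j \<in> J" "p i = p j"
    then have "p i \<in> U i \<inter> U j" using p[OF ij(1)] p[OF ij(2)] by auto
    then show "i = j" using assms(1) by (auto simp: disjoint_family_on_def)
  qed
  then have "card J = card (p ` J)" by (simp add: card_image)
  also have "\<dots> \<le> card (f -` {y} \<inter> \<Omega>)"
  proof (rule card_mono[OF assms(3)])
    show "p ` J \<subseteq> f -` {y} \<inter> \<Omega>"
      using p assms(2) by (fastforce simp: subset_iff)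
  qed
  finally have "card J \<le> K" using assms(4) by simp
  have "(\<Sum>i<n. indicator (f ` U i) y :: ennreal) = (\<Sum>i\<in>J. 1)"
    unfolding J_def by (rule sum.mono_neutral_cong_right) (auto simp: indicator_def)
  also have "\<dots> = of_nat (card J)" by simp
  also have "\<dots> \<le> of_nat K" using \<open>card J \<le> K\<close> by (rule of_nat_mono)
  finally show "(\<Sum>i<n. indicator (f ` U i) y :: ennreal) \<le> of_nat K" .
qed

text \<open>On the part of each piece that f sends into A, the area formula turns the Jacobian into
  the measure of an image inside A, and almost every point lies in at most K of these images. The
  right-hand side keeps the intersection with the image of \<Omega>, so that overlaps of the images
  under different maps can be counted afterwards. Finite measure of A makes the images
  \<open>lmeasurable\<close>, as the change of variables demands.\<close>

proposition nn_integral_approx_jacobian_le: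
  fixes f :: "real^'n \<Rightarrow> real^'n" and h :: "real^'n \<Rightarrow> ennreal"
  assumes \<Omega>: "\<Omega> \<in> sets lebesgue" and f: "f \<in> borel_measurable (lebesgue_on \<Omega>)"
    and AE: "AE x in lebesgue. x \<in> \<Omega> \<longrightarrow> approx_differentiable \<Omega> f x"
    and luzin: "luzin_N \<Omega> f"
    and null: "\<And>M. M \<in> null_sets lebesgue \<Longrightarrow> f -` M \<inter> \<Omega> \<in> null_sets lebesgue"
    and maps: "f ` \<Omega> \<subseteq> \<Omega>"
    and K: "{x \<in> \<Omega>. infinite (f -` {x} \<inter> \<Omega>) \<or> card (f -` {x} \<inter> \<Omega>) > K} \<in> null_sets lebesgue"
    and h: "AE x in lebesgue. x \<in> \<Omega> \<longrightarrow> h x \<le> c * ennreal \<bar>approx_jacobian \<Omega> f x\<bar>"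
    and A: "A \<in> sets lebesgue" "emeasure lebesgue A < \<infinity>"
  shows "(\<integral>\<^sup>+ x. h x * indicator A (f x) \<partial>lebesgue_on \<Omega>) \<le> c * of_nat K * emeasure lebesgue (A \<inter> f ` \<Omega>)"
proof -
  let ?A = "\<lambda>x. SOME A. approx_differential \<Omega> f A x"
  let ?J = "\<lambda>x. ennreal \<bar>det (matrix (?A x))\<bar>"
  obtain T :: "nat \<Rightarrow> (real^'n) set" where T: "\<And>i. T i \<in> sets lebesgue" "\<And>i. T i \<subseteq> \<Omega>" "\<And>i. inj_on f (T i)"
    "disjoint_family T" and T0: "AE x in lebesgue. x \<in> \<Omega> - (\<Union>i. T i) \<longrightarrow> approx_jacobian \<Omega> f x = 0"
    and Tdiff: "\<And>i x. x \<in> T i \<Longrightarrow> approx_differentiable \<Omega> f x"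
    and Tder: "\<And>i x. x \<in> T i \<Longrightarrow> (f has_derivative ?A x) (at x within T i)"
    by (rule approx_jacobian_decomposition[OF \<Omega> f AE]) blast
  define U where "U i = T i \<inter> f -` A" for i
  have UT: "U i \<subseteq> T i" for i by (auto simp: U_def)
  have f': "f \<in> lebesgue_on \<Omega> \<rightarrow>\<^sub>M lebesgue"
    by (rule nonsingular_measurable_lebesgue[OF \<Omega> f null])
  have U: "U i \<in> sets lebesgue" for i
  proof -
    have "f -` A \<inter> \<Omega> \<in> sets lebesgue"
      using measurable_sets[OF f' A(1)] \<Omega> by (simp add: sets_restrict_space_iff space_restrict_space)
    then have "T i \<inter> (f -` A \<inter> \<Omega>) \<in> sets lebesgue" using T(1) by blast
    moreover have "T i \<inter> (f -` A \<inter> \<Omega>) = U i" using T(2)[of i] by (auto simp: U_def)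
    ultimately show ?thesis by simp
  qed
  have Uder: "(f has_derivative ?A x) (at x within U i)" if "x \<in> U i" for i x
    using Tder[of x i] UT[of i] that by (meson has_derivative_subset subsetD)
  have Uinj: "inj_on f (U i)" for i using T(3) UT by (rule inj_on_subset)
  have fU: "f ` U i \<in> sets lebesgue" for i
  proof (rule differentiable_image_in_sets_lebesgue[OF U])
    show "f differentiable_on U i"
      unfolding differentiable_on_def differentiable_def using Uder by blast
  qed simp
  have fUA: "f ` U i \<subseteq> A" for i by (auto simp: U_def)
  have Am: "A \<in> lmeasurable" using A by (rule fmeasurableI)
  have fUm: "f ` U i \<in> lmeasurable" for i
    by (rule fmeasurableI2[OF Am fUA fU])
  have meas: "(\<lambda>x. indicator (U i) x * ?J x) \<in> borel_measurable lebesgue" for i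
    by (rule det_measurable_inj[OF U Uder Uinj fUm])
  have int: "(\<integral>\<^sup>+ x. indicator (U i) x * ?J x \<partial>lebesgue) = emeasure lebesgue (f ` U i)" for i
    by (rule nn_integral_det_inj[OF U Uder Uinj fUm])
  have "(\<integral>\<^sup>+ x. h x * indicator A (f x) \<partial>lebesgue_on \<Omega>) = (\<integral>\<^sup>+ x. h x * indicator A (f x) * indicator \<Omega> x \<partial>lebesgue)"
    using \<Omega> by (intro nn_integral_restrict_space) auto
  also have "\<dots> \<le> (\<integral>\<^sup>+ x. (\<Sum>i. c * (indicator (U i) x * ?J x)) \<partial>lebesgue)"
  proof (rule nn_integral_mono_AE)
    show "AE x in lebesgue. h x * indicator A (f x) * indicator \<Omega> x \<le> (\<Sum>i. c * (indicator (U i) x * ?J x))"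
      using h T0
    proof eventually_elim
      case (elim x)
      consider "x \<in> \<Omega>" "f x \<in> A" "x \<in> (\<Union>i. T i)" | "x \<in> \<Omega>" "x \<notin> (\<Union>i. T i)" | "x \<notin> \<Omega> \<or> f x \<notin> A" by blast
      then show ?case
      proof cases
        case 1
        then obtain i where i: "x \<in> T i" by blast
        then have "x \<in> U i" using 1 by (auto simp: U_def)
        have "h x \<le> c * (indicator (U i) x * ?J x)"
          using elim(1) 1 Tdiff[OF i] \<open>x \<in> U i\<close> by (simp add: approx_jacobian_def)
        also have "\<dots> \<le> (\<Sum>i. c * (indicator (U i) x * ?J x))"
          using sum_le_suminf[of "\<lambda>i. c * (indicator (U i) x * ?J x)" "{i}"] by simp
        finally show ?thesis using 1 by simp
      next
        case 2
        then show ?thesis using elim by auto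
      qed auto
    qed
  qed
  also have "\<dots> = (\<Sum>i. \<integral>\<^sup>+ x. c * (indicator (U i) x * ?J x) \<partial>lebesgue)"
    by (intro nn_integral_suminf borel_measurable_times_ennreal meas) simp
  also have "\<dots> = (\<Sum>i. c * emeasure lebesgue (f ` U i))"
    by (simp only: nn_integral_cmult[OF meas] int)
  also have "\<dots> = c * (\<Sum>i. \<integral>\<^sup>+ y. indicator (f ` U i) y \<partial>lebesgue)"
    using fU by (simp add: nn_integral_indicator del: emeasure_completion)
  also have "\<dots> = c * (\<integral>\<^sup>+ y. (\<Sum>i. indicator (f ` U i) y) \<partial>lebesgue)"
    using fU by (subst nn_integral_suminf) auto
  also have "\<dots> \<le> c * (\<integral>\<^sup>+ y. of_nat K * indicator (A \<inter> f ` \<Omega>) y \<partial>lebesgue)"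
  proof (intro mult_left_mono nn_integral_mono_AE)
    show "AE y in lebesgue. (\<Sum>i. indicator (f ` U i) y) \<le> (of_nat K * indicator (A \<inter> f ` \<Omega>) y :: ennreal)"
      using AE_not_in[OF K]
    proof eventually_elim
      case (elim y)
      show ?case
      proof (cases "y \<in> A \<inter> f ` \<Omega>")
        case True
        have "disjoint_family U" using T(4) UT by (rule disjoint_family_subset)
        moreover have "U i \<subseteq> \<Omega>" for i using UT T(2) by blast
        \<comment> \<open>The number of preimages is bounded for almost all points of \<Omega>, so
          the image has to lie there.\<close>
        moreover have "y \<in> \<Omega>" using True maps by blast
        ultimately have "(\<Sum>i. indicator (f ` U i) y :: ennreal) \<le> of_nat K"
          using elim by (intro sum_indicator_disjoint_images_le_card[where \<Omega>=\<Omega>]) auto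
        then show ?thesis using True by simp
      next
        case False
        then have "y \<notin> f ` U i" for i using UT T(2) by (auto simp: U_def)
        then show ?thesis by simp
      qed
    qed
  qed simp
  also have "\<dots> = c * of_nat K * emeasure lebesgue (A \<inter> f ` \<Omega>)"
  proof -
    have "A \<inter> f ` \<Omega> \<in> sets lebesgue"
      using image_measurable_lebesgue_if_luzin[OF \<Omega> f AE luzin] A(1) by blast
    then show ?thesis by (simp add: nn_integral_cmult_indicator mult.assoc del: emeasure_completion)
  qed
  finally show ?thesis .
qed

section \<open>The functional equation\<close>

text \<open>There are finitely many index sets, so almost every y avoids all null intersections at
  once. The set of those n whose images contain such a y then has an intersection of positive
  measure and competes in the maximum.\<close>

lemma AE_card_images_le_L_const:
  assumes meas: "\<And>n. n \<in> {1..N} \<Longrightarrow> f n ` \<Omega> \<in> sets lebesgue"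
  shows "AE y in lebesgue. card {n \<in> {1..N}. y \<in> f n ` \<Omega>} \<le> L_const \<Omega> N f"
proof -
  define Z where "Z = {S \<in> Pow {1..N}. S \<noteq> {} \<and> emeasure lebesgue (\<Inter>n\<in>S. f n ` \<Omega>) = 0}"
  have "finite Z" unfolding Z_def by (rule finite_subset[of _ "Pow {1..N}"]) auto
  have "AE y in lebesgue. y \<notin> (\<Inter>n\<in>S. f n ` \<Omega>)" if "S \<in> Z" for S
  proof (rule AE_not_in)
    have S: "S \<subseteq> {1..N}" "S \<noteq> {}" "emeasure lebesgue (\<Inter>n\<in>S. f n ` \<Omega>) = 0" using that by (auto simp: Z_def)
    have "(\<Inter>n\<in>S. f n ` \<Omega>) \<in> sets lebesgue"
      using S finite_subset[OF S(1)] meas by (intro sets.finite_INT) auto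
    then show "(\<Inter>n\<in>S. f n ` \<Omega>) \<in> null_sets lebesgue" using S(3) by (rule null_setsI[rotated])
  qed
  then have "AE y in lebesgue. \<forall>S\<in>Z. y \<notin> (\<Inter>n\<in>S. f n ` \<Omega>)"
    using \<open>finite Z\<close> by (intro AE_finite_allI) auto
  then show ?thesis
  proof eventually_elim
    case (elim y)
    let ?S = "{n \<in> {1..N}. y \<in> f n ` \<Omega>}"
    show ?case
    \<comment> \<open>The empty index set is no candidate in the maximum. If all images are null,
      \<open>L_const\<close> is the unspecified \<open>Max {}\<close>, and only this case can
      occur.\<close>
    proof (cases "?S = {}")
      case True
      then have "card ?S = 0" by (simp only: card.empty)
      then show ?thesis by (metis le0)
    next
      case False
      have "y \<in> (\<Inter>n\<in>?S. f n ` \<Omega>)" by blast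
      then have "?S \<notin> Z" using elim by blast
      then have "emeasure lebesgue (\<Inter>n\<in>?S. f n ` \<Omega>) \<noteq> 0" using False unfolding Z_def by blast
      then have pos: "0 < emeasure lebesgue (\<Inter>n\<in>?S. f n ` \<Omega>)" by (rule zero_less_iff_neq_zero[THEN iffD2])
      have fin: "finite ?S" by simp
      have "0 < card ?S" using False fin by (simp only: card_gt_0_iff) simp
      moreover have "card ?S \<le> card {1..N}" by (rule card_mono) auto
      ultimately have card: "card ?S \<in> {1..N}" by (simp only: card_atLeastAtMost atLeastAtMost_iff) linarith
      have "card ?S \<in> {l \<in> {1..N}. \<exists>S. S \<subseteq> {1..N} \<and> card S = l \<and>
            emeasure lebesgue (\<Inter>n\<in>S. f n ` \<Omega>) > 0}"
        by (intro CollectI conjI exI[of _ ?S] card pos refl) blast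
      then show ?thesis unfolding L_const_def by (intro Max_ge) auto
    qed
  qed
qed

lemma sum_emeasure_images_le:
  assumes meas: "\<And>n. n \<in> {1..N} \<Longrightarrow> f n ` \<Omega> \<in> sets lebesgue" and A: "A \<in> sets lebesgue"
  shows "(\<Sum>n=1..N. emeasure lebesgue (A \<inter> f n ` \<Omega>)) \<le> of_nat (L_const \<Omega> N f) * emeasure lebesgue A"
proof -
  have AE: "AE y in lebesgue. card {n \<in> {1..N}. y \<in> f n ` \<Omega>} \<le> L_const \<Omega> N f"
    using meas by (rule AE_card_images_le_L_const)
  have "(\<Sum>n=1..N. emeasure lebesgue (A \<inter> f n ` \<Omega>)) = (\<Sum>n=1..N. \<integral>\<^sup>+ y. indicator (A \<inter> f n ` \<Omega>) y \<partial>lebesgue)"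
    by (intro sum.cong refl nn_integral_indicator[symmetric] sets.Int A meas)
  also have "\<dots> = (\<integral>\<^sup>+ y. (\<Sum>n=1..N. indicator (A \<inter> f n ` \<Omega>) y) \<partial>lebesgue)"
    using A meas by (intro nn_integral_sum[symmetric] borel_measurable_indicator sets.Int) auto
  also have "\<dots> \<le> (\<integral>\<^sup>+ y. of_nat (L_const \<Omega> N f) * indicator A y \<partial>lebesgue)"
  proof (rule nn_integral_mono_AE)
    show "AE y in lebesgue. (\<Sum>n=1..N. indicator (A \<inter> f n ` \<Omega>) y) \<le> (of_nat (L_const \<Omega> N f) * indicator A y :: ennreal)"
      using AE
    proof eventually_elim
      case (elim y)
      have "(\<Sum>n=1..N. indicator (A \<inter> f n ` \<Omega>) y) = (\<Sum>n\<in>{n \<in> {1..N}. y \<in> f n ` \<Omega>}. indicator A y :: ennreal)"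
        by (rule sum.mono_neutral_cong_right) (auto simp: indicator_def)
      also have "\<dots> = of_nat (card {n \<in> {1..N}. y \<in> f n ` \<Omega>}) * indicator A y" by simp
      also have "\<dots> \<le> of_nat (L_const \<Omega> N f) * indicator A y"
        using elim by (intro mult_right_mono of_nat_mono) auto
      finally show ?case .
    qed
  qed
  also have "\<dots> = of_nat (L_const \<Omega> N f) * emeasure lebesgue A"
    using A by (rule nn_integral_cmult_indicator)
  finally show ?thesis .
qed

text \<open>The part 1 / N of the minimum gives the bound on L^\<infinity>, the Jacobian part the
  bound on L^1: K counts preimages under one map, L counts the maps whose images overlap, and
  together they cancel the denominator.\<close>

lemma transfer_operator_hypothesis_H:
  fixes \<Omega> :: "(real^'n) set" and g :: "nat \<Rightarrow> real^'n \<Rightarrow> 'k::{real_normed_field,banach,second_countable_topology}"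
  assumes \<Omega>: "\<Omega> \<in> sets lebesgue"
    and maps: "\<forall>n\<in>{1..N}. \<forall>x\<in>\<Omega>. f n x \<in> \<Omega>"
    and "K \<ge> 1"
    and H: "hypothesis_H \<Omega> N f g h0 K"
    and alpha: "0 \<le> \<alpha>" "\<alpha> < 1"
    and g_bound: "\<forall>n\<in>{1..N}. AE x in lebesgue. x \<in> \<Omega> \<longrightarrow>
        norm (g n x) \<le> \<alpha> * min (\<bar>approx_jacobian \<Omega> (f n) x\<bar> / (real K * real (L_const \<Omega> N f)))
                                 (1 / real N)"
  shows "transfer_operator (lebesgue_on \<Omega>) N f (\<lambda>n x. ennreal (norm (g n x))) \<alpha>"
proof -
  let ?M = "lebesgue_on \<Omega>" and ?L = "L_const \<Omega> N f"
  have f: "f n \<in> borel_measurable ?M" and diff: "AE x in lebesgue. x \<in> \<Omega> \<longrightarrow> approx_differentiable \<Omega> (f n) x"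
    and luzin: "luzin_N \<Omega> (f n)" and null: "\<And>Z. Z \<in> null_sets lebesgue \<Longrightarrow> f n -` Z \<inter> \<Omega> \<in> null_sets lebesgue"
    and K: "{x \<in> \<Omega>. infinite (f n -` {x} \<inter> \<Omega>) \<or> card (f n -` {x} \<inter> \<Omega>) > K} \<in> null_sets lebesgue"
    and g: "g n \<in> borel_measurable ?M" if "n \<in> {1..N}" for n
    using H that unfolding hypothesis_H_def by blast+
  have im: "f n ` \<Omega> \<in> sets lebesgue" if "n \<in> {1..N}" for n
    by (rule image_measurable_lebesgue_if_luzin[OF \<Omega> f[OF that] diff[OF that] luzin[OF that]])
  have space: "space ?M = \<Omega>" by (simp add: space_restrict_space)
  have gb: "AE x in ?M. norm (g n x) \<le> \<alpha> * min (\<bar>approx_jacobian \<Omega> (f n) x\<bar> / (real K * real ?L)) (1 / real N)"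
    if "n \<in> {1..N}" for n
    using g_bound that \<Omega> by (simp add: AE_restrict_space_iff)
  show ?thesis
  proof
    fix n assume n: "n \<in> {1..N}"
    show "f n \<in> ?M \<rightarrow>\<^sub>M ?M"
    proof (rule measurable_restrict_space2)
      show "f n \<in> space ?M \<rightarrow> \<Omega>" using maps n by (auto simp: space)
      show "f n \<in> ?M \<rightarrow>\<^sub>M lebesgue" by (rule nonsingular_measurable_lebesgue[OF \<Omega> f[OF n] null[OF n]])
    qed
    show "(\<lambda>x. ennreal (norm (g n x))) \<in> borel_measurable ?M" using g[OF n] by measurable
    fix A assume "A \<in> null_sets ?M"
    then have "A \<in> null_sets lebesgue" using \<Omega> by (simp add: null_sets_restrict_space)
    then show "f n -` A \<inter> space ?M \<in> null_sets ?M"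
      using null[OF n] \<Omega> by (simp add: null_sets_restrict_space space)
  next
    have "AE x in ?M. \<forall>n\<in>{1..N}. norm (g n x) \<le> \<alpha> * min (\<bar>approx_jacobian \<Omega> (f n) x\<bar> / (real K * real ?L)) (1 / real N)"
      using gb by (intro AE_finite_allI) auto
    then show "AE x in ?M. (\<Sum>n=1..N. ennreal (norm (g n x))) \<le> ennreal \<alpha>"
    proof eventually_elim
      case (elim x)
      have "norm (g n x) \<le> \<alpha> * (1 / real N)" if "n \<in> {1..N}" for n
      proof -
        have "norm (g n x) \<le> \<alpha> * min (\<bar>approx_jacobian \<Omega> (f n) x\<bar> / (real K * real ?L)) (1 / real N)"
          using elim that by blast
        also have "\<dots> \<le> \<alpha> * (1 / real N)" using alpha by (intro mult_left_mono) auto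
        finally show ?thesis .
      qed
      then have "(\<Sum>n=1..N. norm (g n x)) \<le> (\<Sum>n=1..N. \<alpha> * (1 / real N))" by (rule sum_mono)
      also have "\<dots> \<le> \<alpha>" using alpha by (cases "N = 0") auto
      finally show ?case by (simp add: sum_ennreal ennreal_leI)
    qed
  next
    fix A assume A: "A \<in> sets ?M" "emeasure ?M A < \<infinity>"
    have Al: "A \<in> sets lebesgue" "A \<subseteq> \<Omega>" using A(1) \<Omega> by (auto simp: sets_restrict_space_iff)
    have eA: "emeasure ?M A = emeasure lebesgue A" using Al \<Omega> by (intro emeasure_restrict_space) auto
    define c where "c = \<alpha> / (real K * real ?L)"
    have c: "0 \<le> c" using alpha by (simp add: c_def)
    have "(\<Sum>n=1..N. \<integral>\<^sup>+ x. ennreal (norm (g n x)) * indicator A (f n x) \<partial>?M)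
        \<le> (\<Sum>n=1..N. ennreal c * of_nat K * emeasure lebesgue (A \<inter> f n ` \<Omega>))"
    proof (rule sum_mono)
      fix n assume n: "n \<in> {1..N}"
      have "AE x in lebesgue. x \<in> \<Omega> \<longrightarrow> norm (g n x) \<le> \<alpha> * min (\<bar>approx_jacobian \<Omega> (f n) x\<bar> / (real K * real ?L)) (1 / real N)"
        using g_bound n by blast
      then have "AE x in lebesgue. x \<in> \<Omega> \<longrightarrow> ennreal (norm (g n x)) \<le> ennreal c * ennreal \<bar>approx_jacobian \<Omega> (f n) x\<bar>"
      proof eventually_elim
        case (elim x)
        show ?case
        proof
          assume "x \<in> \<Omega>"
          then have "norm (g n x) \<le> \<alpha> * min (\<bar>approx_jacobian \<Omega> (f n) x\<bar> / (real K * real ?L)) (1 / real N)"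
            using elim by blast
          also have "\<dots> \<le> \<alpha> * (\<bar>approx_jacobian \<Omega> (f n) x\<bar> / (real K * real ?L))"
            using alpha by (intro mult_left_mono) auto
          also have "\<dots> = c * \<bar>approx_jacobian \<Omega> (f n) x\<bar>" by (simp add: c_def)
          finally show "ennreal (norm (g n x)) \<le> ennreal c * ennreal \<bar>approx_jacobian \<Omega> (f n) x\<bar>"
            using c by (simp add: ennreal_leI flip: ennreal_mult)
        qed
      qed
      moreover have "f n ` \<Omega> \<subseteq> \<Omega>" using maps n by blast
      ultimately show "(\<integral>\<^sup>+ x. ennreal (norm (g n x)) * indicator A (f n x) \<partial>?M)
        \<le> ennreal c * of_nat K * emeasure lebesgue (A \<inter> f n ` \<Omega>)"
        using A(2) eA Al by (intro nn_integral_approx_jacobian_le[OF \<Omega> f[OF n] diff[OF n] luzin[OF n] null[OF n] _ K[OF n]]) auto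
    qed
    also have "\<dots> = ennreal c * of_nat K * (\<Sum>n=1..N. emeasure lebesgue (A \<inter> f n ` \<Omega>))"
      by (simp only: sum_distrib_left)
    also have "\<dots> \<le> ennreal c * of_nat K * (of_nat ?L * emeasure lebesgue A)"
      by (intro mult_left_mono sum_emeasure_images_le im Al) auto
    also have "\<dots> = ennreal (c * real K * real ?L) * emeasure lebesgue A"
      using c by (simp add: ennreal_mult ennreal_of_nat_eq_real_of_nat mult.assoc del: emeasure_completion)
    \<comment> \<open>Only an inequality, since for L = 0 the quotient \<open>c\<close> is 0 by
      convention.\<close>
    also have "\<dots> \<le> ennreal \<alpha> * emeasure lebesgue A"
      using alpha \<open>K \<ge> 1\<close> by (intro mult_right_mono ennreal_leI) (auto simp: c_def)
    finally show "(\<Sum>n=1..N. \<integral>\<^sup>+ x. ennreal (norm (g n x)) * indicator A (f n x) \<partial>?M) \<le> ennreal \<alpha> * emeasure ?M A"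
      unfolding eA .
  qed (use alpha in auto)
qed

lemma P_op_diff: "P_op N f g (\<lambda>x. u x - v x) x = P_op N f g u x - P_op N f g v x"
  by (simp add: P_op_def algebra_simps sum_subtractf)

text \<open>The tail from j on is written as \<phi> minus a partial sum, so one function \<phi>
  carries the convergence, the equation and all error bounds. The scalar class includes the reals
  and the complex numbers; its multiplicative norm gives |P \<phi>| \<le> p |\<phi>|.\<close>

theorem theorem3p6:
  fixes \<Omega> :: "(real^'n) set"
    and N K :: nat
    and f :: "nat \<Rightarrow> real^'n \<Rightarrow> real^'n"
    and g :: "nat \<Rightarrow> real^'n \<Rightarrow> 'k::{real_normed_field,banach,second_countable_topology}"
    and h0 :: "real^'n \<Rightarrow> 'k"
    and \<psi> :: "real \<Rightarrow> real"
    and \<alpha> :: real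
  assumes "open \<Omega>"
    and maps: "\<forall>n\<in>{1..N}. \<forall>x\<in>\<Omega>. f n x \<in> \<Omega>"
    and "K \<ge> 1"
    and H: "hypothesis_H \<Omega> N f g h0 K"
    and psi: "admissible_psi \<psi>"
    and h0: "h0 \<in> lorentz_space \<psi> \<Omega>"
    and alpha: "0 \<le> \<alpha>" "\<alpha> < 1/2"
    and g_bound: "\<forall>n\<in>{1..N}. AE x in lebesgue. x \<in> \<Omega> \<longrightarrow>
        norm (g n x) \<le> \<alpha> * min (\<bar>approx_jacobian \<Omega> (f n) x\<bar> / (real K * real (L_const \<Omega> N f)))
                                 (1 / real N)"
  shows "(\<forall>i. (P_op N f g ^^ i) h0 \<in> lorentz_space \<psi> \<Omega>) \<and>
         (\<exists>\<phi> \<in> lorentz_space \<psi> \<Omega>.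
            ((\<lambda>m. lorentz_norm \<psi> \<Omega> (\<lambda>x. \<phi> x - (\<Sum>i<m. (P_op N f g ^^ i) h0 x))) \<longlonglongrightarrow> 0) \<and>
            (AE x in lebesgue. x \<in> \<Omega> \<longrightarrow> \<phi> x = P_op N f g \<phi> x + h0 x) \<and>
            (\<forall>\<phi>' \<in> lorentz_space \<psi> \<Omega>.
               (AE x in lebesgue. x \<in> \<Omega> \<longrightarrow> \<phi>' x = P_op N f g \<phi>' x + h0 x) \<longrightarrow>
               (AE x in lebesgue. x \<in> \<Omega> \<longrightarrow> \<phi>' x = \<phi> x)) \<and>
            (\<forall>j::nat. lorentz_norm \<psi> \<Omega> (\<lambda>x. \<phi> x - (\<Sum>i<j. (P_op N f g ^^ i) h0 x))
                 \<le> (2 * \<alpha>) ^ j / (1 - 2 * \<alpha>) * lorentz_norm \<psi> \<Omega> h0))"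
proof -
  have \<Omega>: "\<Omega> \<in> sets lebesgue" using \<open>open \<Omega>\<close> by auto
  define M where "M = lebesgue_on \<Omega>"
  define P where "P = P_op N f g"
  define W where "W = (\<lambda>(\<phi> :: real^'n \<Rightarrow> 'k) x. ennreal (norm (\<phi> x)))"
  define E where "E = layer_integral (tau_inv \<psi>) M"
  interpret \<sigma>: quasiconcave "tau_inv \<psi>" by (rule quasiconcave_tau_inv[OF psi])
  have T: "transfer_operator M N f (\<lambda>n x. ennreal (norm (g n x))) \<alpha>"
    unfolding M_def using alpha by (intro transfer_operator_hypothesis_H[OF \<Omega> maps \<open>K \<ge> 1\<close> H _ _ g_bound]) auto
  interpret transfer_operator M N f "\<lambda>n x. ennreal (norm (g n x))" \<alpha> by (rule T)
  have AE_iff: "(AE x in lebesgue. x \<in> \<Omega> \<longrightarrow> Q x) \<longleftrightarrow> (AE x in M. Q x)" for Q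
    unfolding M_def by (rule AE_restrict_space_iff[symmetric]) (use \<Omega> in simp)
  have space_iff: "\<phi> \<in> lorentz_space \<psi> \<Omega> \<longleftrightarrow> \<phi> \<in> borel_measurable M \<and> E (W \<phi>) < \<infinity>" for \<phi> :: "real^'n \<Rightarrow> 'k"
    using lorentz_space_iff[OF psi \<Omega>, of \<phi>] by (simp add: M_def E_def W_def)
  have norm_eq: "lorentz_norm \<psi> \<Omega> \<phi> = enn2real (E (W \<phi>))" for \<phi> :: "real^'n \<Rightarrow> 'k"
    by (simp add: lorentz_norm_def lorentz_enorm_eq_layer_integral[OF \<Omega>] M_def E_def W_def)
  have W_meas: "W \<phi> \<in> borel_measurable M" if "\<phi> \<in> borel_measurable M" for \<phi>
    unfolding W_def using that by measurable
  have E_mono: "E v \<le> E w" if "AE x in M. v x \<le> w x" "w \<in> borel_measurable M" for v w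
    unfolding E_def by (rule \<sigma>.layer_integral_mono_AE[OF that])
  have p_mono: "p v x \<le> p w x" if "\<And>x. v x \<le> w x" for v w x
    unfolding p_def using that by (intro sum_mono mult_left_mono) auto

  have g: "g n \<in> borel_measurable M" if "n \<in> {1..N}" for n
    using H that by (simp add: hypothesis_H_def M_def)
  have P_meas: "P \<phi> \<in> borel_measurable M" if "\<phi> \<in> borel_measurable M" for \<phi>
    unfolding P_def P_op_def using f g that
    by (intro borel_measurable_sum borel_measurable_times measurable_compose[of "f _" M M \<phi>]) auto
  have Pi_meas: "(P ^^ i) \<phi> \<in> borel_measurable M" if "\<phi> \<in> borel_measurable M" for i \<phi>
    by (induction i) (use that P_meas in auto)
  have W_P: "W (P \<phi>) x \<le> p (W \<phi>) x" for \<phi> x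
  proof -
    have "norm (P \<phi> x) \<le> (\<Sum>n=1..N. norm (g n x) * norm (\<phi> (f n x)))"
      unfolding P_def P_op_def by (rule order_trans[OF norm_sum]) (simp add: norm_mult)
    then have "W (P \<phi>) x \<le> ennreal (\<Sum>n=1..N. norm (g n x) * norm (\<phi> (f n x)))"
      unfolding W_def by (rule ennreal_leI)
    also have "\<dots> = p (W \<phi>) x"
      by (simp add: p_def W_def ennreal_mult flip: sum_ennreal)
    finally show ?thesis .
  qed
  have W_Pi: "W ((P ^^ i) \<phi>) x \<le> (p ^^ i) (W \<phi>) x" for i \<phi> x
  proof (induction i arbitrary: x)
    case (Suc i)
    have "W ((P ^^ Suc i) \<phi>) x \<le> p (W ((P ^^ i) \<phi>)) x" using W_P by simp
    also have "\<dots> \<le> p ((p ^^ i) (W \<phi>)) x" by (intro p_mono Suc)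
    finally show ?case by simp
  qed simp

  have h0m: "h0 \<in> borel_measurable M" and E0: "E (W h0) < \<infinity>" using h0 space_iff by auto
  note Wh0 = W_meas[OF h0m]
  have tail_meas: "tail j (W h0) \<in> borel_measurable M" for j
    by (rule sup_linear_operator.measurable[OF sup_linear_operator_tail Wh0])
  have E_tail: "E (tail j (W h0)) \<le> 2 * ennreal (\<alpha> ^ j / (1 - \<alpha>)) * E (W h0)" for j
    using \<sigma>.layer_integral_add_tail[OF T _ Wh0, of "\<lambda>_. 0" j] E0 by (simp add: E_def \<sigma>.layer_integral_0)
  have E_power: "E ((p ^^ i) v) \<le> 2 * ennreal (\<alpha> ^ i) * E v" if "v \<in> borel_measurable M" "E v < \<infinity>" for i v
    using \<sigma>.layer_integral_power[OF T that(1)] that(2) by (simp add: E_def)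
  have Pi_space: "(P ^^ i) h0 \<in> lorentz_space \<psi> \<Omega>" for i
  proof -
    have "E (W ((P ^^ i) h0)) \<le> E ((p ^^ i) (W h0))"
      using W_Pi power_measurable[OF Wh0] by (intro E_mono) auto
    also have "\<dots> \<le> 2 * ennreal (\<alpha> ^ i) * E (W h0)" by (rule E_power[OF Wh0 E0])
    also have "\<dots> < \<infinity>" using E0 by (simp add: ennreal_mult_less_top)
    finally show ?thesis using space_iff Pi_meas[OF h0m] by blast
  qed

  \<comment> \<open>Elsewhere the series may diverge, and \<open>suminf\<close> then has an
    unspecified value. Finite quasi-norm of the majorant makes the exceptional set null.\<close>
  define good where "good x \<longleftrightarrow> tail 0 (W h0) x < \<infinity>" for x
  have AE_good: "AE x in M. good x"
  proof -
    have "E (tail 0 (W h0)) < \<infinity>"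
      by (rule le_less_trans[OF E_tail]) (use E0 in \<open>simp add: ennreal_mult_less_top\<close>)
    then show ?thesis unfolding good_def using tail_meas by (intro \<sigma>.AE_finite_layer_integral) (simp_all add: E_def)
  qed
  have summ: "summable (\<lambda>i. norm ((P ^^ i) h0 x))" if "good x" for x
  proof (rule summable_suminf_not_top)
    have "(\<Sum>i. ennreal (norm ((P ^^ i) h0 x))) \<le> tail 0 (W h0) x"
      unfolding tail_def using W_Pi[of _ h0 x] by (intro suminf_le) (auto simp: W_def)
    then show "(\<Sum>i. ennreal (norm ((P ^^ i) h0 x))) \<noteq> top" using that by (auto simp: good_def top_unique)
  qed simp
  define \<phi> where "\<phi> x = (\<Sum>i. (P ^^ i) h0 x)" for x
  have \<phi>_meas: "\<phi> \<in> borel_measurable M"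
    unfolding \<phi>_def using Pi_meas[OF h0m] by measurable
  define rest where "rest j = (\<lambda>x. \<phi> x - (\<Sum>i<j. (P ^^ i) h0 x))" for j
  have rest_le: "W (rest j) x \<le> tail j (W h0) x" if "good x" for j x
  proof -
    have s: "summable (\<lambda>i. norm ((P ^^ (i + j)) h0 x))" by (rule summable_ignore_initial_segment[OF summ[OF that]])
    have "rest j x = (\<Sum>i. (P ^^ (i + j)) h0 x)"
      unfolding rest_def \<phi>_def using suminf_minus_initial_segment[OF summable_norm_cancel[OF summ[OF that]]] by simp
    then have "norm (rest j x) \<le> (\<Sum>i. norm ((P ^^ (i + j)) h0 x))" using summable_norm[OF s] by simp
    then have "W (rest j) x \<le> ennreal (\<Sum>i. norm ((P ^^ (i + j)) h0 x))" unfolding W_def by (rule ennreal_leI)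
    also have "\<dots> = (\<Sum>i. ennreal (norm ((P ^^ (i + j)) h0 x)))" using s by (intro suminf_ennreal2[symmetric]) auto
    also have "\<dots> \<le> tail j (W h0) x"
      unfolding tail_def using W_Pi[of _ h0 x] by (intro suminf_le) (auto simp: W_def)
    finally show ?thesis .
  qed
  have E_rest: "E (W (rest j)) \<le> 2 * ennreal (\<alpha> ^ j / (1 - \<alpha>)) * E (W h0)" for j
  proof -
    have "E (W (rest j)) \<le> E (tail j (W h0))"
      by (intro E_mono tail_meas) (use AE_good rest_le in \<open>auto elim!: eventually_mono\<close>)
    then show ?thesis using E_tail by (rule order_trans)
  qed
  \<comment> \<open>For \<open>j = 0\<close> the constant \<open>2 / (1 - \<alpha>)\<close> above exceeds \<open>1 / (1 - 2 * \<alpha>)\<close> when \<open>\<alpha> < 1/3\<close>; the factor two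
    must be charged to the tail only.\<close>
  have E_rest_0: "E (W \<phi>) \<le> E (W h0) + 2 * ennreal (\<alpha> / (1 - \<alpha>)) * E (W h0)"
  proof -
    have "W \<phi> x \<le> W h0 x + tail 1 (W h0) x" if "good x" for x
    proof -
      have "norm (\<phi> x) \<le> norm (h0 x) + norm (rest 1 x)"
        using norm_triangle_ineq[of "h0 x" "rest 1 x"] by (simp add: rest_def)
      then have "W \<phi> x \<le> W h0 x + W (rest 1) x" unfolding W_def by (simp add: ennreal_leI flip: ennreal_plus)
      then show ?thesis using rest_le[OF that, of 1] by (meson add_left_mono order_trans)
    qed
    then have "E (W \<phi>) \<le> E (\<lambda>x. W h0 x + tail 1 (W h0) x)"
      using AE_good Wh0 tail_meas by (intro E_mono) (auto elim!: eventually_mono)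
    also have "\<dots> \<le> E (W h0) + 2 * ennreal (\<alpha> / (1 - \<alpha>)) * E (W h0)"
      using \<sigma>.layer_integral_add_tail[OF T Wh0 Wh0, of 1] E0 by (simp add: E_def)
    finally show ?thesis .
  qed
  obtain e where e: "E (W h0) = ennreal e" "0 \<le> e" using E0 by (cases "E (W h0)") auto
  have e_norm: "lorentz_norm \<psi> \<Omega> h0 = e" using e by (simp add: norm_eq)
  have rest_norm: "lorentz_norm \<psi> \<Omega> (rest j) \<le> 2 * (\<alpha> ^ j / (1 - \<alpha>)) * e" for j
  proof -
    have "2 * ennreal (\<alpha> ^ j / (1 - \<alpha>)) * E (W h0) = ennreal (2 * (\<alpha> ^ j / (1 - \<alpha>)) * e)"
      using e alpha by (simp add: ennreal_mult del: times_divide_eq_right times_divide_eq_left)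
    then have "enn2real (E (W (rest j))) \<le> enn2real (ennreal (2 * (\<alpha> ^ j / (1 - \<alpha>)) * e))"
      using E_rest[of j] by (intro enn2real_mono) auto
    then show ?thesis using e alpha by (simp add: norm_eq)
  qed
  have bound: "lorentz_norm \<psi> \<Omega> (rest j) \<le> (2 * \<alpha>) ^ j / (1 - 2 * \<alpha>) * lorentz_norm \<psi> \<Omega> h0" for j
  proof (cases "j = 0")
    case True
    have "E (W h0) + 2 * ennreal (\<alpha> / (1 - \<alpha>)) * E (W h0) = ennreal (e + 2 * (\<alpha> / (1 - \<alpha>)) * e)"
      using e alpha by (simp add: ennreal_mult del: times_divide_eq_right times_divide_eq_left)
    then have "enn2real (E (W \<phi>)) \<le> enn2real (ennreal (e + 2 * (\<alpha> / (1 - \<alpha>)) * e))"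
      using E_rest_0 by (intro enn2real_mono) auto
    then have "enn2real (E (W \<phi>)) \<le> e + 2 * (\<alpha> / (1 - \<alpha>)) * e"
      using e alpha by (subst (asm) enn2real_ennreal) auto
    then have "lorentz_norm \<psi> \<Omega> (rest j) \<le> (1 + 2 * (\<alpha> / (1 - \<alpha>))) * e"
      using True by (simp add: norm_eq rest_def distrib_right)
    also have "\<dots> \<le> 1 / (1 - 2 * \<alpha>) * e"
    proof (rule mult_right_mono)
      have "1 + 2 * (\<alpha> / (1 - \<alpha>)) = (1 + \<alpha>) / (1 - \<alpha>)" using alpha by (simp add: field_simps)
      \<comment> \<open>Cross-multiplied, this is 1 - \<alpha> - 2 * \<alpha>^2 \<le> 1 -
        \<alpha>.\<close>
      also have "\<dots> \<le> 1 / (1 - 2 * \<alpha>)" using alpha by (simp add: divide_simps) (simp add: algebra_simps)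
      finally show "1 + 2 * (\<alpha> / (1 - \<alpha>)) \<le> 1 / (1 - 2 * \<alpha>)" .
    qed (rule e)
    finally show ?thesis using True e_norm by simp
  next
    case False
    have "2 * (\<alpha> ^ j / (1 - \<alpha>)) = 2 * \<alpha> ^ j / (1 - \<alpha>)" by simp
    also have "\<dots> \<le> (2 * \<alpha>) ^ j / (1 - 2 * \<alpha>)"
    proof (rule frac_le)
      \<comment> \<open>For j \<ge> 1 the factor 2 of the quasi-norm estimate is absorbed by 2 ^
        j.\<close>
      have "(2::real) ^ 1 \<le> 2 ^ j" using False by (intro power_increasing) auto
      then show "2 * \<alpha> ^ j \<le> (2 * \<alpha>) ^ j" using alpha by (simp add: power_mult_distrib mult_right_mono)
    qed (use alpha in auto)
    finally have "2 * (\<alpha> ^ j / (1 - \<alpha>)) * e \<le> (2 * \<alpha>) ^ j / (1 - 2 * \<alpha>) * e" using e by (intro mult_right_mono)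
    then show ?thesis using rest_norm[of j] e_norm by simp
  qed
  have lim: "(\<lambda>j. lorentz_norm \<psi> \<Omega> (rest j)) \<longlonglongrightarrow> 0"
  proof (rule tendsto_sandwich[OF _ _ tendsto_const])
    show "\<forall>\<^sub>F j in sequentially. 0 \<le> lorentz_norm \<psi> \<Omega> (rest j)" by (simp add: lorentz_norm_def)
    show "\<forall>\<^sub>F j in sequentially. lorentz_norm \<psi> \<Omega> (rest j) \<le> 2 * (\<alpha> ^ j / (1 - \<alpha>)) * e" using rest_norm by simp
    have "(\<lambda>j. 2 * (\<alpha> ^ j / (1 - \<alpha>)) * e) \<longlonglongrightarrow> 2 * (0 / (1 - \<alpha>)) * e"
      using alpha by (intro tendsto_intros LIMSEQ_power_zero) auto
    then show "(\<lambda>j. 2 * (\<alpha> ^ j / (1 - \<alpha>)) * e) \<longlonglongrightarrow> 0" by simp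
  qed

  have \<phi>_space: "\<phi> \<in> lorentz_space \<psi> \<Omega>"
  proof -
    have "E (W \<phi>) < \<infinity>"
      by (rule le_less_trans[OF E_rest_0]) (use E0 in \<open>simp add: ennreal_mult_less_top\<close>)
    then show ?thesis using space_iff \<phi>_meas by blast
  qed
  have solves: "AE x in M. \<phi> x = P \<phi> x + h0 x"
  proof -
    \<comment> \<open>Applying P term by term needs convergence at the points f n x as well, which
      holds almost everywhere because preimages of null sets are null.\<close>
    have "AE x in M. \<forall>n\<in>{1..N}. good (f n x)"
      using AE_compose[OF AE_good] by (intro AE_finite_allI) auto
    with AE_good show ?thesis
    proof eventually_elim
      case (elim x)
      have sm: "summable (\<lambda>i. (P ^^ i) h0 x)" if "good x" for x
        by (rule summable_norm_cancel[OF summ[OF that]])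
      have P_eq: "P \<xi> x = (\<Sum>n=1..N. g n x * \<xi> (f n x))" for \<xi> by (simp add: P_def P_op_def)
      have "P \<phi> x = (\<Sum>n=1..N. \<Sum>i. g n x * (P ^^ i) h0 (f n x))"
        unfolding P_eq \<phi>_def using elim(2) sm by (intro sum.cong refl suminf_mult[symmetric]) simp
      also have "\<dots> = (\<Sum>i. \<Sum>n=1..N. g n x * (P ^^ i) h0 (f n x))"
        using elim(2) sm by (intro suminf_sum[symmetric] summable_mult) auto
      also have "\<dots> = (\<Sum>i. (P ^^ Suc i) h0 x)" by (simp add: P_eq)
      also have "\<dots> = \<phi> x - h0 x"
        unfolding \<phi>_def using suminf_split_head[OF sm[OF elim(1)]] by simp
      finally show ?case by simp
    qed
  qed
  have unique: "AE x in M. \<phi>' x = \<phi> x"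
    if \<phi>': "\<phi>' \<in> lorentz_space \<psi> \<Omega>" and eq: "AE x in M. \<phi>' x = P \<phi>' x + h0 x" for \<phi>'
  proof -
    \<comment> \<open>The difference solves the homogeneous equation, so its modulus is dominated by
      all its iterates under \<open>p\<close>. The quasi-triangle inequality only has to make its
      quasi-norm finite.\<close>
    define d where "d x = \<phi>' x - \<phi> x" for x
    have \<phi>'m: "\<phi>' \<in> borel_measurable M" "E (W \<phi>') < \<infinity>" and \<phi>m: "E (W \<phi>) < \<infinity>"
      using \<phi>' \<phi>_space space_iff by auto
    have dm: "d \<in> borel_measurable M" unfolding d_def using \<phi>'m \<phi>_meas by measurable
    have "W d x \<le> W \<phi>' x + W \<phi> x" for x
      unfolding W_def d_def using norm_triangle_ineq4[of "\<phi>' x" "\<phi> x"] by (simp add: ennreal_leI flip: ennreal_plus)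
    then have "E (W d) \<le> E (\<lambda>x. W \<phi>' x + W \<phi> x)"
      using W_meas \<phi>'m \<phi>_meas by (intro E_mono) auto
    also have "\<dots> \<le> E (W \<phi>') + 2 * E (W \<phi>)"
      unfolding E_def using W_meas \<phi>'m \<phi>_meas \<phi>m by (intro \<sigma>.layer_integral_add_le) (auto simp: E_def)
    also have "\<dots> < \<infinity>" using \<phi>'m \<phi>m by (simp add: ennreal_mult_less_top)
    finally have Ed: "E (W d) < \<infinity>" .
    have "AE x in M. W d x \<le> p (W d) x"
      using eq solves
    proof eventually_elim
      case (elim x)
      have "d x = P d x" unfolding d_def[abs_def] P_def P_op_diff using elim by (simp add: P_def)
      then show ?case using W_P[of d x] by (simp add: W_def)
    qed
    then have iter: "AE x in M. W d x \<le> (p ^^ i) (W d) x" for i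
    proof (induction i)
      case (Suc i)
      have "AE x in M. p (W d) x \<le> p ((p ^^ i) (W d)) x" by (rule p_mono_AE[OF Suc.IH[OF Suc.prems]])
      with Suc.prems show ?case by eventually_elim (simp add: order_trans)
    qed simp
    obtain c where c: "E (W d) = ennreal c" "0 \<le> c" using Ed by (cases "E (W d)") auto
    have "c \<le> 2 * \<alpha> ^ i * c" for i
    proof -
      have "E (W d) \<le> E ((p ^^ i) (W d))" by (rule E_mono[OF iter power_measurable[OF W_meas[OF dm]]])
      also have "\<dots> \<le> 2 * ennreal (\<alpha> ^ i) * E (W d)" by (rule E_power[OF W_meas[OF dm] Ed])
      finally have "ennreal c \<le> ennreal (2 * \<alpha> ^ i * c)" using c alpha by (simp add: ennreal_mult)
      then show ?thesis using c alpha by simp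
    qed
    \<comment> \<open>Any exponent i with 2 * \<alpha>^i < 1 forces c = 0; for i = 2 the factor is
      at most 1/2.\<close>
    from this[of 2] have "c * (1 - 2 * \<alpha> ^ 2) \<le> 0" by (simp add: algebra_simps)
    moreover have "2 * \<alpha> ^ 2 < 1"
    proof -
      have "\<alpha> ^ 2 \<le> (1/2) ^ 2" using alpha by (intro power_mono) auto
      then show ?thesis by (simp add: power2_eq_square)
    qed
    ultimately have "c = 0" using c(2) by (simp add: mult_le_0_iff)
    then have "AE x in M. W d x = 0"
      using c W_meas[OF dm] by (intro \<sigma>.AE_0_layer_integral) (simp_all add: E_def)
    then show ?thesis by eventually_elim (simp add: W_def d_def)
  qed
  show ?thesis
    unfolding AE_iff P_def[symmetric] using Pi_space lim bound solves unique \<phi>_space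
    unfolding rest_def by blast
qed

end
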